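(* Let $q_0$ be a prime power and let $X$ be a polynomial count variety over $\mathbb F_{q_0}$, i.e. there is a polynomial $N_X\in\mathbb Z[q]$ such that $\#X(\mathbb F_{q_0^r})=N_X(q_0^r)$ for all $r\in\mathbb N$ (with $r\ge 1$). Let $C=(\mathcal C,|\cdot|,W)$ be coloring data with weights in $R=\mathbb Z[[q,t_1,\dots,t_N]][q^{-1},t_1^{-1},\dots,t_N^{-1}]$. Let $Z_C(X,t,T)$ be the coloring zeta function of $X$, with the cardinality of the ground field identified with the variable $q$ of $R$ (as made precise in the context). Then $Z_C(X,t,T)\in 1+T\,R[[T]]$ and $$\mathrm{Log}\bigl(Z_C(X,t,T)\bigr)=N_X(q)\,\mathrm{Log}\bigl(Z_C(\bullet,t,T)\bigr)\quad\text{in } R[[T]].$$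
   Context: Coloring data $C=(\mathcal C,|\cdot|,W)$ consists of: a set $\mathcal C$ of colors; a degree function $|\cdot|:\mathcal C\to\mathbb Z_{\ge 0}$ such that there are finitely many colors of each degree and there is a unique color $0\in\mathcal C$ of degree $0$; and a weight function $W:\mathcal C\to R$ with $W(0)=1$. Here $R=\mathbb Z[[q,t_1,\dots,t_N]][q^{-1},t_1^{-1},\dots,t_N^{-1}]$ with $q,t_1,\dots,t_N$ formal variables. For $f\in R$ and an integer $d\ge 1$, $f(q^d,t^d)$ denotes the result of substituting $q\mapsto q^d$ and $t_i\mapsto t_i^d$ for all $i$. For $m\in\mathbb Z^N$, $t^m=t_1^{m_1}\cdots t_N^{m_N}$. Log: every $Z\in 1+T\,R[[T]]$ can be written uniquely as $Z=\prod_{i\in\mathbb Z,\ m\in\mathbb Z^N,\ d\ge1}(1-q^it^mT^d)^{-v_{d,i,m}}$ with integers $v_{d,i,m}$ such that $\sum_{i,m}v_{d,i,m}q^it^m\in R$ for each $d$; one defines $\mathrm{Log}(Z)=\sum_{d\ge1,\ i\in\mathbb Z,\ m\in\mathbb Z^N}v_{d,i,m}\,q^it^mT^d\in R[[T]]$. Colorings: let $\overline{\mathbb F}$ be an algebraic closure of $\mathbb F_{q_0}$. A coloring on $X$ is a map $\Lambda:X(\overline{\mathbb F})\to\mathcal C$ with $\Lambda(x)=0$ for all but finitely many $x$; its degree is $|\Lambda|=\sum_x|\Lambda(x)|$. For $r\ge1$ it is a coloring of $X/\mathbb F_{q_0^r}$ if it is invariant under the Frobenius $\mathrm{Frob}_{q_0}^r$,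 i.e. $\Lambda(\mathrm{Frob}_{q_0}^r(x))=\Lambda(x)$ for all $x$. The type $\tau(\Lambda)$ of a coloring $\Lambda$ of $X/\mathbb F_{q_0^r}$ is the collection of multiplicities $\{m_{d,\lambda}\}_{d\ge1,\ \lambda\in\mathcal C,\ \lambda\ne0}$, where $m_{d,\lambda}$ is the number of $\mathrm{Frob}_{q_0}^r$-orbits $\{x\}$ of size $d$ in $X(\overline{\mathbb F})$ with $\Lambda(x)=\lambda$. The degree and the weight of $\Lambda$ depend only on its type: $|\Lambda|=|\tau|:=\sum_{d,\lambda}m_{d,\lambda}\,d\,|\lambda|$ and $W(\Lambda)=W(\tau):=\prod_{d\ge1,\ \lambda\ne0}W(\lambda)(q^d,t^d)^{m_{d,\lambda}}\in R$. The coloring zeta function is $Z_C(X,t,T)=\sum_\Lambda W(\Lambda)T^{|\Lambda|}$, summed over all colorings of $X$ over the ground field. The identification of the cardinality of the ground field with the variable $q$ means the following: since $X$ is polynomial count, for each type $\tau$ (a finitely supported family $\{m_{d,\lambda}\}$ of non-negative integers) there is a unique polynomial $P_\tau\in\mathbb Q[q]$ such that, for every $r\ge1$, $P_\tau(q_0^r)$ is the number of colorings of $X/\mathbb F_{q_0^r}$ of type $\tau$; then $Z_C(X,t,T)=\sum_\tau P_\tau(q)\,W(\tau)\,T^{|\tau|}$, with $q$ the formal variable in $R$. For $X=\bullet$ a point, $Z_C(\bullet,t,T)=\sum_{\lambda\in\mathcal C}W(\lambda)T^{|\lambda|}\in 1+T\,R[[T]]$. *)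

theory Defs
  imports
    "HOL-Library.Cardinality"
    "HOL-Library.Poly_Mapping"
    "HOL-Computational_Algebra.Formal_Power_Series"
    "HOL-Combinatorics.Orbits"
    "HOL-Algebra.Algebraic_Closure_Type"
begin

abbreviation "lookup \<equiv> Poly_Mapping.lookup"
abbreviation "keys \<equiv> Poly_Mapping.keys"

section \<open>Multivariate formal Laurent series\<close>

text \<open>
  The variable with index \<open>0\<close> plays the role of \<open>q\<close>, the variable with index \<open>i \<ge> 1\<close>
  that of \<open>t\<^sub>i\<close>; an exponent vector \<open>(i, m)\<close> is a finitely supported map
  from variable indices to integers. An element of the type \<open>mls\<close> involves only
  finitely many variables, and its exponents are bounded from below, i.e. it becomes a power
  series after multiplication with some monomial.
\<close>

definition bounded_supp :: "nat \<Rightarrow> int \<Rightarrow> ((nat \<Rightarrow>\<^sub>0 int) \<Rightarrow> 'a::zero) \<Rightarrow> bool" where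
  "bounded_supp N b f \<longleftrightarrow>
     (\<forall>m. f m \<noteq> 0 \<longrightarrow> keys m \<subseteq> {..N} \<and> (\<forall>i. b \<le> lookup m i))"

lemma bounded_suppD:
  assumes "bounded_supp N b f" "f m \<noteq> 0"
  shows "keys m \<subseteq> {..N}" "b \<le> lookup m i"
  using assms unfolding bounded_supp_def by blast+

lemma bounded_supp_mono:
  "bounded_supp N b f \<Longrightarrow> N \<le> N' \<Longrightarrow> b' \<le> b \<Longrightarrow> bounded_supp N' b' f"
  unfolding bounded_supp_def by (meson atMost_subset_iff order_trans)

lemma bounded_supp_common:
  assumes "\<exists>N b. bounded_supp N b f" "\<exists>N b. bounded_supp N b g"
  obtains N b where "b \<le> 0" "bounded_supp N b f" "bounded_supp N b g"
proof -
  obtain N b N' b' where *: "bounded_supp N b f" "bounded_supp N' b' g"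
    using assms by blast
  show thesis
    by (rule that[of "min 0 (min b b')" "max N N'"])
       (auto intro: bounded_supp_mono[OF *(1)] bounded_supp_mono[OF *(2)])
qed

typedef (overloaded) 'a mls =
  "{f :: (nat \<Rightarrow>\<^sub>0 int) \<Rightarrow> 'a::zero. \<exists>N b. bounded_supp N b f}"
  morphisms mls_nth Abs_mls
  by (rule exI[of _ "\<lambda>_. 0"]) (simp add: bounded_supp_def)

setup_lifting type_definition_mls

lemma mls_eqI: "(\<And>m. mls_nth f m = mls_nth g m) \<Longrightarrow> f = g"
  by transfer auto

definition box :: "nat \<Rightarrow> int \<Rightarrow> (nat \<Rightarrow>\<^sub>0 int) \<Rightarrow> (nat \<Rightarrow>\<^sub>0 int) set" where
  "box N b u = {m. keys m \<subseteq> {..N} \<and> (\<forall>i. b \<le> lookup m i \<and> lookup m i \<le> lookup u i - b)}"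

lemma finite_box: "finite (box N b u)"
proof -
  define c where "c = Max (lookup u ` {..N}) - b"
  let ?F = "{f :: nat \<Rightarrow> int. \<forall>i. (i \<in> {..N} \<longrightarrow> f i \<in> {b..c}) \<and> (i \<notin> {..N} \<longrightarrow> f i = 0)}"
  have fin: "finite ?F"
    by (rule finite_set_of_finite_funs) auto
  have le: "lookup u i - b \<le> c" if "i \<le> N" for i
    unfolding c_def using that by (auto intro!: Max_ge)
  have "lookup ` box N b u \<subseteq> ?F"
  proof (clarify, intro conjI impI)
    fix m i assume m: "m \<in> box N b u"
    show "lookup m i \<in> {b..c}" if "i \<in> {..N}"
      using m le[of i] that unfolding box_def by (auto intro: order_trans)
    show "lookup m i = 0" if "i \<notin> {..N}"
      using m that unfolding box_def by (auto simp: in_keys_iff)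
  qed
  with fin have "finite (lookup ` box N b u)"
    by (rule finite_subset[rotated])
  moreover have "inj_on lookup (box N b u)"
    by (auto simp: inj_on_def intro: poly_mapping_eqI)
  ultimately show ?thesis
    by (rule finite_imageD)
qed

definition conv :: "((nat \<Rightarrow>\<^sub>0 int) \<Rightarrow> 'a::comm_ring_1) \<Rightarrow> ((nat \<Rightarrow>\<^sub>0 int) \<Rightarrow> 'a) \<Rightarrow> (nat \<Rightarrow>\<^sub>0 int) \<Rightarrow> 'a" where
  "conv f g m = (\<Sum>a | f a \<noteq> 0 \<and> g (m - a) \<noteq> 0. f a * g (m - a))"

lemma conv_eq_sum:
  assumes "finite A" "{a. f a \<noteq> 0 \<and> g (m - a) \<noteq> 0} \<subseteq> A"
  shows "conv f g m = (\<Sum>a\<in>A. f a * g (m - a))"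
  unfolding conv_def using assms by (intro sum.mono_neutral_left) auto

lemma conv_supp_subset:
  assumes "bounded_supp N b f" "bounded_supp N b' g"
  shows "{a. f a \<noteq> 0 \<and> g (m - a) \<noteq> 0} \<subseteq> box N (min b b') m"
proof
  fix a assume "a \<in> {a. f a \<noteq> 0 \<and> g (m - a) \<noteq> 0}"
  hence "keys a \<subseteq> {..N}" "\<And>i. b \<le> lookup a i" "\<And>i. b' \<le> lookup m i - lookup a i"
    using assms unfolding bounded_supp_def by (auto simp: lookup_minus)
  moreover from this have "lookup a i \<le> lookup m i - min b b'" for i
    by (smt (verit))
  ultimately show "a \<in> box N (min b b') m"
    unfolding box_def by (auto simp: min_le_iff_disj)
qed

lemma bounded_supp_conv:
  assumes "bounded_supp N b f" "bounded_supp N b' g"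
  shows "bounded_supp N (b + b') (conv f g)"
  unfolding bounded_supp_def
proof (intro allI impI)
  fix m assume "conv f g m \<noteq> 0"
  then obtain a where a: "f a \<noteq> 0" "g (m - a) \<noteq> 0"
    unfolding conv_def by (auto elim!: sum.not_neutral_contains_not_neutral)
  have *: "keys a \<subseteq> {..N}" "keys (m - a) \<subseteq> {..N}"
    "\<And>i. b \<le> lookup a i" "\<And>i. b' \<le> lookup (m - a) i"
    using a assms unfolding bounded_supp_def by blast+
  have "keys m \<subseteq> keys a \<union> keys (m - a)"
    by (metis add.commute diff_add_cancel keys_add)
  moreover have "b + b' \<le> lookup m i" for i
    using *(3,4)[of i] by (simp add: lookup_minus)
  ultimately show "keys m \<subseteq> {..N} \<and> (\<forall>i. b + b' \<le> lookup m i)"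
    using * by blast
qed

lemma conv_commute: "conv f g = conv g f"
proof
  fix m show "conv f g m = conv g f m"
    unfolding conv_def
    by (rule sum.reindex_bij_witness[of _ "\<lambda>a. m - a" "\<lambda>a. m - a"]) (auto simp: mult.commute)
qed

lemma conv_assoc:
  assumes f: "\<exists>N b. bounded_supp N b f"
    and g: "\<exists>N b. bounded_supp N b g" and h: "\<exists>N b. bounded_supp N b h"
  shows "conv (conv f g) h = conv f (conv g h)"
proof
  fix m
  obtain N1 b1 where 1: "b1 \<le> 0" "bounded_supp N1 b1 f" "bounded_supp N1 b1 g"
    using bounded_supp_common[OF f g] .
  obtain N b where b: "b \<le> b1" "N1 \<le> N" "bounded_supp N b h"
  proof -
    obtain N2 b2 where "bounded_supp N2 b2 h" using h by blast
    thus thesis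
      by (intro that[of "min b1 b2" "max N1 N2"]) (auto intro: bounded_supp_mono)
  qed
  have bf: "bounded_supp N b f" and bg: "bounded_supp N b g" and bh: "bounded_supp N b h"
    and b0: "b \<le> 0"
    using 1 b by (auto intro: bounded_supp_mono)
  define S where "S = box N (b + b) m"
  have fin: "finite S" by (simp add: S_def finite_box)
  have memS: "s \<in> S" if "keys s \<subseteq> {..N}" "\<And>i. b + b \<le> lookup s i" "\<And>i. b \<le> lookup m i - lookup s i" for s
  proof -
    have "lookup s i \<le> lookup m i - (b + b)" for i using that(3)[of i] b0 by linarith
    thus ?thesis unfolding S_def box_def using that by auto
  qed
  define A where "A = box N (b + b) m"
  have finA: "finite A" by (simp add: A_def finite_box)
  have memA: "a \<in> A" if "keys a \<subseteq> {..N}" "\<And>i. b \<le> lookup a i" "\<And>i. b + b \<le> lookup m i - lookup a i" for a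
  proof -
    have "lookup a i \<le> lookup m i - (b + b)" for i using that(3)[of i] b0 by linarith
    moreover have "b + b \<le> lookup a i" for i using that(2)[of i] b0 by linarith
    ultimately show ?thesis unfolding A_def box_def using that by auto
  qed
  have "conv (conv f g) h m = (\<Sum>s\<in>S. conv f g s * h (m - s))"
  proof (rule conv_eq_sum[OF fin], rule subsetI)
    fix s assume "s \<in> {a. conv f g a \<noteq> 0 \<and> h (m - a) \<noteq> 0}"
    hence s: "conv f g s \<noteq> 0" "h (m - s) \<noteq> 0" by auto
    show "s \<in> S"
      using bounded_suppD[OF bounded_supp_conv[OF bf bg] s(1)] bounded_suppD(2)[OF bh s(2)]
      by (intro memS) (simp_all add: lookup_minus)
  qed
  also have "\<dots> = (\<Sum>s\<in>S. \<Sum>a\<in>A. f a * g (s - a) * h (m - s))"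
  proof (rule sum.cong[OF refl])
    fix s assume s: "s \<in> S"
    show "conv f g s * h (m - s) = (\<Sum>a\<in>A. f a * g (s - a) * h (m - s))"
    proof (cases "h (m - s) = 0")
      case False
      have "conv f g s = (\<Sum>a\<in>A. f a * g (s - a))"
      proof (rule conv_eq_sum[OF finA], rule subsetI)
        fix a assume "a \<in> {a. f a \<noteq> 0 \<and> g (s - a) \<noteq> 0}"
        hence a: "f a \<noteq> 0" "g (s - a) \<noteq> 0" by auto
        have "b \<le> lookup s i - lookup a i" "b \<le> lookup m i - lookup s i" for i
          using bg bh a(2) False unfolding bounded_supp_def by (auto simp: lookup_minus)
        hence "b + b \<le> lookup m i - lookup a i" for i by (smt (verit))
        thus "a \<in> A" using bf a(1) unfolding bounded_supp_def by (intro memA) auto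
      qed
      thus ?thesis by (simp add: sum_distrib_right)
    qed simp
  qed
  also have "\<dots> = (\<Sum>a\<in>A. \<Sum>s\<in>S. f a * g (s - a) * h (m - s))"
    by (rule sum.swap)
  also have "\<dots> = (\<Sum>a\<in>A. f a * conv g h (m - a))"
  proof (rule sum.cong[OF refl])
    fix a assume a: "a \<in> A"
    show "(\<Sum>s\<in>S. f a * g (s - a) * h (m - s)) = f a * conv g h (m - a)"
    proof (cases "f a = 0")
      case False
      have "conv g h (m - a) = (\<Sum>c\<in>(\<lambda>s. s - a) ` S. g c * h (m - a - c))"
      proof (rule conv_eq_sum)
        show "finite ((\<lambda>s. s - a) ` S)" using fin by simp
        show "{c. g c \<noteq> 0 \<and> h (m - a - c) \<noteq> 0} \<subseteq> (\<lambda>s. s - a) ` S"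
        proof
          fix c assume "c \<in> {c. g c \<noteq> 0 \<and> h (m - a - c) \<noteq> 0}"
          hence c: "g c \<noteq> 0" "h (m - a - c) \<noteq> 0" by auto
          have *: "keys a \<subseteq> {..N}" "\<And>i. b \<le> lookup a i" "keys c \<subseteq> {..N}" "\<And>i. b \<le> lookup c i"
            "\<And>i. b \<le> lookup m i - lookup a i - lookup c i"
            using bf bg bh False c unfolding bounded_supp_def by (auto simp: lookup_minus)
          have "c + a \<in> S"
          proof (rule memS)
            show "keys (c + a) \<subseteq> {..N}" using *(1,3) keys_add[of c a] by blast
            show "b + b \<le> lookup (c + a) i" for i
              using *(2)[of i] *(4)[of i] by (simp add: lookup_add)
            show "b \<le> lookup m i - lookup (c + a) i" for i
              using *(5)[of i] by (simp add: lookup_add)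
          qed
          thus "c \<in> (\<lambda>s. s - a) ` S" by (auto intro!: image_eqI[of _ _ "c + a"])
        qed
      qed
      also have "\<dots> = (\<Sum>s\<in>S. g (s - a) * h (m - s))"
        by (subst sum.reindex) (auto simp: inj_on_def)
      finally show ?thesis by (simp add: sum_distrib_left mult.assoc)
    qed simp
  qed
  also have "\<dots> = conv f (conv g h) m"
  proof (rule conv_eq_sum[OF finA, symmetric], rule subsetI)
    fix a assume "a \<in> {a. f a \<noteq> 0 \<and> conv g h (m - a) \<noteq> 0}"
    hence a: "f a \<noteq> 0" "conv g h (m - a) \<noteq> 0" by auto
    show "a \<in> A"
      using bounded_suppD[OF bf a(1)] bounded_suppD(2)[OF bounded_supp_conv[OF bg bh] a(2)]
      by (intro memA) (simp_all add: lookup_minus)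
  qed
  finally show "conv (conv f g) h m = conv f (conv g h) m" .
qed

instantiation mls :: (comm_ring_1) comm_ring_1
begin

lift_definition zero_mls :: "'a mls" is "\<lambda>_. 0"
  by (simp add: bounded_supp_def)

lift_definition one_mls :: "'a mls" is "\<lambda>m. if m = 0 then 1 else 0"
  by (rule exI[of _ 0], rule exI[of _ 0]) (simp add: bounded_supp_def)

lift_definition plus_mls :: "'a mls \<Rightarrow> 'a mls \<Rightarrow> 'a mls" is "\<lambda>f g m. f m + g m"
proof -
  fix f g :: "(nat \<Rightarrow>\<^sub>0 int) \<Rightarrow> 'a"
  assume "\<exists>N b. bounded_supp N b f" "\<exists>N b. bounded_supp N b g"
  then obtain N b where "bounded_supp N b f" "bounded_supp N b g"
    by (rule bounded_supp_common)
  hence "bounded_supp N b (\<lambda>m. f m + g m)"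
    unfolding bounded_supp_def by (metis add_0)
  thus "\<exists>N b. bounded_supp N b (\<lambda>m. f m + g m)" by blast
qed

lift_definition uminus_mls :: "'a mls \<Rightarrow> 'a mls" is "\<lambda>f m. - f m"
  by (simp add: bounded_supp_def)

lift_definition minus_mls :: "'a mls \<Rightarrow> 'a mls \<Rightarrow> 'a mls" is "\<lambda>f g m. f m - g m"
proof -
  fix f g :: "(nat \<Rightarrow>\<^sub>0 int) \<Rightarrow> 'a"
  assume "\<exists>N b. bounded_supp N b f" "\<exists>N b. bounded_supp N b g"
  then obtain N b where "bounded_supp N b f" "bounded_supp N b g"
    by (rule bounded_supp_common)
  hence "bounded_supp N b (\<lambda>m. f m - g m)"
    unfolding bounded_supp_def by (metis diff_0_right)
  thus "\<exists>N b. bounded_supp N b (\<lambda>m. f m - g m)" by blast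
qed

lift_definition times_mls :: "'a mls \<Rightarrow> 'a mls \<Rightarrow> 'a mls" is conv
proof -
  fix f g :: "(nat \<Rightarrow>\<^sub>0 int) \<Rightarrow> 'a"
  assume "\<exists>N b. bounded_supp N b f" "\<exists>N b. bounded_supp N b g"
  then obtain N b where "bounded_supp N b f" "bounded_supp N b g"
    by (rule bounded_supp_common)
  thus "\<exists>N b. bounded_supp N b (conv f g)"
    by (blast intro: bounded_supp_conv)
qed

instance
proof
  fix f g h :: "'a mls"
  show "f * g * h = f * (g * h)" by transfer (rule conv_assoc)
  show "f * g = g * f" by transfer (rule conv_commute)
  show "1 * f = f"
  proof transfer
    fix f :: "(nat \<Rightarrow>\<^sub>0 int) \<Rightarrow> 'a"
    show "conv (\<lambda>m. if m = 0 then 1 else 0) f = f"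
    proof
      fix m show "conv (\<lambda>m. if m = 0 then 1 else 0) f m = f m"
        by (subst conv_eq_sum[of "{0}"]) (auto split: if_splits)
    qed
  qed
  show "(f + g) * h = f * h + g * h"
  proof transfer
    fix f g h :: "(nat \<Rightarrow>\<^sub>0 int) \<Rightarrow> 'a"
    assume fg: "\<exists>N b. bounded_supp N b f" "\<exists>N b. bounded_supp N b g"
      and h: "\<exists>N b. bounded_supp N b h"
    show "conv (\<lambda>m. f m + g m) h = (\<lambda>m. conv f h m + conv g h m)"
    proof
      fix m
      define A where "A = {a. f a \<noteq> 0 \<and> h (m - a) \<noteq> 0} \<union> {a. g a \<noteq> 0 \<and> h (m - a) \<noteq> 0}"
      have "finite A"
      proof -
        obtain N1 b1 where 1: "bounded_supp N1 b1 f" "bounded_supp N1 b1 h"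
          using bounded_supp_common[OF fg(1) h] .
        obtain N2 b2 where 2: "bounded_supp N2 b2 g" "bounded_supp N2 b2 h"
          using bounded_supp_common[OF fg(2) h] .
        show ?thesis
          unfolding A_def
          using finite_subset[OF conv_supp_subset[OF 1] finite_box]
            finite_subset[OF conv_supp_subset[OF 2] finite_box] by blast
      qed
      moreover have "{a. f a + g a \<noteq> 0 \<and> h (m - a) \<noteq> 0} \<subseteq> A"
        unfolding A_def by auto
      moreover have "{a. f a \<noteq> 0 \<and> h (m - a) \<noteq> 0} \<subseteq> A" "{a. g a \<noteq> 0 \<and> h (m - a) \<noteq> 0} \<subseteq> A"
        unfolding A_def by auto
      ultimately show "conv (\<lambda>m. f m + g m) h m = conv f h m + conv g h m"
        by (simp only: conv_eq_sum[of A] sum.distrib distrib_right)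
    qed
  qed
  show "f + g + h = f + (g + h)" by transfer (simp add: add.assoc)
  show "f + g = g + f" by transfer (simp add: add.commute)
  show "0 + f = f" by transfer simp
  show "- f + f = 0" by transfer simp
  show "f - g = f + - g" by transfer simp
  show "(0 :: 'a mls) \<noteq> 1"
  proof
    assume "(0 :: 'a mls) = 1"
    hence "mls_nth (0 :: 'a mls) 0 = mls_nth 1 0" by simp
    thus False by (simp add: zero_mls.rep_eq one_mls.rep_eq)
  qed
qed

end

lift_definition mls_const :: "'a::zero \<Rightarrow> 'a mls" is "\<lambda>c m. if m = 0 then c else 0"
  by (rule exI[of _ 0], rule exI[of _ 0]) (simp add: bounded_supp_def)

definition mls_monom :: "(nat \<Rightarrow>\<^sub>0 int) \<Rightarrow> 'a::zero_neq_one mls" where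
  "mls_monom a = Abs_mls (\<lambda>m. if m = a then 1 else 0)"

lemma mls_nth_monom: "mls_nth (mls_monom a) m = (if m = a then 1 else 0)"
proof -
  obtain N where "keys a \<subseteq> {..N}"
    using finite_nat_set_iff_bounded_le[of "keys a"] by auto
  moreover have "Min (insert 0 (lookup a ` keys a)) \<le> lookup a i" for i
    by (cases "i \<in> keys a") (auto simp: Min_le_iff in_keys_iff)
  ultimately have "bounded_supp N (Min (insert 0 (lookup a ` keys a)))
      (\<lambda>m. if m = a then 1 else (0::'a))"
    unfolding bounded_supp_def by simp
  hence "\<exists>N b. bounded_supp N b (\<lambda>m. if m = a then 1 else (0::'a))"
    by blast
  thus ?thesis
    unfolding mls_monom_def by (subst Abs_mls_inverse) auto
qed

definition q_var :: "rat mls" where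
  "q_var = mls_monom (Poly_Mapping.single 0 1)"

text \<open>The substitution of every variable by its \<open>d\<close>-th power (meant for \<open>d \<ge> 1\<close>).\<close>

lift_definition mls_subst_power :: "nat \<Rightarrow> 'a::zero mls \<Rightarrow> 'a mls" is
  "\<lambda>d f m. if \<forall>i. int d dvd lookup m i then f (Poly_Mapping.map (\<lambda>k. k div int d) m) else 0"
proof -
  fix d :: nat and f :: "(nat \<Rightarrow>\<^sub>0 int) \<Rightarrow> 'a"
  assume "\<exists>N b. bounded_supp N b f"
  then obtain N b where f: "bounded_supp N b f" by blast
  have "bounded_supp N (int d * b)
    (\<lambda>m. if \<forall>i. int d dvd lookup m i then f (Poly_Mapping.map (\<lambda>k. k div int d) m) else 0)"
    unfolding bounded_supp_def
  proof (intro allI impI)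
    fix m :: "nat \<Rightarrow>\<^sub>0 int"
    define m' where "m' = Poly_Mapping.map (\<lambda>k. k div int d) m"
    assume "(if \<forall>i. int d dvd lookup m i then f (Poly_Mapping.map (\<lambda>k. k div int d) m) else 0) \<noteq> 0"
    hence d: "\<And>i. int d dvd lookup m i" and nz: "f m' \<noteq> 0"
      by (auto simp: m'_def split: if_splits)
    have m: "lookup m i = int d * lookup m' i" for i
      using d[of i] by (auto simp: m'_def Poly_Mapping.map.rep_eq when_def elim!: dvdE)
    have "keys m' \<subseteq> {..N}" "\<And>i. b \<le> lookup m' i"
      using f nz unfolding bounded_supp_def by blast+
    thus "keys m \<subseteq> {..N} \<and> (\<forall>i. int d * b \<le> lookup m i)"
      by (auto simp: m in_keys_iff subset_iff mult_left_mono)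
  qed
  thus "\<exists>N b. bounded_supp N b
    (\<lambda>m. if \<forall>i. int d dvd lookup m i then f (Poly_Mapping.map (\<lambda>k. k div int d) m) else 0)"
    by blast
qed

text \<open>
  The ring \<open>R = \<int>[[q, t\<^sub>1, \<dots>, t\<^sub>N]][q\<inverse>, t\<^sub>1\<inverse>, \<dots>, t\<^sub>N\<inverse>]\<close>,
  as a subring of the Laurent series with rational coefficients, and \<open>R[[T]]\<close>.
\<close>

definition R_ring :: "nat \<Rightarrow> rat mls set" where
  "R_ring N = {f. \<forall>m. mls_nth f m \<in> \<int> \<and> (mls_nth f m \<noteq> 0 \<longrightarrow> keys m \<subseteq> {..N})}"

definition R_fps :: "nat \<Rightarrow> rat mls fps set" where
  "R_fps N = {F. \<forall>n. fps_nth F n \<in> R_ring N}"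


section \<open>The plethystic logarithm\<close>

definition fps_powi :: "'a::comm_ring_1 fps \<Rightarrow> int \<Rightarrow> 'a fps" where
  \<comment> \<open>integer powers of a series with constant coefficient 1\<close>
  "fps_powi F k = (if k \<ge> 0 then F ^ nat k else fps_left_inverse F 1 ^ nat (- k))"

text \<open>Unconditional convergence of a product, coefficientwise in \<open>T\<close>, \<open>q\<close> and the \<open>t\<^sub>i\<close>.\<close>

definition has_formal_prod :: "('i \<Rightarrow> rat mls fps) \<Rightarrow> 'i set \<Rightarrow> rat mls fps \<Rightarrow> bool" where
  "has_formal_prod F I Z \<longleftrightarrow>
     (\<forall>k m. \<forall>\<^sub>F S in finite_subsets_at_top I.
        mls_nth (fps_nth (\<Prod>s\<in>S. F s) k) m = mls_nth (fps_nth Z k) m)"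

text \<open>The factor \<open>(1 - q\<^sup>i t\<^sup>m T\<^sup>d) ^ (-v)\<close>, where \<open>a\<close> is the exponent vector \<open>(i, m)\<close>.\<close>

definition euler_factor :: "nat \<Rightarrow> (nat \<Rightarrow>\<^sub>0 int) \<Rightarrow> int \<Rightarrow> rat mls fps" where
  "euler_factor d a v = fps_powi (1 - fps_const (mls_monom a) * fps_X ^ d) (- v)"

text \<open>
  The family of integers \<open>v\<close> is encoded by the series
  \<open>V = (\<Sum>d i m. v\<^bsub>d,i,m\<^esub> q\<^sup>i t\<^sup>m T\<^sup>d)\<close>.
  Its coefficients are integers by \<open>V \<in> R_fps N\<close>, so \<open>floor\<close> only converts the type.
\<close>

definition is_Log :: "nat \<Rightarrow> rat mls fps \<Rightarrow> rat mls fps \<Rightarrow> bool" where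
  "is_Log N Z V \<longleftrightarrow> V \<in> R_fps N \<and> fps_nth V 0 = 0 \<and>
     has_formal_prod (\<lambda>(d, a). euler_factor d a \<lfloor>mls_nth (fps_nth V d) a\<rfloor>)
       ({1..} \<times> {a. keys a \<subseteq> {..N}}) Z"

definition Log :: "nat \<Rightarrow> rat mls fps \<Rightarrow> rat mls fps" where
  "Log N Z = (THE V. is_Log N Z V)"


section \<open>Varieties over a finite field\<close>

text \<open>
  The ground field is the finite type \<open>'k\<close>, so the prime power \<open>q\<^sub>0\<close> is \<open>CARD('k)\<close>.
  Varieties are described by their geometric points together with a finite atlas of affine
  charts defined over \<open>'k\<close> (as in Serre's and Weil's definitions); as \<open>'k\<close> is perfect,
  this is the same as a reduced separated scheme of finite type over \<open>'k\<close>. Irreducibility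
  is not required.
\<close>

type_synonym 'k mpoly = "(nat \<Rightarrow>\<^sub>0 nat) \<Rightarrow>\<^sub>0 'k"

definition mpoly_eval :: "'k::field mpoly \<Rightarrow> (nat \<Rightarrow> 'k alg_closure) \<Rightarrow> 'k alg_closure" where
  "mpoly_eval p a =
     (\<Sum>m\<in>keys p. to_ac (lookup p m) * (\<Prod>i\<in>keys m. a i ^ lookup m i))"

text \<open>
  Points of affine \<open>n\<close>-space are padded with zeros. Polynomials may therefore be allowed to
  contain further variables, which vanish on affine \<open>n\<close>-space.
\<close>

definition affine_space :: "nat \<Rightarrow> (nat \<Rightarrow> 'k::field alg_closure) set" where
  "affine_space n = {a. \<forall>i\<ge>n. a i = 0}"

definition zero_locus :: "'k::field mpoly set \<Rightarrow> (nat \<Rightarrow> 'k alg_closure) set" where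
  "zero_locus S = {a. \<forall>p\<in>S. mpoly_eval p a = 0}"

definition zariski_closed :: "nat \<Rightarrow> (nat \<Rightarrow> 'k::field alg_closure) set \<Rightarrow> bool" where
  "zariski_closed n A \<longleftrightarrow> (\<exists>S. A = affine_space n \<inter> zero_locus S)"

definition zariski_open_in ::
    "(nat \<Rightarrow> 'k::field alg_closure) set \<Rightarrow> (nat \<Rightarrow> 'k alg_closure) set \<Rightarrow> bool" where
  "zariski_open_in Z A \<longleftrightarrow> (\<exists>S. A = Z - zero_locus S)"

definition regular_fun ::
    "(nat \<Rightarrow> 'k::field alg_closure) set \<Rightarrow> ((nat \<Rightarrow> 'k alg_closure) \<Rightarrow> 'k alg_closure) \<Rightarrow> bool" where
  "regular_fun A g \<longleftrightarrow>
     (\<forall>a\<in>A. \<exists>P Q. mpoly_eval Q a \<noteq> 0 \<and>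
        (\<forall>b\<in>A. mpoly_eval Q b \<noteq> 0 \<longrightarrow> g b = mpoly_eval P b / mpoly_eval Q b))"

definition join_coords :: "nat \<Rightarrow> (nat \<Rightarrow> 'b) \<Rightarrow> (nat \<Rightarrow> 'b) \<Rightarrow> nat \<Rightarrow> 'b" where
  "join_coords n a b i = (if i < n then a i else b (i - n))"

record (overloaded) ('k, 'x) variety =
  points :: "'x set"
  charts :: "('x set \<times> nat \<times> ('x \<Rightarrow> nat \<Rightarrow> 'k alg_closure)) set"

definition is_variety :: "('k::field, 'x) variety \<Rightarrow> bool" where
  "is_variety Y \<longleftrightarrow>
     finite (charts Y) \<and>
     (\<Union>(U, n, \<phi>)\<in>charts Y. U) = points Y \<and>
     (\<forall>(U, n, \<phi>)\<in>charts Y. inj_on \<phi> U \<and> zariski_closed n (\<phi> ` U)) \<and>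
     (\<forall>(U, n, \<phi>)\<in>charts Y. \<forall>(V, k, \<psi>)\<in>charts Y.
        zariski_open_in (\<phi> ` U) (\<phi> ` (U \<inter> V)) \<and>
        (\<forall>j<k. regular_fun (\<phi> ` (U \<inter> V)) (\<lambda>a. \<psi> (inv_into U \<phi> a) j)) \<and>
        \<comment> \<open>separatedness: the diagonal is closed\<close>
        zariski_closed (n + k) ((\<lambda>x. join_coords n (\<phi> x) (\<psi> x)) ` (U \<inter> V)))"

definition frob :: "('k::{field,finite}, 'x) variety \<Rightarrow> 'x \<Rightarrow> 'x" where
  "frob Y x = (THE y. \<exists>(U, n, \<phi>)\<in>charts Y. x \<in> U \<and> y \<in> U \<and> \<phi> y = (\<lambda>i. \<phi> x i ^ CARD('k)))"

text \<open>\<open>Y(\<F>)\<close> for the extension \<open>\<F>\<close> of degree \<open>r\<close> of the ground field inside its algebraic closure.\<close>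

definition subfield_ext :: "nat \<Rightarrow> 'k::{field,finite} alg_closure set" where
  "subfield_ext r = {y. y ^ (CARD('k) ^ r) = y}"

definition rational_points :: "('k::{field,finite}, 'x) variety \<Rightarrow> nat \<Rightarrow> 'x set" where
  "rational_points Y r =
     {x. \<exists>(U, n, \<phi>)\<in>charts Y. x \<in> U \<and> (\<forall>i<n. \<phi> x i \<in> subfield_ext r)}"

definition polynomial_count :: "('k::{field,finite}, 'x) variety \<Rightarrow> int poly \<Rightarrow> bool" where
  "polynomial_count Y NY \<longleftrightarrow>
     (\<forall>r\<ge>1. int (card (rational_points Y r)) = poly NY (int (CARD('k) ^ r)))"

definition point_variety :: "('k::field, unit) variety" where
  "point_variety = \<lparr>points = {()}, charts = {({()}, 0, \<lambda>_ _. 0)}\<rparr>"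


section \<open>Coloring data and the coloring zeta function\<close>

record 'c coloring_data =
  colors :: "'c set"
  cdeg :: "'c \<Rightarrow> nat"
  weight :: "'c \<Rightarrow> rat mls"

definition zero_color :: "'c coloring_data \<Rightarrow> 'c" where
  "zero_color C = (THE c. c \<in> colors C \<and> cdeg C c = 0)"

definition is_coloring_data :: "nat \<Rightarrow> 'c coloring_data \<Rightarrow> bool" where
  "is_coloring_data N C \<longleftrightarrow>
     (\<forall>n. finite {c \<in> colors C. cdeg C c = n}) \<and>
     (\<exists>!c. c \<in> colors C \<and> cdeg C c = 0) \<and>
     (\<forall>c\<in>colors C. weight C c \<in> R_ring N) \<and>
     weight C (zero_color C) = 1"

text \<open>
  Colorings of \<open>Y\<close> over the extension of degree \<open>r\<close> of the ground field. So that
  different functions are different colorings, they take the value \<open>zero_color\<close> outside of \<open>Y\<close>.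
\<close>

definition colorings ::
    "'c coloring_data \<Rightarrow> ('k::{field,finite}, 'x) variety \<Rightarrow> nat \<Rightarrow> ('x \<Rightarrow> 'c) set" where
  "colorings C Y r = {\<Lambda>.
     (\<forall>x\<in>points Y. \<Lambda> x \<in> colors C) \<and>
     (\<forall>x. x \<notin> points Y \<longrightarrow> \<Lambda> x = zero_color C) \<and>
     finite {x \<in> points Y. \<Lambda> x \<noteq> zero_color C} \<and>
     (\<forall>x\<in>points Y. \<Lambda> ((frob Y ^^ r) x) = \<Lambda> x)}"

type_synonym 'c ctype = "nat \<Rightarrow> 'c \<Rightarrow> nat"

definition ctype_supp :: "'c ctype \<Rightarrow> (nat \<times> 'c) set" where
  "ctype_supp \<tau> = {(d, c). \<tau> d c \<noteq> 0}"

definition ctypes :: "'c coloring_data \<Rightarrow> 'c ctype set" where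
  "ctypes C = {\<tau>. finite (ctype_supp \<tau>) \<and> ctype_supp \<tau> \<subseteq> {1..} \<times> (colors C - {zero_color C})}"

definition coloring_type ::
    "'c coloring_data \<Rightarrow> ('k::{field,finite}, 'x) variety \<Rightarrow> nat \<Rightarrow> ('x \<Rightarrow> 'c) \<Rightarrow> 'c ctype" where
  "coloring_type C Y r \<Lambda> d c =
     (if d \<ge> 1 \<and> c \<in> colors C - {zero_color C}
      then card {B. \<exists>x\<in>points Y. B = orbit (frob Y ^^ r) x \<and> card B = d \<and> \<Lambda> x = c}
      else 0)"

definition ctype_degree :: "'c coloring_data \<Rightarrow> 'c ctype \<Rightarrow> nat" where
  "ctype_degree C \<tau> = (\<Sum>(d, c)\<in>ctype_supp \<tau>. \<tau> d c * d * cdeg C c)"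

definition ctype_weight :: "'c coloring_data \<Rightarrow> 'c ctype \<Rightarrow> rat mls" where
  "ctype_weight C \<tau> = (\<Prod>(d, c)\<in>ctype_supp \<tau>. mls_subst_power d (weight C c) ^ \<tau> d c)"

definition ctype_count_poly ::
    "'c coloring_data \<Rightarrow> ('k::{field,finite}, 'x) variety \<Rightarrow> 'c ctype \<Rightarrow> rat poly" where
  "ctype_count_poly C Y \<tau> = (THE P. \<forall>r\<ge>1.
     poly P (of_nat (CARD('k) ^ r)) =
       of_nat (card {\<Lambda> \<in> colorings C Y r. coloring_type C Y r \<Lambda> = \<tau>}))"

definition at_q :: "rat poly \<Rightarrow> rat mls" where
  "at_q P = poly (map_poly mls_const P) q_var"

text \<open>For coloring data there are only finitely many types of a given degree.\<close>

definition coloring_zeta ::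
    "'c coloring_data \<Rightarrow> ('k::{field,finite}, 'x) variety \<Rightarrow> rat mls fps" where
  "coloring_zeta C Y = Abs_fps (\<lambda>n.
     \<Sum>\<tau> | \<tau> \<in> ctypes C \<and> ctype_degree C \<tau> = n.
       at_q (ctype_count_poly C Y \<tau>) * ctype_weight C \<tau>)"

end

theory Submission
  imports Defs
begin

text \<open>
  Let \<open>\<psi>\<^sub>n\<close> be the substitution of every variable by its \<open>n\<close>-th power (\<open>mls_subst_power\<close> on
  coefficients, \<open>fps_adams\<close> on power series in \<open>T\<close>), let \<open>\<theta> = T d/dT\<close>, and call \<open>A\<close> the
  logarithmic derivative of \<open>Z\<close> if \<open>Z\<close> has constant coefficient 1 and \<open>\<theta> Z = Z A\<close>
  (\<open>has_dlog\<close>).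

  The factor \<open>(1 - q\<^sup>i t\<^sup>m T\<^sup>d)\<close> raised to the power \<open>-v\<close> has the logarithmic derivative
  \<open>\<Sum>\<^sub>n \<psi>\<^sub>n (\<theta> (v q\<^sup>i t\<^sup>m T\<^sup>d))\<close>. Hence \<open>V\<close> is the plethystic logarithm of \<open>Z\<close> if and only if
  \<open>Z\<close> has the logarithmic derivative \<open>\<Sum>\<^sub>n \<psi>\<^sub>n (\<theta> V)\<close>, which is called \<open>plog_deriv V\<close> below; this is
  \<open>is_Log_iff\<close>. The passage from finite products to the infinite one uses the topology
  on Laurent series in which a series is small if all its exponents have large total degree: sums,
  products and the \<open>\<psi>\<^sub>n\<close> are continuous for it, and limits are limits of coefficients.
  Every series over \<open>R\<close> with constant coefficient 1 has a plethystic logarithm over \<open>R\<close>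
  (\<open>ex_is_Log\<close>), and it is unique (\<open>Log_eqI\<close>).

  On the arithmetic side, Frobenius acts on the geometric points with finite orbits, and the points
  of \<open>X\<close> over the extension of degree \<open>r\<close> are the fixed points of its \<open>r\<close>-th power. So the
  number of orbits of size \<open>d\<close> is given by polynomials \<open>m\<^sub>d\<close> (\<open>orbit_poly\<close>) with
  \<open>\<Sum>\<^bsub>d | n\<^esub> d m\<^sub>d(q) = N\<^sub>X(q\<^sup>n)\<close>. If the type \<open>\<tau>\<close> arises from \<open>\<sigma>\<close> by adding one orbit of
  size \<open>d\<close> and color \<open>c\<close>, then counting the pairs of a coloring of type \<open>\<tau>\<close> and one of its
  orbits of size \<open>d\<close> and color \<open>c\<close>, by removing the color of this orbit, gives
  \<open>\<tau>\<^bsub>d,c\<^esub> P\<^sub>\<tau> = (m\<^sub>d - \<Sum>\<^sub>b \<sigma>\<^bsub>d,b\<^esub>) P\<^sub>\<sigma>\<close> (\<open>colorings_of_type_recursion\<close>). This shows that the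
  \<open>P\<^sub>\<tau>\<close> exist, and it is all that is needed about them.

  Let \<open>F = \<Sum>\<^sub>c W(c) T\<^bsup>|c|\<^esup>\<close> (\<open>color_series\<close>), \<open>F\<^sub>d = \<psi>\<^sub>d F\<close>, \<open>Z = \<Sum>\<^sub>\<tau> P\<^sub>\<tau> W(\<tau>) T\<^bsup>|\<tau>|\<^esup>\<close> and
  \<open>U\<^sub>d = \<Sum>\<^sub>\<tau> (m\<^sub>d - \<Sum>\<^sub>b \<tau>\<^bsub>d,b\<^esub>) P\<^sub>\<tau> W(\<tau>) T\<^bsup>|\<tau>|\<^esup>\<close>. The recursion gives
  \<open>m\<^sub>d Z - U\<^sub>d = (F\<^sub>d - 1) U\<^sub>d\<close> and \<open>\<theta> Z = \<Sum>\<^sub>d \<theta>(F\<^sub>d) U\<^sub>d\<close>. Hence \<open>m\<^sub>d Z = F\<^sub>d U\<^sub>d\<close>, and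
  \<open>Z\<close> has the logarithmic derivative \<open>\<Sum>\<^sub>d d m\<^sub>d \<psi>\<^sub>d (\<theta> F / F)\<close>. If \<open>V\<close> is the plethystic logarithm
  of \<open>F\<close>, so that \<open>\<theta> F / F = \<Sum>\<^sub>n \<psi>\<^sub>n (\<theta> V)\<close>, this sum equals
  \<open>\<Sum>\<^sub>n \<psi>\<^sub>n (N\<^sub>X) \<psi>\<^sub>n (\<theta> V) = \<Sum>\<^sub>n \<psi>\<^sub>n (\<theta> (N\<^sub>X V))\<close>, i.e. \<open>N\<^sub>X V\<close> is the plethystic logarithm of \<open>Z\<close>
  (\<open>has_dlog_coloring_zeta\<close>). The same result for the point, where \<open>N\<^sub>X = 1\<close>, shows that its
  coloring zeta function is \<open>F\<close>.
\<close>

section \<open>Coefficients of multivariate Laurent series\<close>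

lemmas mls_nth_simps =
  zero_mls.rep_eq one_mls.rep_eq plus_mls.rep_eq minus_mls.rep_eq uminus_mls.rep_eq
  mls_const.rep_eq

lemma mls_nth_sum: "mls_nth (\<Sum>x\<in>A. f x) m = (\<Sum>x\<in>A. mls_nth (f x) m)"
  by (induction A rule: infinite_finite_induct) (auto simp: mls_nth_simps)

lemma mls_nth_mult: "mls_nth (f * g) m = conv (mls_nth f) (mls_nth g) m"
  by (simp add: times_mls.rep_eq)

lemma mls_nth_mult_nonzeroE:
  assumes "mls_nth (f * g) m \<noteq> 0"
  obtains a b where "m = a + b" "mls_nth f a \<noteq> 0" "mls_nth g b \<noteq> 0"
proof -
  obtain a where "mls_nth f a \<noteq> 0" "mls_nth g (m - a) \<noteq> 0"
    using assms unfolding mls_nth_mult conv_def by (auto elim!: sum.not_neutral_contains_not_neutral)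
  thus thesis by (intro that[of a "m - a"]) auto
qed

lemma mls_const_mult_nth: "mls_nth (mls_const c * f) m = c * mls_nth f m"
  unfolding mls_nth_mult by (subst conv_eq_sum[of "{0}"]) (auto simp: mls_nth_simps split: if_splits)

lemma mls_const_0 [simp]: "mls_const 0 = 0"
  by (rule mls_eqI) (simp add: mls_nth_simps)

lemma mls_const_1 [simp]: "mls_const 1 = 1"
  by (rule mls_eqI) (simp add: mls_nth_simps)

lemma mls_const_add: "mls_const (a + b :: 'a :: comm_ring_1) = mls_const a + mls_const b"
  by (rule mls_eqI) (simp add: mls_nth_simps)

lemma mls_const_mult: "mls_const (a * b :: 'a :: comm_ring_1) = mls_const a * mls_const b"
  by (rule mls_eqI) (simp add: mls_const_mult_nth, simp add: mls_nth_simps)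

lemma mls_const_of_nat: "mls_const (of_nat n :: 'a :: comm_ring_1) = of_nat n"
  by (induction n) (simp_all add: mls_const_add)

lemma mls_const_of_int: "mls_const (of_int n :: 'a :: comm_ring_1) = of_int n"
proof -
  have neg: "mls_const (- a :: 'a) = - mls_const a" for a
    by (rule mls_eqI) (simp add: mls_nth_simps)
  show ?thesis
    by (cases n rule: int_cases2) (simp_all add: neg mls_const_of_nat)
qed

lemma mls_nth_of_nat_mult: "mls_nth (of_nat n * f) m = of_nat n * mls_nth f m"
  by (simp add: mls_const_mult_nth flip: mls_const_of_nat)

lemma mls_nth_of_int_mult: "mls_nth (of_int n * f) m = of_int n * mls_nth f m"
  by (simp add: mls_const_mult_nth flip: mls_const_of_int)

lemma mls_of_nat_mult_cancel:
  fixes f g :: "rat mls"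
  assumes "of_nat n * f = of_nat n * g" "n > 0"
  shows "f = g"
proof (rule mls_eqI)
  fix m
  from assms(1) have "mls_nth (of_nat n * f) m = mls_nth (of_nat n * g) m" by simp
  thus "mls_nth f m = mls_nth g m" using assms(2) by (simp add: mls_nth_of_nat_mult)
qed

lemma mls_of_nat_mult_inverse: "n > 0 \<Longrightarrow> of_nat n * (mls_const (1 / of_nat n) * f) = (f :: rat mls)"
  by (rule mls_eqI) (simp add: mls_nth_of_nat_mult mls_const_mult_nth)

lemma mls_monom_0 [simp]: "mls_monom 0 = (1 :: 'a :: comm_ring_1 mls)"
  by (rule mls_eqI) (simp add: mls_nth_simps mls_nth_monom)

lemma mls_monom_mult: "mls_monom a * mls_monom b = (mls_monom (a + b) :: 'a :: comm_ring_1 mls)"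
proof (rule mls_eqI)
  fix m
  have "m - a = b \<longleftrightarrow> m = a + b" by (auto simp: algebra_simps)
  thus "mls_nth (mls_monom a * mls_monom b :: 'a mls) m = mls_nth (mls_monom (a + b)) m"
    unfolding mls_nth_mult
    by (subst conv_eq_sum[of "{a}"]) (auto simp: mls_nth_monom split: if_splits)
qed

section \<open>Adams operations\<close>

text \<open>The map \<open>a \<mapsto> n a\<close> on exponent vectors.\<close>

definition exp_scale :: "nat \<Rightarrow> (nat \<Rightarrow>\<^sub>0 int) \<Rightarrow> (nat \<Rightarrow>\<^sub>0 int)" where
  "exp_scale n = Poly_Mapping.map (\<lambda>k. int n * k)"

lemma lookup_exp_scale: "lookup (exp_scale n a) i = int n * lookup a i"
  by (auto simp: exp_scale_def Poly_Mapping.map.rep_eq when_def)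

lemma exp_scale_add: "exp_scale n (a + b) = exp_scale n a + exp_scale n b"
  by (rule poly_mapping_eqI) (simp add: lookup_exp_scale lookup_add algebra_simps)

lemma exp_scale_diff: "exp_scale n (a - b) = exp_scale n a - exp_scale n b"
  by (rule poly_mapping_eqI) (simp add: lookup_exp_scale lookup_minus algebra_simps)

lemma exp_scale_0 [simp]: "exp_scale n 0 = 0" "exp_scale 0 a = 0"
  by (rule poly_mapping_eqI; simp add: lookup_exp_scale)+

lemma exp_scale_Suc: "exp_scale (Suc n) a = a + exp_scale n a"
  by (rule poly_mapping_eqI) (simp add: lookup_exp_scale lookup_add algebra_simps)

lemma exp_scale_exp_scale: "exp_scale m (exp_scale n a) = exp_scale (m * n) a"
  by (rule poly_mapping_eqI) (simp add: lookup_exp_scale)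

lemma exp_scale_eq_iff: "n > 0 \<Longrightarrow> exp_scale n a = exp_scale n b \<longleftrightarrow> a = b"
  by (metis lookup_exp_scale mult_cancel_left of_nat_0_eq_iff poly_mapping_eqI less_numeral_extra(3))

lemma keys_exp_scale: "n > 0 \<Longrightarrow> keys (exp_scale n a) = keys a"
  by (auto simp: in_keys_iff lookup_exp_scale)

lemma mls_monom_power: "mls_monom a ^ n = (mls_monom (exp_scale n a) :: 'a :: comm_ring_1 mls)"
  by (induction n) (simp_all add: mls_monom_mult exp_scale_Suc)

lemma mls_nth_subst_power_exp_scale:
  assumes "n > 0"
  shows "mls_nth (mls_subst_power n f) (exp_scale n a) = mls_nth f a"
proof -
  have "Poly_Mapping.map (\<lambda>k. k div int n) (exp_scale n a) = a"
    using assms by (intro poly_mapping_eqI)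
      (auto simp: Poly_Mapping.map.rep_eq lookup_exp_scale when_def)
  thus ?thesis by (simp add: mls_subst_power.rep_eq lookup_exp_scale)
qed

lemma mls_nth_subst_power_outside:
  assumes "m \<notin> range (exp_scale n)"
  shows "mls_nth (mls_subst_power n f) m = 0"
proof -
  have "\<not> (\<forall>i. int n dvd lookup m i)"
  proof
    assume "\<forall>i. int n dvd lookup m i"
    hence "m = exp_scale n (Poly_Mapping.map (\<lambda>k. k div int n) m)"
      by (intro poly_mapping_eqI) (auto simp: Poly_Mapping.map.rep_eq lookup_exp_scale when_def)
    thus False using assms by blast
  qed
  thus ?thesis by (auto simp: mls_subst_power.rep_eq)
qed

lemma mls_nth_subst_power_nonzeroE:
  assumes "n > 0" "mls_nth (mls_subst_power n f) m \<noteq> 0"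
  obtains a where "m = exp_scale n a" "mls_nth f a \<noteq> 0"
  by (metis assms mls_nth_subst_power_exp_scale mls_nth_subst_power_outside rangeE)

lemma mls_subst_power_eqI:
  assumes "n > 0" "\<And>a. mls_nth g (exp_scale n a) = mls_nth f a"
    "\<And>m. m \<notin> range (exp_scale n) \<Longrightarrow> mls_nth g m = 0"
  shows "mls_subst_power n f = g"
proof (rule mls_eqI)
  fix m show "mls_nth (mls_subst_power n f) m = mls_nth g m"
    using assms
    by (cases "m \<in> range (exp_scale n)")
       (auto simp: mls_nth_subst_power_exp_scale mls_nth_subst_power_outside)
qed

lemma mls_subst_power_0 [simp]: "n > 0 \<Longrightarrow> mls_subst_power n 0 = 0"
  by (rule mls_subst_power_eqI) (auto simp: mls_nth_simps)

lemma mls_subst_power_const: "n > 0 \<Longrightarrow> mls_subst_power n (mls_const c) = mls_const c"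
proof (rule mls_subst_power_eqI)
  assume n: "n > 0"
  show "mls_nth (mls_const c) (exp_scale n a) = mls_nth (mls_const c) a" for a
    using exp_scale_eq_iff[OF n, of a 0] by (simp add: mls_const.rep_eq)
  show "mls_nth (mls_const c) m = 0" if "m \<notin> range (exp_scale n)" for m
    using that by (auto simp: mls_const.rep_eq intro: range_eqI[of _ _ 0])
qed

lemma mls_subst_power_1 [simp]: "n > 0 \<Longrightarrow> mls_subst_power n 1 = (1 :: 'a :: comm_ring_1 mls)"
  using mls_subst_power_const[of n "1 :: 'a"] by simp

lemma mls_subst_power_of_nat [simp]:
  "n > 0 \<Longrightarrow> mls_subst_power n (of_nat k) = (of_nat k :: 'a :: comm_ring_1 mls)"
  using mls_subst_power_const[of n "of_nat k :: 'a"] by (simp add: mls_const_of_nat)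

lemma mls_subst_power_of_int [simp]:
  "n > 0 \<Longrightarrow> mls_subst_power n (of_int k) = (of_int k :: 'a :: comm_ring_1 mls)"
  using mls_subst_power_const[of n "of_int k :: 'a"] by (simp add: mls_const_of_int)

lemma mls_subst_power_monom:
  "n > 0 \<Longrightarrow> mls_subst_power n (mls_monom a) = (mls_monom a ^ n :: 'a :: comm_ring_1 mls)"
  unfolding mls_monom_power
  by (rule mls_subst_power_eqI) (auto simp: mls_nth_monom exp_scale_eq_iff)

lemma mls_subst_power_add:
  "n > 0 \<Longrightarrow> mls_subst_power n (f + g) = mls_subst_power n f + mls_subst_power n (g :: 'a :: comm_ring_1 mls)"
  by (rule mls_subst_power_eqI)
     (auto simp: mls_nth_simps mls_nth_subst_power_exp_scale mls_nth_subst_power_outside)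

lemma mls_subst_power_diff:
  "n > 0 \<Longrightarrow> mls_subst_power n (f - g) = mls_subst_power n f - mls_subst_power n (g :: 'a :: comm_ring_1 mls)"
  by (rule mls_subst_power_eqI)
     (auto simp: mls_nth_simps mls_nth_subst_power_exp_scale mls_nth_subst_power_outside)

lemma mls_subst_power_mult:
  fixes f g :: "'a :: comm_ring_1 mls"
  assumes n: "n > 0"
  shows "mls_subst_power n (f * g) = mls_subst_power n f * mls_subst_power n g"
proof (rule mls_subst_power_eqI[OF n])
  fix a
  let ?f = "mls_nth f" and ?g = "mls_nth g" and ?s = "exp_scale n"
  let ?F = "mls_nth (mls_subst_power n f)" and ?G = "mls_nth (mls_subst_power n g)"
  have eq: "{x. ?F x \<noteq> 0 \<and> ?G (?s a - x) \<noteq> 0} = ?s ` {b. ?f b \<noteq> 0 \<and> ?g (a - b) \<noteq> 0}"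
  proof (intro equalityI subsetI)
    fix x assume x: "x \<in> {x. ?F x \<noteq> 0 \<and> ?G (?s a - x) \<noteq> 0}"
    then obtain b where "x = ?s b" "?f b \<noteq> 0"
      using mls_nth_subst_power_nonzeroE[OF n] by blast
    moreover from this x have "?g (a - b) \<noteq> 0"
      by (simp add: mls_nth_subst_power_exp_scale[OF n] flip: exp_scale_diff)
    ultimately show "x \<in> ?s ` {b. ?f b \<noteq> 0 \<and> ?g (a - b) \<noteq> 0}" by blast
  qed (auto simp: mls_nth_subst_power_exp_scale[OF n] simp flip: exp_scale_diff)
  have inj: "inj_on ?s A" for A by (simp add: inj_on_def exp_scale_eq_iff n)
  show "mls_nth (mls_subst_power n f * mls_subst_power n g) (?s a) = mls_nth (f * g) a"
    unfolding mls_nth_mult conv_def eq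
    by (subst sum.reindex[OF inj])
       (simp add: mls_nth_subst_power_exp_scale[OF n] flip: exp_scale_diff)
next
  fix m assume "m \<notin> range (exp_scale n)"
  thus "mls_nth (mls_subst_power n f * mls_subst_power n g) m = 0"
    by (metis (no_types, lifting) exp_scale_add mls_nth_mult_nonzeroE
          mls_nth_subst_power_nonzeroE n rangeI)
qed

lemma mls_subst_power_sum:
  fixes f :: "_ \<Rightarrow> 'a :: comm_ring_1 mls"
  shows "n > 0 \<Longrightarrow> mls_subst_power n (\<Sum>x\<in>A. f x) = (\<Sum>x\<in>A. mls_subst_power n (f x))"
  by (induction A rule: infinite_finite_induct) (simp_all add: mls_subst_power_add)

lemma mls_subst_power_by_1: "mls_subst_power 1 f = f"
proof (rule mls_eqI)
  fix m
  have "exp_scale 1 m = m" using exp_scale_Suc[of 0 m] by simp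
  thus "mls_nth (mls_subst_power 1 f) m = mls_nth f m"
    using mls_nth_subst_power_exp_scale[of 1 f m] by simp
qed

lemma mls_subst_power_subst_power:
  assumes "m > 0" "n > 0"
  shows "mls_subst_power m (mls_subst_power n f) = mls_subst_power (m * n) f"
proof (rule mls_subst_power_eqI)
  fix a show "mls_nth (mls_subst_power (m * n) f) (exp_scale m a) = mls_nth (mls_subst_power n f) a"
  proof (cases "a \<in> range (exp_scale n)")
    case True
    thus ?thesis using assms
      by (auto simp: exp_scale_exp_scale mls_nth_subst_power_exp_scale)
  next
    case False
    hence "exp_scale m a \<notin> range (exp_scale (m * n))"
      using assms by (auto simp: exp_scale_eq_iff simp flip: exp_scale_exp_scale)
    thus ?thesis using False by (simp add: mls_nth_subst_power_outside)
  qed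
next
  fix k assume "k \<notin> range (exp_scale m)"
  hence "k \<notin> range (exp_scale (m * n))" by (auto simp flip: exp_scale_exp_scale)
  thus "mls_nth (mls_subst_power (m * n) f) k = 0" by (rule mls_nth_subst_power_outside)
qed fact

section \<open>Evaluating a polynomial at \<open>q\<close>\<close>

lemma at_q_pCons: "at_q (pCons c P) = mls_const c + q_var * at_q P"
  by (simp add: at_q_def map_poly_pCons)

lemma at_q_0 [simp]: "at_q 0 = 0"
  by (simp add: at_q_def)

lemma at_q_1 [simp]: "at_q 1 = 1"
  by (simp add: one_pCons at_q_pCons)

lemma at_q_add: "at_q (P + Q) = at_q P + at_q Q"
proof (induction P arbitrary: Q)
  case (pCons a P)
  show ?case by (cases Q) (simp add: at_q_pCons pCons.IH mls_const_add distrib_left)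
qed simp

lemma at_q_smult: "at_q (smult c P) = mls_const c * at_q P"
  by (induction P) (simp_all add: at_q_pCons mls_const_mult algebra_simps)

lemma at_q_mult: "at_q (P * Q) = at_q P * at_q Q"
  by (induction P) (simp_all add: at_q_pCons at_q_add at_q_smult algebra_simps)

lemma at_q_of_nat: "at_q (of_nat k) = of_nat k"
  by (induction k) (simp_all add: at_q_add)

lemma at_q_diff: "at_q (P - Q) = at_q P - at_q Q"
  using at_q_add[of "P - Q" Q] by simp

lemma at_q_sum: "at_q (\<Sum>x\<in>A. f x) = (\<Sum>x\<in>A. at_q (f x))"
  by (induction A rule: infinite_finite_induct) (simp_all add: at_q_add)

lemma at_q_monom: "at_q (monom 1 n) = q_var ^ n"
  by (induction n) (simp_all add: monom_0 monom_Suc at_q_pCons flip: one_pCons)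

lemma mls_subst_power_at_q:
  assumes n: "n > 0"
  shows "mls_subst_power n (at_q P) = at_q (pcompose P (monom 1 n))"
proof (induction P)
  case (pCons c P)
  have "mls_subst_power n q_var = q_var ^ n"
    by (simp add: q_var_def mls_subst_power_monom n)
  thus ?case
    by (simp add: at_q_pCons pcompose_pCons at_q_add at_q_mult at_q_monom n pCons.IH
          mls_subst_power_add mls_subst_power_mult mls_subst_power_const)
qed (simp add: n)

section \<open>Closure properties of the ring \<open>R\<close>\<close>

lemma R_ringD:
  "f \<in> R_ring N \<Longrightarrow> mls_nth f m \<in> \<int>"
  "f \<in> R_ring N \<Longrightarrow> mls_nth f m \<noteq> 0 \<Longrightarrow> keys m \<subseteq> {..N}"
  by (auto simp: R_ring_def)

lemma R_ring_const: "c \<in> \<int> \<Longrightarrow> mls_const c \<in> R_ring N"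
  by (auto simp: R_ring_def mls_const.rep_eq)

lemma R_ring_0 [simp]: "0 \<in> R_ring N" and R_ring_1 [simp]: "1 \<in> R_ring N"
  using R_ring_const[of 0 N] R_ring_const[of 1 N] by simp_all

lemma R_ring_add: "f \<in> R_ring N \<Longrightarrow> g \<in> R_ring N \<Longrightarrow> f + g \<in> R_ring N"
  unfolding R_ring_def mem_Collect_eq mls_nth_simps by (metis Ints_add add_0)

lemma R_ring_uminus: "f \<in> R_ring N \<Longrightarrow> - f \<in> R_ring N"
  by (auto simp: R_ring_def mls_nth_simps)

lemma R_ring_diff: "f \<in> R_ring N \<Longrightarrow> g \<in> R_ring N \<Longrightarrow> f - g \<in> R_ring N"
  using R_ring_add[of f N "- g"] R_ring_uminus by simp

lemma R_ring_mult:
  assumes f: "f \<in> R_ring N" and g: "g \<in> R_ring N"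
  shows "f * g \<in> R_ring N"
  unfolding R_ring_def
proof (intro CollectI allI conjI impI)
  fix m show "mls_nth (f * g) m \<in> \<int>"
    unfolding mls_nth_mult conv_def by (intro Ints_sum Ints_mult R_ringD(1)[OF f] R_ringD(1)[OF g])
next
  fix m assume "mls_nth (f * g) m \<noteq> 0"
  then obtain a b where "m = a + b" "mls_nth f a \<noteq> 0" "mls_nth g b \<noteq> 0"
    by (rule mls_nth_mult_nonzeroE)
  thus "keys m \<subseteq> {..N}" using R_ringD(2)[OF f] R_ringD(2)[OF g] keys_add[of a b] by blast
qed

lemma R_ring_power: "f \<in> R_ring N \<Longrightarrow> f ^ n \<in> R_ring N"
  by (induction n) (auto intro: R_ring_mult)

lemma R_ring_sum: "(\<And>x. x \<in> A \<Longrightarrow> f x \<in> R_ring N) \<Longrightarrow> (\<Sum>x\<in>A. f x) \<in> R_ring N"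
  by (induction A rule: infinite_finite_induct) (auto intro: R_ring_add)

lemma R_ring_monom: "keys a \<subseteq> {..N} \<Longrightarrow> mls_monom a \<in> R_ring N"
  by (auto simp: R_ring_def mls_nth_monom split: if_splits)

lemma R_ring_at_q:
  "at_q (map_poly of_int P) \<in> R_ring N"
proof (induction P)
  case (pCons c P)
  have "q_var \<in> R_ring N"
    unfolding q_var_def by (rule R_ring_monom) simp
  thus ?case using pCons
    by (auto simp: map_poly_pCons at_q_pCons intro!: R_ring_add R_ring_mult R_ring_const)
qed simp

lemma R_fps_mult: "F \<in> R_fps N \<Longrightarrow> G \<in> R_fps N \<Longrightarrow> F * G \<in> R_fps N"
  by (auto simp: R_fps_def fps_mult_nth intro!: R_ring_sum R_ring_mult)

lemma R_fps_1 [simp]: "1 \<in> R_fps N"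
  by (auto simp: R_fps_def)

lemma R_fps_power: "F \<in> R_fps N \<Longrightarrow> F ^ k \<in> R_fps N"
  by (induction k) (auto intro: R_fps_mult)

lemma R_fps_prod: "(\<And>x. x \<in> A \<Longrightarrow> F x \<in> R_fps N) \<Longrightarrow> (\<Prod>x\<in>A. F x) \<in> R_fps N"
  by (induction A rule: infinite_finite_induct) (auto intro: R_fps_mult)

section \<open>The topology given by the total degree\<close>

text \<open>
  The total degree of an exponent vector. It is additive, and a given Laurent series has only
  finitely many exponents of total degree below a given bound.
\<close>

definition tdeg :: "(nat \<Rightarrow>\<^sub>0 int) \<Rightarrow> int" where
  "tdeg m = (\<Sum>i\<in>keys m. lookup m i)"

lemma tdeg_eq: "finite A \<Longrightarrow> keys m \<subseteq> A \<Longrightarrow> tdeg m = (\<Sum>i\<in>A. lookup m i)"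
  unfolding tdeg_def by (rule sum.mono_neutral_left) (auto simp: in_keys_iff)

lemma tdeg_add: "tdeg (a + b) = tdeg a + tdeg b"
proof -
  have "tdeg m = (\<Sum>i\<in>keys a \<union> keys b. lookup m i)" if "keys m \<subseteq> keys a \<union> keys b" for m
    using that by (intro tdeg_eq) auto
  thus ?thesis using keys_add[of a b] by (simp add: lookup_add sum.distrib)
qed

lemma tdeg_exp_scale: "n > 0 \<Longrightarrow> tdeg (exp_scale n a) = int n * tdeg a"
  by (simp add: tdeg_def keys_exp_scale lookup_exp_scale sum_distrib_left)

text \<open>
  All exponents of the series have total degree at least \<open>L\<close>.
\<close>

definition mls_ge :: "int \<Rightarrow> 'a::zero mls \<Rightarrow> bool" where
  "mls_ge L f \<longleftrightarrow> (\<forall>m. mls_nth f m \<noteq> 0 \<longrightarrow> L \<le> tdeg m)"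

lemma mls_ge_mono: "mls_ge L f \<Longrightarrow> L' \<le> L \<Longrightarrow> mls_ge L' f"
  by (force simp: mls_ge_def)

lemma mls_nth_bounded:
  obtains N b where "b \<le> 0" "bounded_supp N b (mls_nth f)"
proof -
  have ex: "\<exists>N b. bounded_supp N b (mls_nth f)" using mls_nth[of f] by simp
  show thesis using bounded_supp_common[OF ex ex] that by blast
qed

lemma ex_mls_ge: "\<exists>L. mls_ge L f"
proof -
  obtain N b where b: "b \<le> 0" "bounded_supp N b (mls_nth f)"
    by (rule mls_nth_bounded)
  have "mls_ge (int (Suc N) * b) f"
    unfolding mls_ge_def
  proof (intro allI impI)
    fix m assume m: "mls_nth f m \<noteq> 0"
    have "int (Suc N) * b = (\<Sum>i\<le>N. b)" by simp
    also have "\<dots> \<le> (\<Sum>i\<le>N. lookup m i)"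
      using bounded_suppD(2)[OF b(2) m] by (rule sum_mono)
    also have "\<dots> = tdeg m"
      using bounded_suppD(1)[OF b(2) m] by (intro tdeg_eq[symmetric]) auto
    finally show "int (Suc N) * b \<le> tdeg m" .
  qed
  thus ?thesis ..
qed

lemma finite_mls_low_degree: "finite {a. mls_nth f a \<noteq> 0 \<and> tdeg a < L}"
proof -
  obtain N b where b: "b \<le> 0" "bounded_supp N b (mls_nth f)"
    by (rule mls_nth_bounded)
  (* If all N + 1 coordinates are at least b and their sum is below L, then each of them is at
     most L - N b. *)
  define c where "c = int (Suc N) * b - \<bar>L\<bar>"
  have "int (Suc N) * b \<le> 1 * b"
    using b(1) by (intro mult_right_mono_neg) auto
  hence cb: "c \<le> b" unfolding c_def by linarith
  have "{a. mls_nth f a \<noteq> 0 \<and> tdeg a < L} \<subseteq> box N c 0"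
  proof (clarsimp simp: box_def, intro conjI allI)
    fix a assume a: "mls_nth f a \<noteq> 0" "tdeg a < L"
    note bs = bounded_suppD[OF b(2) a(1)]
    show "keys a \<subseteq> {..N}" by fact
    show "c \<le> lookup a i" for i using bs(2)[of i] cb by linarith
    show "lookup a i \<le> - c" for i
    proof (cases "i \<in> {..N}")
      case True
      have "int N * b = (\<Sum>j\<in>{..N} - {i}. b)" using True by simp
      also have "\<dots> \<le> (\<Sum>j\<in>{..N} - {i}. lookup a j)" using bs(2) by (rule sum_mono)
      also have "\<dots> = tdeg a - lookup a i"
        using True tdeg_eq[OF _ bs(1)] by (simp add: sum.remove[of "{..N}" i])
      finally show ?thesis using a(2) b(1) by (simp add: c_def algebra_simps)
    next
      case False
      hence "lookup a i = 0" using bs(1) by (auto simp: in_keys_iff)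
      thus ?thesis using cb b(1) by linarith
    qed
  qed
  thus ?thesis by (rule finite_subset) (rule finite_box)
qed

lemma mls_ge_0: "mls_ge L 0"
  by (simp add: mls_ge_def mls_nth_simps)

lemma mls_ge_add: "mls_ge L f \<Longrightarrow> mls_ge L g \<Longrightarrow> mls_ge L (f + g)"
  unfolding mls_ge_def mls_nth_simps by (metis add_0)

lemma mls_ge_mult:
  assumes "mls_ge L f" "mls_ge K g"
  shows "mls_ge (L + K) (f * g)"
  unfolding mls_ge_def
proof (intro allI impI)
  fix m assume "mls_nth (f * g) m \<noteq> 0"
  then obtain a b where m: "m = a + b" "mls_nth f a \<noteq> 0" "mls_nth g b \<noteq> 0"
    by (rule mls_nth_mult_nonzeroE)
  thus "L + K \<le> tdeg m" using assms by (force simp: mls_ge_def tdeg_add intro: add_mono)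
qed

lemma mls_ge_subst_power:
  assumes "mls_ge L f" "n > 0"
  shows "mls_ge (int n * L) (mls_subst_power n f)"
  unfolding mls_ge_def
proof (intro allI impI)
  fix m assume "mls_nth (mls_subst_power n f) m \<noteq> 0"
  then obtain a where "m = exp_scale n a" "mls_nth f a \<noteq> 0"
    using assms(2) by (metis mls_nth_subst_power_nonzeroE)
  thus "int n * L \<le> tdeg m" using assms by (auto simp: mls_ge_def tdeg_exp_scale)
qed

text \<open>
  Convergence of a family of Laurent series in the topology that has the series with all exponents
  of total degree at least \<open>L\<close>, for integers \<open>L\<close>, as neighbourhoods of 0. This is a ring topology
  although \<open>L\<close> may be negative, since the exponents of any fixed series have bounded total degree
  from below. Coefficientwise convergence would not be preserved by products.
\<close>

definition mls_lim :: "('i \<Rightarrow> 'a::comm_ring_1 mls) \<Rightarrow> 'a mls \<Rightarrow> 'i filter \<Rightarrow> bool" where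
  "mls_lim f g F \<longleftrightarrow> (\<forall>L. \<forall>\<^sub>F x in F. mls_ge L (f x - g))"

lemma mls_lim_const: "mls_lim (\<lambda>_. g) g F"
  by (simp add: mls_lim_def mls_ge_0)

lemma mls_lim_add:
  assumes "mls_lim f a F" "mls_lim g b F"
  shows "mls_lim (\<lambda>x. f x + g x) (a + b) F"
  unfolding mls_lim_def
proof
  fix L
  have "\<forall>\<^sub>F x in F. mls_ge L (f x - a)" "\<forall>\<^sub>F x in F. mls_ge L (g x - b)"
    using assms by (auto simp: mls_lim_def)
  thus "\<forall>\<^sub>F x in F. mls_ge L (f x + g x - (a + b))"
    by eventually_elim (metis add_diff_add mls_ge_add)
qed

lemma mls_lim_sum:
  "(\<And>i. i \<in> A \<Longrightarrow> mls_lim (\<lambda>x. f x i) (g i) F) \<Longrightarrow> mls_lim (\<lambda>x. \<Sum>i\<in>A. f x i) (\<Sum>i\<in>A. g i) F"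
  by (induction A rule: infinite_finite_induct) (auto intro: mls_lim_add mls_lim_const)

lemma mls_lim_mult:
  assumes "mls_lim f a F" "mls_lim g b F"
  shows "mls_lim (\<lambda>x. f x * g x) (a * b) F"
  unfolding mls_lim_def
proof
  fix L
  obtain \<alpha> \<beta> where ab: "mls_ge \<alpha> a" "mls_ge \<beta> b" using ex_mls_ge by blast
  define K where "K = Max {0, L, L - \<alpha>, L - \<beta>}"
  have "0 \<le> K" "L \<le> K" "L - \<alpha> \<le> K" "L - \<beta> \<le> K" by (auto simp: K_def)
  hence K: "L \<le> K + K" "L \<le> \<alpha> + K" "L \<le> K + \<beta>" by linarith+
  have "\<forall>\<^sub>F x in F. mls_ge K (f x - a)" "\<forall>\<^sub>F x in F. mls_ge K (g x - b)"
    using assms by (auto simp: mls_lim_def)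
  thus "\<forall>\<^sub>F x in F. mls_ge L (f x * g x - a * b)"
  proof eventually_elim
    case (elim x)
    have "f x * g x - a * b = (f x - a) * (g x - b) + (a * (g x - b) + (f x - a) * b)"
      by (simp add: algebra_simps)
    thus ?case
      using mls_ge_mono[OF mls_ge_mult[OF elim] K(1)] mls_ge_mono[OF mls_ge_mult[OF ab(1) elim(2)] K(2)]
        mls_ge_mono[OF mls_ge_mult[OF elim(1) ab(2)] K(3)]
      by (auto intro: mls_ge_add)
  qed
qed

lemma mls_lim_subst_power:
  assumes "mls_lim f a F" "n > 0"
  shows "mls_lim (\<lambda>x. mls_subst_power n (f x)) (mls_subst_power n a) F"
  unfolding mls_lim_def
proof
  fix L
  have "max 0 L * 1 \<le> max 0 L * int n" using assms(2) by (intro mult_left_mono) auto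
  hence L: "L \<le> int n * max 0 L" by (simp add: mult.commute)
  have "\<forall>\<^sub>F x in F. mls_ge (max 0 L) (f x - a)"
    using assms by (auto simp: mls_lim_def)
  thus "\<forall>\<^sub>F x in F. mls_ge L (mls_subst_power n (f x) - mls_subst_power n a)"
    by eventually_elim
       (auto simp: assms(2) simp flip: mls_subst_power_diff intro: mls_ge_mono[OF mls_ge_subst_power L])
qed

lemma mls_lim_nth:
  assumes "mls_lim f g F"
  shows "\<forall>\<^sub>F x in F. mls_nth (f x) m = mls_nth g m"
proof -
  have "\<forall>\<^sub>F x in F. mls_ge (tdeg m + 1) (f x - g)"
    using assms by (auto simp: mls_lim_def)
  thus ?thesis
  proof eventually_elim
    case (elim x)
    thus ?case unfolding mls_ge_def mls_nth_simps
      by (metis add.commute right_minus_eq zle_add1_eq_le order_less_irrefl)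
  qed
qed

lemma mls_lim_transform:
  assumes "mls_lim f a F" "\<forall>\<^sub>F x in F. f x = g x"
  shows "mls_lim g a F"
  unfolding mls_lim_def
proof
  fix L
  have "\<forall>\<^sub>F x in F. mls_ge L (f x - a)" using assms(1) by (simp add: mls_lim_def)
  with assms(2) show "\<forall>\<^sub>F x in F. mls_ge L (g x - a)" by eventually_elim simp
qed

section \<open>Logarithmic derivatives\<close>

text \<open>
  The Euler derivation \<open>T d/dT\<close>, which multiplies the coefficient of \<open>T\<^sup>n\<close> by \<open>n\<close>.
\<close>

definition theta :: "'a::comm_ring_1 fps \<Rightarrow> 'a fps" where
  "theta F = fps_X * fps_deriv F"

lemma theta_nth: "fps_nth (theta F) n = of_nat n * fps_nth F n"
  by (cases n) (simp_all add: theta_def)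

lemma theta_mult: "theta (F * G) = F * theta G + theta F * G"
  by (simp add: theta_def algebra_simps)

lemma theta_1 [simp]: "theta 1 = 0"
  by (simp add: theta_def)

text \<open>
  \<open>A\<close> is the logarithmic derivative \<open>\<theta> F / F\<close> of the series \<open>F\<close> with constant coefficient 1. A
  relation avoids division in the ring of power series.
\<close>

definition has_dlog :: "'a::comm_ring_1 fps \<Rightarrow> 'a fps \<Rightarrow> bool" where
  "has_dlog F A \<longleftrightarrow> fps_nth F 0 = 1 \<and> theta F = F * A"

lemma has_dlog_0: "has_dlog F A \<Longrightarrow> fps_nth F 0 = 1"
  by (simp add: has_dlog_def)

lemma has_dlog_nth:
  assumes "has_dlog F A"
  shows "of_nat n * fps_nth F n = (\<Sum>i<n. fps_nth F i * fps_nth A (n - i))"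
    and "fps_nth A 0 = 0"
proof -
  have *: "of_nat n * fps_nth F n = (\<Sum>i=0..n. fps_nth F i * fps_nth A (n - i))" for n
    using assms by (simp add: has_dlog_def fps_mult_nth flip: theta_nth)
  show A0: "fps_nth A 0 = 0" using *[of 0] assms by (simp add: has_dlog_def)
  show "of_nat n * fps_nth F n = (\<Sum>i<n. fps_nth F i * fps_nth A (n - i))"
    unfolding * by (cases n) (simp_all add: A0 atLeast0AtMost lessThan_Suc_atMost)
qed

lemma has_dlog_1: "has_dlog 1 0"
  by (simp add: has_dlog_def)

lemma has_dlog_mult:
  "has_dlog F A \<Longrightarrow> has_dlog G B \<Longrightarrow> has_dlog (F * G) (A + B)"
  by (simp add: has_dlog_def theta_mult algebra_simps)

lemma has_dlog_prod:
  "(\<And>x. x \<in> S \<Longrightarrow> has_dlog (F x) (A x)) \<Longrightarrow> has_dlog (\<Prod>x\<in>S. F x) (\<Sum>x\<in>S. A x)"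
  by (induction S rule: infinite_finite_induct) (auto intro: has_dlog_1 has_dlog_mult)

lemma has_dlog_power: "has_dlog F A \<Longrightarrow> has_dlog (F ^ n) (of_nat n * A)"
  by (induction n) (auto simp: algebra_simps intro: has_dlog_1 dest: has_dlog_mult)

lemma fps_left_inverse_1:
  fixes F :: "'a::comm_ring_1 fps"
  assumes "fps_nth F 0 = 1"
  shows "fps_left_inverse F 1 * F = 1"
  by (rule fps_left_inverse) (simp add: assms)

lemma has_dlog_left_inverse:
  assumes "has_dlog F A"
  shows "has_dlog (fps_left_inverse F 1) (- A)"
proof -
  define G where "G = fps_left_inverse F 1"
  have GF: "G * F = 1"
    unfolding G_def using has_dlog_0[OF assms] by (rule fps_left_inverse_1)
  hence "theta (G * F) = 0" by simp
  hence "F * theta G = - (F * (G * A))"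
    using assms by (simp add: theta_mult has_dlog_def algebra_simps eq_neg_iff_add_eq_0)
  hence "(G * F) * theta G = - ((G * F) * (G * A))"
    by (metis mult.assoc mult_minus_right)
  moreover have "fps_nth G 0 = 1" by (simp add: G_def)
  ultimately show ?thesis unfolding G_def[symmetric] by (simp add: has_dlog_def GF)
qed

lemma has_dlog_powi:
  assumes "has_dlog F A"
  shows "has_dlog (fps_powi F k) (of_int k * A)"
proof (cases "k \<ge> 0")
  case True
  thus ?thesis using has_dlog_power[OF assms, of "nat k"] by (simp add: fps_powi_def)
next
  case False
  thus ?thesis using has_dlog_power[OF has_dlog_left_inverse[OF assms], of "nat (- k)"]
    by (simp add: fps_powi_def)
qed

lemma has_dlog_unique_dlog:
  assumes "has_dlog F A" "has_dlog F B"
  shows "A = B"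
proof -
  have "F * A = F * B" using assms by (simp add: has_dlog_def)
  hence "fps_left_inverse F 1 * F * A = fps_left_inverse F 1 * F * B"
    by (simp only: mult.assoc)
  thus ?thesis using fps_left_inverse_1[OF has_dlog_0[OF assms(1)]] by simp
qed

lemma ex_has_dlog:
  assumes "fps_nth F 0 = 1"
  shows "\<exists>A. has_dlog F A"
proof
  have "F * (fps_left_inverse F 1 * theta F) = theta F"
    using fps_left_inverse_1[OF assms] by (metis mult.assoc mult.commute mult.left_neutral)
  thus "has_dlog F (fps_left_inverse F 1 * theta F)"
    using assms by (simp add: has_dlog_def)
qed

text \<open>
  Two series whose logarithmic derivatives agree below degree \<open>n\<close> agree below degree \<open>n\<close>, and
  \<open>n\<close> times the difference of their coefficients in degree \<open>n\<close> equals the difference of the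
  coefficients of the logarithmic derivatives in degree \<open>n\<close>.
\<close>

lemma has_dlog_agree:
  fixes F G :: "rat mls fps"
  assumes F: "has_dlog F A" and G: "has_dlog G B"
    and AB: "\<And>i. i < n \<Longrightarrow> fps_nth A i = fps_nth B i"
  shows "i < n \<Longrightarrow> fps_nth F i = fps_nth G i"
    and "of_nat n * fps_nth F n - of_nat n * fps_nth G n = fps_nth A n - fps_nth B n"
proof -
  show *: "fps_nth F i = fps_nth G i" if "i < n" for i
    using that
  proof (induction i rule: less_induct)
    case (less i)
    show ?case
    proof (cases "i = 0")
      case False
      have "of_nat i * fps_nth F i = of_nat i * fps_nth G i"
        unfolding has_dlog_nth(1)[OF F] has_dlog_nth(1)[OF G]
        using less False by (intro sum.cong refl arg_cong2[of _ _ _ _ "(*)"] AB) auto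
      thus ?thesis by (rule mls_of_nat_mult_cancel) (use False in simp)
    qed (simp add: has_dlog_0[OF F] has_dlog_0[OF G])
  qed
  show "of_nat n * fps_nth F n - of_nat n * fps_nth G n = fps_nth A n - fps_nth B n"
  proof (cases "n = 0")
    case True
    thus ?thesis using has_dlog_nth(2)[OF F] has_dlog_nth(2)[OF G] by simp
  next
    case False
    have split: "(\<Sum>i<n. H i) = H 0 + (\<Sum>i\<in>{0<..<n}. H i)" for H :: "nat \<Rightarrow> rat mls"
      using False by (subst sum.remove[of "{..<n}" 0]) (auto intro!: sum.cong)
    have "(\<Sum>i\<in>{0<..<n}. fps_nth F i * fps_nth A (n - i))
        = (\<Sum>i\<in>{0<..<n}. fps_nth G i * fps_nth B (n - i))"
      by (intro sum.cong refl arg_cong2[of _ _ _ _ "(*)"] AB *) auto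
    thus ?thesis
      unfolding has_dlog_nth(1)[OF F] has_dlog_nth(1)[OF G] split
      by (simp add: has_dlog_0[OF F] has_dlog_0[OF G])
  qed
qed

lemma has_dlog_unique:
  fixes F G :: "rat mls fps"
  assumes "has_dlog F A" "has_dlog G A"
  shows "F = G"
  using has_dlog_agree(1)[OF assms] by (intro fps_ext) blast

text \<open>
  The coefficients of the solution \<open>F\<close> of \<open>\<theta> F = F A\<close> with constant coefficient 1. The
  coefficients being rational, one can divide by \<open>n\<close>.
\<close>

fun dexp_coeff :: "rat mls fps \<Rightarrow> nat \<Rightarrow> rat mls" where
  "dexp_coeff A n = (if n = 0 then 1 else
     mls_const (1 / of_nat n) * (\<Sum>i<n. dexp_coeff A i * fps_nth A (n - i)))"

declare dexp_coeff.simps [simp del]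

lemma ex_has_dlog_inverse:
  assumes "fps_nth A 0 = (0 :: rat mls)"
  shows "\<exists>F. has_dlog F A"
proof
  show "has_dlog (Abs_fps (dexp_coeff A)) A"
    unfolding has_dlog_def
  proof
    show "theta (Abs_fps (dexp_coeff A)) = Abs_fps (dexp_coeff A) * A"
    proof (rule fps_ext)
      fix n
      show "fps_nth (theta (Abs_fps (dexp_coeff A))) n = fps_nth (Abs_fps (dexp_coeff A) * A) n"
      proof (cases "n = 0")
        case False
        have "of_nat n * dexp_coeff A n = (\<Sum>i<n. dexp_coeff A i * fps_nth A (n - i))"
          using False by (subst dexp_coeff.simps) (simp add: mls_of_nat_mult_inverse)
        thus ?thesis using assms
          by (cases n) (simp_all add: theta_nth fps_mult_nth atLeast0AtMost lessThan_Suc_atMost)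
      qed (simp add: theta_nth fps_mult_nth assms)
    qed
  qed (simp add: dexp_coeff.simps)
qed

section \<open>The plethystic exponential\<close>

text \<open>
  The series \<open>\<Sum>\<^sub>n \<psi>\<^sub>n (\<theta> V)\<close>, which is the logarithmic derivative of the plethystic exponential of
  \<open>V\<close>. The coefficient of \<open>T\<^sup>0\<close> needs its own case, since all integers divide 0.
\<close>

definition plog_deriv :: "rat mls fps \<Rightarrow> rat mls fps" where
  "plog_deriv V = Abs_fps (\<lambda>j. if j = 0 then 0 else
     \<Sum>d | d dvd j. of_nat d * mls_subst_power (j div d) (fps_nth V d))"

lemma plog_deriv_nth:
  "j > 0 \<Longrightarrow> fps_nth (plog_deriv V) j =
     (\<Sum>d | d dvd j. of_nat d * mls_subst_power (j div d) (fps_nth V d))"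
  by (simp add: plog_deriv_def)

lemma plog_deriv_nth_0 [simp]: "fps_nth (plog_deriv V) 0 = 0"
  by (simp add: plog_deriv_def)

lemma sum_divisors_split:
  fixes f :: "nat \<Rightarrow> 'a :: comm_monoid_add"
  assumes "n > 0"
  shows "(\<Sum>d | d dvd n. f d) = f n + (\<Sum>d | d dvd n \<and> d < n. f d)"
proof -
  have "{d. d dvd n} = insert n {d. d dvd n \<and> d < n}"
    using assms by (auto dest: dvd_imp_le)
  thus ?thesis using assms by simp
qed

lemma plog_deriv_nth_split:
  assumes "n > 0"
  shows "fps_nth (plog_deriv V) n = of_nat n * fps_nth V n +
    (\<Sum>d | d dvd n \<and> d < n. of_nat d * mls_subst_power (n div d) (fps_nth V d))"
proof -
  have "mls_subst_power (n div n) f = f" for f :: "rat mls"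
    using assms mls_subst_power_by_1 by simp
  thus ?thesis unfolding plog_deriv_nth[OF assms] sum_divisors_split[OF assms] by simp
qed

lemma dvd_div_pos: "d dvd n \<Longrightarrow> n > 0 \<Longrightarrow> n div d > (0 :: nat)"
  by (auto simp: dvd_div_eq_0_iff intro!: gr0I)

lemma plog_deriv_add: "plog_deriv (V + W) = plog_deriv V + plog_deriv W"
proof (rule fps_ext)
  fix n show "fps_nth (plog_deriv (V + W)) n = fps_nth (plog_deriv V + plog_deriv W) n"
    by (cases "n = 0")
       (auto simp: plog_deriv_nth mls_subst_power_add distrib_left dvd_div_pos simp flip: sum.distrib
          intro!: sum.cong)
qed

lemma plog_deriv_0: "plog_deriv 0 = 0"
  using plog_deriv_add[of 0 0] by simp

lemma plog_deriv_sum: "plog_deriv (\<Sum>x\<in>S. f x) = (\<Sum>x\<in>S. plog_deriv (f x))"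
  by (induction S rule: infinite_finite_induct) (simp_all add: plog_deriv_add plog_deriv_0)

text \<open>
  The series \<open>\<Sum>\<^sub>k x\<^sup>k T\<^bsup>d k\<^esup>\<close>, the inverse of \<open>1 - x T\<^sup>d\<close>.
\<close>

definition geometric_series :: "nat \<Rightarrow> 'a::comm_ring_1 \<Rightarrow> 'a fps" where
  "geometric_series d x = Abs_fps (\<lambda>n. if d dvd n then x ^ (n div d) else 0)"

lemma geometric_series_inverse:
  assumes "d > 0"
  shows "(1 - fps_const x * fps_X ^ d) * geometric_series d x = 1"
proof (rule fps_ext)
  fix n
  have "fps_nth ((1 - fps_const x * fps_X ^ d) * geometric_series d x) n =
    fps_nth (geometric_series d x) n - x * (if n < d then 0 else fps_nth (geometric_series d x) (n - d))"
    by (simp add: left_diff_distrib mult.assoc fps_X_power_mult_nth)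
  also have "\<dots> = fps_nth 1 n"
  proof (cases "n < d")
    case True
    thus ?thesis by (auto simp: geometric_series_def dest: dvd_imp_le)
  next
    case False
    hence eq: "d dvd n - d \<longleftrightarrow> d dvd n" "n \<noteq> 0" using assms by (auto intro: dvd_diffD)
    show ?thesis using False assms eq
      by (auto simp: geometric_series_def le_div_geq[of d n] simp flip: power_Suc)
  qed
  finally show "fps_nth ((1 - fps_const x * fps_X ^ d) * geometric_series d x) n = fps_nth 1 n" .
qed

lemma has_dlog_binomial:
  assumes "d > 0"
  shows "has_dlog (1 - fps_const x * fps_X ^ d) (- (of_nat d * (geometric_series d x - 1)))"
proof -
  define m where "m = fps_const x * fps_X ^ d"
  have of_nat: "of_nat d * G = fps_const (of_nat d) * G" for G :: "'a fps" by (simp add: fps_of_nat)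
  have "fps_nth (theta (1 - m)) n = fps_nth (- (of_nat d * m)) n" for n
    unfolding of_nat using assms by (auto simp: theta_nth m_def)
  hence "theta (1 - m) = - (of_nat d * m)" by (rule fps_ext)
  moreover have "(1 - m) * geometric_series d x = 1" unfolding m_def by (rule geometric_series_inverse) fact
  moreover have "(1 - m) * (- (of_nat d * (geometric_series d x - 1))) = - (of_nat d * ((1 - m) * geometric_series d x - (1 - m)))"
    by (simp add: algebra_simps)
  ultimately have "theta (1 - m) = (1 - m) * (- (of_nat d * (geometric_series d x - 1)))"
    by simp
  moreover have "fps_nth (1 - m) 0 = 1" using assms by (simp add: m_def)
  ultimately show ?thesis by (simp add: has_dlog_def m_def)
qed

lemma plog_deriv_monomial:
  assumes "d > 0"
  shows "plog_deriv (fps_const (of_int v * mls_monom a) * fps_X ^ d) =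
    of_int v * (of_nat d * (geometric_series d (mls_monom a) - 1))"
proof (rule fps_ext)
  fix n
  show "fps_nth (plog_deriv (fps_const (of_int v * mls_monom a) * fps_X ^ d)) n =
    fps_nth (of_int v * (of_nat d * (geometric_series d (mls_monom a) - 1))) n"
  proof (cases "n = 0")
    case False
    hence "n > 0" by simp
    have "fps_nth (plog_deriv (fps_const (of_int v * mls_monom a) * fps_X ^ d)) n =
      (\<Sum>e | e dvd n. if e = d then of_nat d * mls_subst_power (n div d) (of_int v * mls_monom a) else 0)"
      unfolding plog_deriv_nth[OF \<open>n > 0\<close>]
      by (intro sum.cong refl) (auto simp: dvd_div_pos \<open>n > 0\<close>)
    also have "\<dots> = (if d dvd n then of_nat d * mls_subst_power (n div d) (of_int v * mls_monom a) else 0)"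
      using False by (simp add: sum.delta)
    also have "\<dots> = (if d dvd n then of_int v * (of_nat d * mls_monom a ^ (n div d)) else 0)"
      using False by (auto simp: mls_subst_power_mult mls_subst_power_monom dvd_div_pos)
    also have "\<dots> = fps_nth (of_int v * (of_nat d * (geometric_series d (mls_monom a) - 1))) n"
      using False by (simp add: geometric_series_def flip: fps_of_int fps_of_nat)
    finally show ?thesis .
  qed (simp add: geometric_series_def flip: fps_of_int fps_of_nat)
qed

lemma has_dlog_euler_factor:
  assumes "d > 0"
  shows "has_dlog (euler_factor d a v) (plog_deriv (fps_const (of_int v * mls_monom a) * fps_X ^ d))"
  using has_dlog_powi[OF has_dlog_binomial[OF assms, of "mls_monom a"], of "- v"]
  by (simp add: euler_factor_def plog_deriv_monomial assms)

lemma R_fps_euler_factor: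
  assumes "d > 0" "keys a \<subseteq> {..N}"
  shows "euler_factor d a v \<in> R_fps N"
proof -
  let ?F = "1 - fps_const (mls_monom a) * fps_X ^ d :: rat mls fps"
  have F: "?F \<in> R_fps N"
    by (auto simp: R_fps_def intro!: R_ring_diff R_ring_uminus R_ring_mult R_ring_monom assms)
  have "fps_left_inverse ?F 1 * ?F = 1"
    using assms by (intro fps_left_inverse_1) simp
  hence "geometric_series d (mls_monom a) = fps_left_inverse ?F 1 * ?F * geometric_series d (mls_monom a)"
    by simp
  also have "\<dots> = fps_left_inverse ?F 1"
    by (simp only: mult.assoc geometric_series_inverse[OF assms(1)] mult_1_right)
  finally have "fps_left_inverse ?F 1 = geometric_series d (mls_monom a)" ..
  moreover have "geometric_series d (mls_monom a) \<in> R_fps N"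
    by (auto simp: R_fps_def geometric_series_def intro!: R_ring_power R_ring_monom assms)
  ultimately show ?thesis
    using F by (simp add: euler_factor_def fps_powi_def R_fps_power)
qed

section \<open>Convergence of the Euler product\<close>

abbreviation euler_index :: "nat \<Rightarrow> (nat \<times> (nat \<Rightarrow>\<^sub>0 int)) set" where
  "euler_index N \<equiv> {1..} \<times> {a. keys a \<subseteq> {..N}}"

text \<open>
  The product of the factors with index in \<open>S\<close> of the Euler product with exponents \<open>V\<close>, and the
  part of \<open>V\<close> that is supported on \<open>S\<close>. The logarithmic derivative of the first is
  \<open>plog_deriv\<close> of the second.
\<close>

definition euler_prod :: "rat mls fps \<Rightarrow> (nat \<times> (nat \<Rightarrow>\<^sub>0 int)) set \<Rightarrow> rat mls fps" where
  "euler_prod V S = (\<Prod>(d, a)\<in>S. euler_factor d a \<lfloor>mls_nth (fps_nth V d) a\<rfloor>)"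

definition fps_restrict :: "rat mls fps \<Rightarrow> (nat \<times> (nat \<Rightarrow>\<^sub>0 int)) set \<Rightarrow> rat mls fps" where
  "fps_restrict V S =
     (\<Sum>(d, a)\<in>S. fps_const (of_int \<lfloor>mls_nth (fps_nth V d) a\<rfloor> * mls_monom a) * fps_X ^ d)"

lemma is_Log_altdef:
  "is_Log N Z V \<longleftrightarrow> V \<in> R_fps N \<and> fps_nth V 0 = 0 \<and>
     (\<forall>k m. \<forall>\<^sub>F S in finite_subsets_at_top (euler_index N).
        mls_nth (fps_nth (euler_prod V S) k) m = mls_nth (fps_nth Z k) m)"
  by (simp add: is_Log_def has_formal_prod_def euler_prod_def case_prod_unfold)

lemma has_dlog_euler_prod:
  assumes "S \<subseteq> euler_index N"
  shows "has_dlog (euler_prod V S) (plog_deriv (fps_restrict V S))"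
  unfolding euler_prod_def fps_restrict_def plog_deriv_sum
  using assms by (intro has_dlog_prod) (auto intro!: has_dlog_euler_factor)

lemma R_fps_euler_prod:
  assumes "S \<subseteq> euler_index N"
  shows "euler_prod V S \<in> R_fps N"
  unfolding euler_prod_def using assms by (intro R_fps_prod) (auto intro!: R_fps_euler_factor)

lemma mls_nth_fps_restrict:
  assumes "finite S" "V \<in> R_fps N"
  shows "mls_nth (fps_nth (fps_restrict V S) d) m = (if (d, m) \<in> S then mls_nth (fps_nth V d) m else 0)"
proof -
  have int: "of_int \<lfloor>mls_nth (fps_nth V d) m\<rfloor> = mls_nth (fps_nth V d) m"
    using assms(2) by (intro of_int_floor) (auto simp: R_fps_def R_ring_def)
  have "mls_nth (fps_nth (fps_restrict V S) d) m =
    (\<Sum>x\<in>S. if x = (d, m) then of_int \<lfloor>mls_nth (fps_nth V d) m\<rfloor> else 0)"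
    unfolding fps_restrict_def fps_sum_nth mls_nth_sum
  proof (intro sum.cong refl)
    fix x show "mls_nth (fps_nth (case x of (d, a) \<Rightarrow>
        fps_const (of_int \<lfloor>mls_nth (fps_nth V d) a\<rfloor> * mls_monom a) * fps_X ^ d) d) m
      = (if x = (d, m) then of_int \<lfloor>mls_nth (fps_nth V d) m\<rfloor> else 0)"
      by (cases "d = fst x")
         (auto simp: case_prod_unfold prod_eq_iff mls_nth_of_int_mult mls_nth_monom mls_nth_simps)
  qed
  thus ?thesis using assms(1) int by (simp add: sum.delta)
qed

lemma mls_lim_fps_restrict:
  assumes V: "V \<in> R_fps N" and d: "d > 0"
  shows "mls_lim (\<lambda>S. fps_nth (fps_restrict V S) d) (fps_nth V d)
    (finite_subsets_at_top (euler_index N))"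
  unfolding mls_lim_def
proof
  fix L
  define K where "K = Pair d ` {a. mls_nth (fps_nth V d) a \<noteq> 0 \<and> tdeg a < L}"
  show "\<forall>\<^sub>F S in finite_subsets_at_top (euler_index N).
      mls_ge L (fps_nth (fps_restrict V S) d - fps_nth V d)"
    unfolding eventually_finite_subsets_at_top
  proof (intro exI[of _ K] conjI allI impI)
    show "finite K" unfolding K_def by (intro finite_imageI finite_mls_low_degree)
    show "K \<subseteq> euler_index N"
      using V d by (auto simp: K_def R_fps_def R_ring_def)
  next
    fix S assume S: "finite S \<and> K \<subseteq> S \<and> S \<subseteq> euler_index N"
    show "mls_ge L (fps_nth (fps_restrict V S) d - fps_nth V d)"
      unfolding mls_ge_def
    proof (intro allI impI)
      fix m assume "mls_nth (fps_nth (fps_restrict V S) d - fps_nth V d) m \<noteq> 0"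
      hence "(d, m) \<notin> S" "mls_nth (fps_nth V d) m \<noteq> 0"
        using S mls_nth_fps_restrict[OF _ V, of S d m] by (auto simp: mls_nth_simps split: if_splits)
      moreover from this S have "(d, m) \<notin> K" by blast
      ultimately show "L \<le> tdeg m" by (auto simp: K_def)
    qed
  qed
qed

text \<open>
  The coefficients of a series are obtained from those of its logarithmic derivative by ring
  operations and division by integers, so that they depend continuously on them.
\<close>

lemma mls_lim_euler_prod:
  assumes V: "V \<in> R_fps N" and Z: "has_dlog Z (plog_deriv V)"
  shows "mls_lim (\<lambda>S. fps_nth (euler_prod V S) k) (fps_nth Z k)
    (finite_subsets_at_top (euler_index N))"
proof (induction k rule: less_induct)
  case (less k)
  let ?F = "finite_subsets_at_top (euler_index N)"
  have ev: "\<forall>\<^sub>F S in ?F. S \<subseteq> euler_index N"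
    by (rule eventually_finite_subsets_at_top_weakI)
  show ?case
  proof (cases "k = 0")
    case True
    have "mls_lim (\<lambda>S. 1) (fps_nth Z 0) ?F"
      unfolding has_dlog_0[OF Z] by (rule mls_lim_const)
    moreover have "\<forall>\<^sub>F S in ?F. 1 = fps_nth (euler_prod V S) 0"
      using ev by eventually_elim (rule has_dlog_0[OF has_dlog_euler_prod, symmetric])
    ultimately show ?thesis
      unfolding True by (rule mls_lim_transform)
  next
    case False
    have lim: "mls_lim (\<lambda>S. fps_nth (plog_deriv (fps_restrict V S)) j) (fps_nth (plog_deriv V) j) ?F"
      if "j > 0" for j
      unfolding plog_deriv_nth[OF that] using that
      by (intro mls_lim_sum mls_lim_mult mls_lim_const mls_lim_subst_power mls_lim_fps_restrict V)
         (auto intro: dvd_pos_nat dvd_div_pos)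
    have "mls_lim (\<lambda>S. mls_const (1 / of_nat k) *
        (\<Sum>i<k. fps_nth (euler_prod V S) i * fps_nth (plog_deriv (fps_restrict V S)) (k - i)))
      (mls_const (1 / of_nat k) * (\<Sum>i<k. fps_nth Z i * fps_nth (plog_deriv V) (k - i))) ?F"
      by (intro mls_lim_mult mls_lim_const mls_lim_sum less lim) auto
    moreover have inv: "mls_const (1 / of_nat k) * (of_nat k * f) = f" for f :: "rat mls"
      using mls_of_nat_mult_inverse[of k f] False by (metis mult.left_commute neq0_conv)
    ultimately have "mls_lim (\<lambda>S. mls_const (1 / of_nat k) *
        (\<Sum>i<k. fps_nth (euler_prod V S) i * fps_nth (plog_deriv (fps_restrict V S)) (k - i)))
      (fps_nth Z k) ?F"
      unfolding has_dlog_nth(1)[OF Z, symmetric] by simp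
    moreover have "\<forall>\<^sub>F S in ?F. mls_const (1 / of_nat k) *
        (\<Sum>i<k. fps_nth (euler_prod V S) i * fps_nth (plog_deriv (fps_restrict V S)) (k - i))
      = fps_nth (euler_prod V S) k"
      using ev
    proof eventually_elim
      case (elim S)
      show ?case
        unfolding has_dlog_nth(1)[OF has_dlog_euler_prod[OF elim], symmetric] by (rule inv)
    qed
    ultimately show ?thesis by (rule mls_lim_transform)
  qed
qed

lemma R_fps_plethystic_exp:
  assumes V: "V \<in> R_fps N" and Z: "has_dlog Z (plog_deriv V)"
  shows "Z \<in> R_fps N"
proof -
  let ?F = "finite_subsets_at_top (euler_index N)"
  have "mls_nth (fps_nth Z n) m \<in> \<int> \<and> (mls_nth (fps_nth Z n) m \<noteq> 0 \<longrightarrow> keys m \<subseteq> {..N})" for n m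
  proof -
    have "\<forall>\<^sub>F S in ?F. S \<subseteq> euler_index N"
      by (rule eventually_finite_subsets_at_top_weakI)
    with mls_lim_nth[OF mls_lim_euler_prod[OF V Z, of n], of m]
    have "\<forall>\<^sub>F S in ?F. mls_nth (fps_nth (euler_prod V S) n) m = mls_nth (fps_nth Z n) m \<and>
        S \<subseteq> euler_index N"
      by (rule eventually_conj)
    from eventually_happens'[OF finite_subsets_at_top_neq_bot this]
    obtain S where S: "mls_nth (fps_nth (euler_prod V S) n) m = mls_nth (fps_nth Z n) m"
      "S \<subseteq> euler_index N" by blast
    have "fps_nth (euler_prod V S) n \<in> R_ring N"
      using R_fps_euler_prod[OF S(2), of V] by (simp add: R_fps_def)
    from R_ringD[OF this, of m] show ?thesis unfolding S(1) by blast
  qed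
  thus ?thesis by (simp add: R_fps_def R_ring_def)
qed

section \<open>The plethystic logarithm in terms of logarithmic derivatives\<close>

lemma is_Log_iff:
  "is_Log N Z V \<longleftrightarrow> V \<in> R_fps N \<and> fps_nth V 0 = 0 \<and> has_dlog Z (plog_deriv V)"
proof
  assume *: "V \<in> R_fps N \<and> fps_nth V 0 = 0 \<and> has_dlog Z (plog_deriv V)"
  thus "is_Log N Z V"
    unfolding is_Log_altdef by (intro conjI allI mls_lim_nth mls_lim_euler_prod) auto
next
  assume *: "is_Log N Z V"
  hence V: "V \<in> R_fps N" by (simp add: is_Log_def)
  obtain Z' where Z': "has_dlog Z' (plog_deriv V)"
    using ex_has_dlog_inverse[of "plog_deriv V"] by auto
  \<comment> \<open>The coefficients of the finite products tend to those of \<open>Z'\<close> as well.\<close>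
  have "Z = Z'"
  proof (intro fps_ext mls_eqI)
    fix k m
    let ?F = "finite_subsets_at_top (euler_index N)"
    have "\<forall>\<^sub>F S in ?F. mls_nth (fps_nth (euler_prod V S) k) m = mls_nth (fps_nth Z k) m"
      using * by (simp add: is_Log_altdef)
    moreover have "\<forall>\<^sub>F S in ?F. mls_nth (fps_nth (euler_prod V S) k) m = mls_nth (fps_nth Z' k) m"
      by (intro mls_lim_nth mls_lim_euler_prod V Z')
    ultimately have "\<forall>\<^sub>F S in ?F. mls_nth (fps_nth Z k) m = mls_nth (fps_nth Z' k) m"
      by eventually_elim simp
    thus "mls_nth (fps_nth Z k) m = mls_nth (fps_nth Z' k) m" by simp
  qed
  thus "V \<in> R_fps N \<and> fps_nth V 0 = 0 \<and> has_dlog Z (plog_deriv V)"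
    using * Z' by (simp add: is_Log_def)
qed

lemma plog_deriv_inj:
  assumes "plog_deriv V = plog_deriv W" "fps_nth V 0 = fps_nth W 0"
  shows "V = W"
proof (rule fps_ext)
  fix n show "fps_nth V n = fps_nth W n"
  proof (induction n rule: less_induct)
    case (less n)
    show ?case
    proof (cases "n = 0")
      case True
      thus ?thesis by (simp only: assms(2))
    next
      case False
      hence n: "n > 0" by simp
      let ?r = "\<lambda>V. \<Sum>d | d dvd n \<and> d < n. of_nat d * mls_subst_power (n div d) (fps_nth V d)"
      have "of_nat n * fps_nth V n + ?r V = of_nat n * fps_nth W n + ?r W"
        by (simp only: assms(1) flip: plog_deriv_nth_split[OF n])
      moreover have "?r V = ?r W"
        by (intro sum.cong refl) (simp add: less.IH)
      ultimately have "of_nat n * fps_nth V n = of_nat n * fps_nth W n"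
        by (simp only: add_right_cancel)
      thus ?thesis using n by (rule mls_of_nat_mult_cancel)
    qed
  qed
qed

lemma Log_eqI:
  assumes "is_Log N Z V"
  shows "Log N Z = V"
  unfolding Log_def
proof (rule the_equality)
  fix W assume W: "is_Log N Z W"
  have "plog_deriv W = plog_deriv V"
    by (rule has_dlog_unique_dlog[of Z]) (use W assms in \<open>simp_all add: is_Log_iff\<close>)
  moreover have "fps_nth W 0 = fps_nth V 0"
    using W assms by (simp add: is_Log_iff)
  ultimately show "W = V" by (rule plog_deriv_inj)
qed fact

text \<open>
  The coefficients of the solution \<open>V\<close> of \<open>plog_deriv V = A\<close> without constant term.
\<close>

fun plog_coeff :: "rat mls fps \<Rightarrow> nat \<Rightarrow> rat mls" where
  "plog_coeff A n = (if n = 0 then 0 else mls_const (1 / of_nat n) *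
     (fps_nth A n - (\<Sum>d | d dvd n \<and> d < n. of_nat d * mls_subst_power (n div d) (plog_coeff A d))))"

declare plog_coeff.simps [simp del]

lemma plog_deriv_plog_coeff:
  assumes "fps_nth A 0 = 0"
  shows "plog_deriv (Abs_fps (plog_coeff A)) = A"
proof (rule fps_ext)
  fix n show "fps_nth (plog_deriv (Abs_fps (plog_coeff A))) n = fps_nth A n"
  proof (cases "n = 0")
    case False
    hence n: "n > 0" by simp
    have "of_nat n * plog_coeff A n =
      fps_nth A n - (\<Sum>d | d dvd n \<and> d < n. of_nat d * mls_subst_power (n div d) (plog_coeff A d))"
      using n by (subst plog_coeff.simps) (simp add: mls_of_nat_mult_inverse)
    thus ?thesis by (simp add: plog_deriv_nth_split[OF n])
  qed (simp add: assms)
qed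

text \<open>
  There is a solution with rational coefficients; the point is that they are integers. The product
  for the part of \<open>V\<close> below degree \<open>n\<close> agrees with \<open>Z\<close> below degree \<open>n\<close> and has its coefficients
  in \<open>R\<close>, and the coefficient of \<open>V\<close> in degree \<open>n\<close> is the difference of the coefficients of
  these two series in degree \<open>n\<close>.
\<close>

lemma ex_is_Log:
  assumes Z: "Z \<in> R_fps N" "fps_nth Z 0 = 1"
  shows "\<exists>V. is_Log N Z V"
proof -
  obtain A where A: "has_dlog Z A" using ex_has_dlog[OF Z(2)] by blast
  define V where "V = Abs_fps (plog_coeff A)"
  have V: "plog_deriv V = A"
    unfolding V_def by (rule plog_deriv_plog_coeff) (rule has_dlog_nth(2)[OF A])
  have V0: "fps_nth V 0 = 0" by (simp add: V_def plog_coeff.simps)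
  have "fps_nth V n \<in> R_ring N" for n
  proof (induction n rule: less_induct)
    case (less n)
    show ?case
    proof (cases "n = 0")
      case False
      hence n: "n > 0" by simp
      define V' where "V' = Abs_fps (\<lambda>i. if i < n then fps_nth V i else 0)"
      have V': "V' \<in> R_fps N" by (auto simp: R_fps_def V'_def less)
      obtain Z' where Z': "has_dlog Z' (plog_deriv V')"
        using ex_has_dlog_inverse[of "plog_deriv V'"] by auto
      have split: "fps_nth (plog_deriv V) i - fps_nth (plog_deriv V') i =
        of_nat i * (fps_nth V i - fps_nth V' i)" if "i \<le> n" for i
      proof (cases "i = 0")
        case False
        hence "i > 0" by simp
        moreover have "(\<Sum>d | d dvd i \<and> d < i. of_nat d * mls_subst_power (i div d) (fps_nth V d)) =
            (\<Sum>d | d dvd i \<and> d < i. of_nat d * mls_subst_power (i div d) (fps_nth V' d))"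
          using that by (intro sum.cong refl) (simp add: V'_def)
        ultimately show ?thesis by (simp add: plog_deriv_nth_split algebra_simps)
      qed simp
      have "fps_nth (plog_deriv V) i = fps_nth (plog_deriv V') i" if "i < n" for i
        using split[of i] that by (simp add: V'_def)
      hence "of_nat n * fps_nth Z n - of_nat n * fps_nth Z' n = of_nat n * fps_nth V n"
        using has_dlog_agree(2)[OF A[folded V] Z'] split[of n] by (simp add: V'_def)
      hence "of_nat n * (fps_nth Z n - fps_nth Z' n) = of_nat n * fps_nth V n"
        by (simp add: algebra_simps)
      hence "fps_nth Z n - fps_nth Z' n = fps_nth V n"
        by (rule mls_of_nat_mult_cancel) fact
      moreover have "Z' \<in> R_fps N" by (rule R_fps_plethystic_exp[OF V' Z'])
      hence "fps_nth Z' n \<in> R_ring N" "fps_nth Z n \<in> R_ring N" using Z(1) by (auto simp: R_fps_def)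
      ultimately show ?thesis by (metis R_ring_diff)
    qed (simp add: V0)
  qed
  hence "is_Log N Z V"
    using A by (simp add: is_Log_iff V V0 R_fps_def)
  thus ?thesis ..
qed

section \<open>The Frobenius map on the algebraic closure of a finite field\<close>

lemma card_field_ge_2: "CARD('k :: {field,finite}) \<ge> 2"
proof -
  have "card {0, 1 :: 'k} \<le> CARD('k)" by (intro card_mono) auto
  thus ?thesis by simp
qed

lemma finite_field_power_card: "x ^ CARD('k) = (x :: 'k :: {field,finite})"
proof (cases "x = 0")
  case True
  thus ?thesis using card_field_ge_2[where 'k = 'k] by simp
next
  case False
  let ?U = "UNIV - {0 :: 'k}"
  have "(\<Prod>y\<in>?U. x * y) = (\<Prod>y\<in>?U. y)"
    by (rule prod.reindex_bij_witness[of _ "\<lambda>y. y / x" "\<lambda>y. x * y"]) (use False in auto)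
  hence "x ^ card ?U * (\<Prod>y\<in>?U. y) = (\<Prod>y\<in>?U. y)"
    by (simp add: prod.distrib)
  moreover have "(\<Prod>y\<in>?U. y) \<noteq> 0" by simp
  ultimately have "x ^ card ?U = 1" by simp
  moreover have "CARD('k) = Suc (card ?U)"
    using card_field_ge_2[where 'k = 'k] by (simp add: card_Diff_singleton)
  ultimately show ?thesis by (simp only: power_Suc mult_1_right)
qed

text \<open>
  The polynomial \<open>(X + 1)\<^sup>q - X\<^sup>q - 1\<close> has degree less than \<open>q\<close> and vanishes on the field
  with \<open>q\<close> elements.
\<close>

lemma choose_card_finite_field:
  assumes "0 < k" "k < CARD('k :: {field,finite})"
  shows "of_nat (CARD('k) choose k) = (0 :: 'k)"
proof -
  define n where "n = CARD('k)"
  define P where "P = (\<Sum>i\<in>{0<..<n}. monom (of_nat (n choose i) :: 'k) i)"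
  have n: "n \<ge> 2" unfolding n_def by (rule card_field_ge_2)
  have "poly P x = 0" for x
  proof -
    have "(x + 1) ^ n = (\<Sum>i\<le>n. of_nat (n choose i) * x ^ i)"
      by (simp add: binomial_ring)
    also have "{..n} = insert 0 (insert n {0<..<n})" by auto
    also have "(\<Sum>i\<in>\<dots>. of_nat (n choose i) * x ^ i) = 1 + (x ^ n + poly P x)"
      using n by (simp add: P_def poly_sum poly_monom)
    finally show ?thesis
      by (simp add: n_def finite_field_power_card)
  qed
  hence roots: "{x. poly P x = 0} = UNIV" by auto
  have "degree P \<le> n - 1"
    unfolding P_def by (intro degree_sum_le) (auto intro!: order.trans[OF degree_monom_le])
  moreover have "n \<le> degree P" if "P \<noteq> 0"
    using card_poly_roots_bound[OF that] unfolding roots n_def .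
  ultimately have "P = 0" using n by linarith
  moreover have "coeff P k = of_nat (n choose k)"
    using assms by (simp add: P_def n_def coeff_sum sum.delta)
  ultimately show ?thesis by (simp add: n_def)
qed

lemma frobenius_add:
  fixes x y :: "'k :: {field,finite} alg_closure"
  shows "(x + y) ^ CARD('k) = x ^ CARD('k) + y ^ CARD('k)"
proof -
  define n where "n = CARD('k)"
  have n: "n \<ge> 2" unfolding n_def by (rule card_field_ge_2)
  have "of_nat (n choose i) = (0 :: 'k alg_closure)" if "i \<in> {0<..<n}" for i
  proof -
    have "of_nat (n choose i) = (0 :: 'k)" using that unfolding n_def
      by (intro choose_card_finite_field) auto
    hence "to_ac (of_nat (n choose i) :: 'k) = 0" by simp
    thus ?thesis by simp
  qed
  hence "(\<Sum>i\<in>{0<..<n}. of_nat (n choose i) * x ^ i * y ^ (n - i)) = 0"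
    by (intro sum.neutral) auto
  moreover have "{..n} = insert 0 (insert n {0<..<n})" by auto
  ultimately have "(x + y) ^ n = x ^ n + y ^ n"
    using n by (simp add: binomial_ring)
  thus ?thesis by (simp add: n_def)
qed

lemma frobenius_inj:
  fixes x y :: "'k :: {field,finite} alg_closure"
  assumes "x ^ CARD('k) = y ^ CARD('k)"
  shows "x = y"
proof -
  have "(x - y) ^ CARD('k) = 0"
    using frobenius_add[of "x - y" y] assms by simp
  thus ?thesis by simp
qed

lemma frobenius_power_inj:
  fixes x y :: "'k :: {field,finite} alg_closure"
  assumes "x ^ (CARD('k) ^ r) = y ^ (CARD('k) ^ r)"
  shows "x = y"
  using assms
proof (induction r)
  case (Suc r)
  hence "(x ^ (CARD('k) ^ r)) ^ CARD('k) = (y ^ (CARD('k) ^ r)) ^ CARD('k)"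
    by (simp add: power_mult[symmetric] mult.commute)
  thus ?case by (rule Suc.IH[OF frobenius_inj])
qed simp

lemma frobenius_sum:
  fixes f :: "_ \<Rightarrow> 'k :: {field,finite} alg_closure"
  shows "(\<Sum>i\<in>A. f i) ^ CARD('k) = (\<Sum>i\<in>A. f i ^ CARD('k))"
  using card_field_ge_2[where 'k = 'k]
  by (induction A rule: infinite_finite_induct) (auto simp: frobenius_add)

lemma frobenius_to_ac: "to_ac (c :: 'k) ^ CARD('k :: {field,finite}) = to_ac c"
  by (simp add: finite_field_power_card flip: to_ac_power)

lemma mpoly_eval_frobenius:
  fixes p :: "'k :: {field,finite} mpoly"
  shows "mpoly_eval p (\<lambda>i. a i ^ CARD('k)) = mpoly_eval p a ^ CARD('k)"
proof -
  have "(\<Prod>i\<in>A. (a i ^ CARD('k)) ^ e i) = (\<Prod>i\<in>A. a i ^ e i) ^ CARD('k)" for A and e :: "nat \<Rightarrow> nat"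
    unfolding prod_power_distrib by (intro prod.cong refl) (simp add: power_mult[symmetric] mult.commute)
  thus ?thesis
    by (simp add: mpoly_eval_def frobenius_sum power_mult_distrib frobenius_to_ac)
qed

lemma poly_frobenius:
  fixes p :: "'k :: {field,finite} poly"
  shows "poly (map_poly to_ac p) (y ^ CARD('k)) = poly (map_poly to_ac p) y ^ CARD('k)"
  using card_field_ge_2[where 'k = 'k]
  by (induction p) (auto simp: map_poly_pCons frobenius_add power_mult_distrib frobenius_to_ac)

text \<open>
  The elements \<open>y\<close>, \<open>y\<^sup>q\<close>, \<open>y\<^bsup>q^2\<^esup>\<close>, \<open>\<dots>\<close> are all roots of the same nonzero polynomial over the
  ground field, where \<open>q\<close> is the number of its elements. So two of them coincide.
\<close>

lemma alg_closure_periodic: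
  fixes y :: "'k :: {field,finite} alg_closure"
  shows "\<exists>r\<ge>1. y ^ (CARD('k) ^ r) = y"
proof -
  obtain p :: "'k poly" where p: "p \<noteq> 0" "poly (map_poly to_ac p) y = 0"
    by (rule alg_closure_algebraic)
  have root: "poly (map_poly to_ac p) (y ^ (CARD('k) ^ i)) = 0" for i
  proof (induction i)
    case (Suc i)
    thus ?case
      using poly_frobenius[of p "y ^ (CARD('k) ^ i)"] card_field_ge_2[where 'k = 'k]
      by (simp add: power_mult[symmetric] mult.commute)
  qed (simp add: p)
  have "map_poly to_ac p \<noteq> 0" using p(1) by (simp add: map_poly_eq_0_iff)
  hence "finite {z. poly (map_poly to_ac p) z = 0}" by (rule poly_roots_finite)
  hence "finite (range (\<lambda>i. y ^ (CARD('k) ^ i)))"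
    by (rule finite_subset[rotated]) (auto simp: root)
  hence "\<not> inj (\<lambda>i. y ^ (CARD('k) ^ i))"
    using finite_imageD infinite_UNIV_nat by blast
  then obtain i j where ij: "i < j" "y ^ (CARD('k) ^ i) = y ^ (CARD('k) ^ j)"
    unfolding inj_def by (metis linorder_neqE_nat)
  have "CARD('k) ^ j = CARD('k) ^ (j - i) * CARD('k) ^ i"
    using ij(1) by (simp flip: power_add)
  hence "(y ^ (CARD('k) ^ (j - i))) ^ (CARD('k) ^ i) = y ^ (CARD('k) ^ i)"
    using ij(2) by (simp add: power_mult)
  hence "y ^ (CARD('k) ^ (j - i)) = y" by (rule frobenius_power_inj)
  thus ?thesis using ij(1) by (intro exI[of _ "j - i"]) auto
qed

lemma frobenius_power_fixed_mult:
  fixes y :: "'k :: {field,finite} alg_closure"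
  assumes "y ^ (CARD('k) ^ r) = y"
  shows "y ^ (CARD('k) ^ (r * s)) = y"
proof (induction s)
  case (Suc s)
  have "y ^ (CARD('k) ^ (r * Suc s)) = (y ^ (CARD('k) ^ r)) ^ (CARD('k) ^ (r * s))"
    by (simp add: power_add power_mult)
  thus ?case using assms Suc by simp
qed simp

lemma alg_closure_tuple_periodic:
  fixes a :: "nat \<Rightarrow> 'k :: {field,finite} alg_closure"
  shows "\<exists>r\<ge>1. \<forall>i<n. a i ^ (CARD('k) ^ r) = a i"
proof (induction n)
  case (Suc n)
  then obtain r where r: "r \<ge> 1" "\<forall>i<n. a i ^ (CARD('k) ^ r) = a i" by blast
  obtain s where s: "s \<ge> 1" "a n ^ (CARD('k) ^ s) = a n"
    using alg_closure_periodic by blast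
  have "a i ^ (CARD('k) ^ (r * s)) = a i" if "i < Suc n" for i
    using that r(2) frobenius_power_fixed_mult[of "a i" r s] frobenius_power_fixed_mult[OF s(2), of r]
    by (auto simp: less_Suc_eq mult.commute)
  moreover have "r * s \<ge> 1" using r(1) s(1) by simp
  ultimately show ?case by blast
qed auto

lemma finite_subfield_ext:
  assumes "r \<ge> 1"
  shows "finite (subfield_ext r :: 'k :: {field,finite} alg_closure set)"
proof -
  define n where "n = CARD('k) ^ r"
  have "CARD('k) ^ 1 \<le> n" unfolding n_def using assms card_field_ge_2[where 'k = 'k]
    by (intro power_increasing) auto
  hence n: "n \<ge> 2" using card_field_ge_2[where 'k = 'k] by simp
  let ?P = "monom 1 n - monom 1 1 :: 'k alg_closure poly"
  have "coeff ?P n = 1" using n by simp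
  hence "?P \<noteq> 0" by (metis coeff_0 zero_neq_one)
  hence "finite {z. poly ?P z = 0}" by (rule poly_roots_finite)
  thus ?thesis by (simp add: subfield_ext_def poly_monom n_def)
qed

section \<open>Frobenius on a variety\<close>

context
  fixes Y :: "('k :: {field,finite}, 'x) variety"
  assumes Y: "is_variety Y"
begin

lemma chart_inj: "(U, n, \<phi>) \<in> charts Y \<Longrightarrow> inj_on \<phi> U"
  and chart_closed: "(U, n, \<phi>) \<in> charts Y \<Longrightarrow> zariski_closed n (\<phi> ` U)"
proof -
  have *: "\<forall>(U, n, \<phi>)\<in>charts Y. inj_on \<phi> U \<and> zariski_closed n (\<phi> ` U)"
    using Y by (simp add: is_variety_def)
  show "inj_on \<phi> U" "zariski_closed n (\<phi> ` U)" if "(U, n, \<phi>) \<in> charts Y"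
    using bspec[OF * that] by simp_all
qed

lemma chart_transition:
  assumes "(U, n, \<phi>) \<in> charts Y" "(V, k, \<psi>) \<in> charts Y"
  shows "zariski_open_in (\<phi> ` U) (\<phi> ` (U \<inter> V))"
    "j < k \<Longrightarrow> regular_fun (\<phi> ` (U \<inter> V)) (\<lambda>a. \<psi> (inv_into U \<phi> a) j)"
proof -
  have *: "\<forall>(U, n, \<phi>)\<in>charts Y. \<forall>(V, k, \<psi>)\<in>charts Y.
        zariski_open_in (\<phi> ` U) (\<phi> ` (U \<inter> V)) \<and>
        (\<forall>j<k. regular_fun (\<phi> ` (U \<inter> V)) (\<lambda>a. \<psi> (inv_into U \<phi> a) j)) \<and>
        zariski_closed (n + k) ((\<lambda>x. join_coords n (\<phi> x) (\<psi> x)) ` (U \<inter> V))"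
    using Y unfolding is_variety_def by (elim conjE)
  have **: "\<forall>(V, k, \<psi>)\<in>charts Y.
        zariski_open_in (\<phi> ` U) (\<phi> ` (U \<inter> V)) \<and>
        (\<forall>j<k. regular_fun (\<phi> ` (U \<inter> V)) (\<lambda>a. \<psi> (inv_into U \<phi> a) j)) \<and>
        zariski_closed (n + k) ((\<lambda>x. join_coords n (\<phi> x) (\<psi> x)) ` (U \<inter> V))"
    using bspec[OF * assms(1)] by (simp only: prod.case)
  note conj = bspec[OF ** assms(2), unfolded prod.case]
  show "zariski_open_in (\<phi> ` U) (\<phi> ` (U \<inter> V))" using conj by (rule conjunct1)
  show "regular_fun (\<phi> ` (U \<inter> V)) (\<lambda>a. \<psi> (inv_into U \<phi> a) j)" if "j < k"
    using conj[THEN conjunct2, THEN conjunct1] that by simp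
qed

lemma Union_charts: "(\<Union>(U, n, \<phi>)\<in>charts Y. U) = points Y"
  using Y by (simp add: is_variety_def)

lemma chart_subset_points: "(U, n, \<phi>) \<in> charts Y \<Longrightarrow> U \<subseteq> points Y"
  unfolding Union_charts[symmetric] by fast

lemma ex_chart:
  assumes "x \<in> points Y"
  obtains U n \<phi> where "(U, n, \<phi>) \<in> charts Y" "x \<in> U"
proof -
  have "x \<in> (\<Union>(U, n, \<phi>)\<in>charts Y. U)" using assms by (simp only: Union_charts)
  thus thesis using that by fast
qed

lemma chart_eq_0: "(U, n, \<phi>) \<in> charts Y \<Longrightarrow> x \<in> U \<Longrightarrow> i \<ge> n \<Longrightarrow> \<phi> x i = 0"
  using chart_closed[of U n \<phi>] by (auto simp: zariski_closed_def affine_space_def)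

lemma chart_frobenius:
  assumes "(U, n, \<phi>) \<in> charts Y" "x \<in> U"
  obtains y where "y \<in> U" "\<phi> y = (\<lambda>i. \<phi> x i ^ CARD('k))"
proof -
  obtain S where S: "\<phi> ` U = affine_space n \<inter> zero_locus S"
    using chart_closed[OF assms(1)] by (auto simp: zariski_closed_def)
  have "\<phi> x \<in> affine_space n \<inter> zero_locus S" using S assms(2) by blast
  hence "(\<lambda>i. \<phi> x i ^ CARD('k)) \<in> affine_space n \<inter> zero_locus S"
    using card_field_ge_2[where 'k = 'k] by (auto simp: affine_space_def zero_locus_def mpoly_eval_frobenius)
  hence "(\<lambda>i. \<phi> x i ^ CARD('k)) \<in> \<phi> ` U" using S by simp
  then obtain y where "y \<in> U" "(\<lambda>i. \<phi> x i ^ CARD('k)) = \<phi> y" by (rule imageE)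
  thus thesis using that by simp
qed

text \<open>
  Overlaps and transition functions of charts are defined by polynomials over the ground field,
  hence compatible with raising all coordinates to the power \<open>q\<close>, the number of its elements.
\<close>

lemma frobenius_transition:
  assumes U: "(U, n, \<phi>) \<in> charts Y" "x \<in> U" "y \<in> U" "\<phi> y = (\<lambda>i. \<phi> x i ^ CARD('k))"
    and V: "(V, k, \<psi>) \<in> charts Y" "x \<in> V"
  shows "y \<in> V" "\<psi> y = (\<lambda>i. \<psi> x i ^ CARD('k))"
proof -
  obtain S where S: "\<phi> ` (U \<inter> V) = \<phi> ` U - zero_locus S"
    using chart_transition(1)[OF U(1) V(1)] by (auto simp: zariski_open_in_def)
  have "\<phi> x \<notin> zero_locus S" using S U V by blast
  hence "\<phi> y \<notin> zero_locus S"
    by (auto simp: zero_locus_def U(4) mpoly_eval_frobenius)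
  hence "\<phi> y \<in> \<phi> ` (U \<inter> V)" using S U(3) by blast
  thus yV: "y \<in> V" using chart_inj[OF U(1)] U(3) by (auto simp: inj_on_def)
  show "\<psi> y = (\<lambda>i. \<psi> x i ^ CARD('k))"
  proof
    fix j
    show "\<psi> y j = \<psi> x j ^ CARD('k)"
    proof (cases "j < k")
      case True
      have inv: "inv_into U \<phi> (\<phi> z) = z" if "z \<in> U" for z
        using chart_inj[OF U(1)] that by simp
      have reg: "\<forall>a\<in>\<phi> ` (U \<inter> V). \<exists>P Q. mpoly_eval Q a \<noteq> 0 \<and>
          (\<forall>b\<in>\<phi> ` (U \<inter> V). mpoly_eval Q b \<noteq> 0 \<longrightarrow>
             \<psi> (inv_into U \<phi> b) j = mpoly_eval P b / mpoly_eval Q b)"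
        using chart_transition(2)[OF U(1) V(1) True] unfolding regular_fun_def .
      have x: "\<phi> x \<in> \<phi> ` (U \<inter> V)" using U V by blast
      from bspec[OF reg this] obtain P Q where PQ: "mpoly_eval Q (\<phi> x) \<noteq> 0"
        "\<forall>b\<in>\<phi> ` (U \<inter> V). mpoly_eval Q b \<noteq> 0 \<longrightarrow> \<psi> (inv_into U \<phi> b) j = mpoly_eval P b / mpoly_eval Q b"
        by blast
      have Qy: "mpoly_eval Q (\<phi> y) \<noteq> 0" using PQ(1) by (simp add: U(4) mpoly_eval_frobenius)
      have "\<psi> x j = mpoly_eval P (\<phi> x) / mpoly_eval Q (\<phi> x)"
        using bspec[OF PQ(2) x] PQ(1) inv[OF U(2)] by simp
      moreover have "\<phi> y \<in> \<phi> ` (U \<inter> V)" using U(3) yV by blast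
      hence "\<psi> y j = mpoly_eval P (\<phi> y) / mpoly_eval Q (\<phi> y)"
        using bspec[OF PQ(2), of "\<phi> y"] Qy inv[OF U(3)] by simp
      ultimately show ?thesis
        by (simp add: U(4) mpoly_eval_frobenius power_divide)
    next
      case False
      thus ?thesis using chart_eq_0[OF V(1) yV, of j] chart_eq_0[OF V, of j] card_field_ge_2[where 'k = 'k]
        by simp
    qed
  qed
qed

text \<open>
  By the compatibility of the charts, the description that defines \<open>frob\<close> determines a unique
  point.
\<close>

lemma frob_chart:
  assumes U: "(U, n, \<phi>) \<in> charts Y" "x \<in> U"
  shows "frob Y x \<in> U" "\<phi> (frob Y x) = (\<lambda>i. \<phi> x i ^ CARD('k))"
proof -
  obtain y where y: "y \<in> U" "\<phi> y = (\<lambda>i. \<phi> x i ^ CARD('k))"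
    using chart_frobenius[OF U] .
  have "frob Y x = y"
    unfolding frob_def
  proof (rule the_equality)
    show "\<exists>(U, n, \<phi>)\<in>charts Y. x \<in> U \<and> y \<in> U \<and> \<phi> y = (\<lambda>i. \<phi> x i ^ CARD('k))"
      using U y by fast
  next
    fix z assume "\<exists>(U, n, \<phi>)\<in>charts Y. x \<in> U \<and> z \<in> U \<and> \<phi> z = (\<lambda>i. \<phi> x i ^ CARD('k))"
    then obtain V k \<psi> where V: "(V, k, \<psi>) \<in> charts Y" "x \<in> V" "z \<in> V" "\<psi> z = (\<lambda>i. \<psi> x i ^ CARD('k))"
      by fast
    have "y \<in> V" "\<psi> y = \<psi> z"
      using frobenius_transition[OF U y V(1,2)] V(4) by simp_all
    thus "z = y" using chart_inj[OF V(1)] V(3) by (auto simp: inj_on_def)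
  qed
  thus "frob Y x \<in> U" "\<phi> (frob Y x) = (\<lambda>i. \<phi> x i ^ CARD('k))" using y by simp_all
qed

lemma frob_power_chart:
  assumes U: "(U, n, \<phi>) \<in> charts Y" "x \<in> U"
  shows "(frob Y ^^ r) x \<in> U" "\<phi> ((frob Y ^^ r) x) = (\<lambda>i. \<phi> x i ^ (CARD('k) ^ r))"
proof (induction r)
  case (Suc r)
  show "(frob Y ^^ Suc r) x \<in> U" using frob_chart(1)[OF U(1) Suc(1)] by simp
  show "\<phi> ((frob Y ^^ Suc r) x) = (\<lambda>i. \<phi> x i ^ (CARD('k) ^ Suc r))"
    using frob_chart(2)[OF U(1) Suc(1)] Suc(2) by (simp add: power_mult[symmetric] mult.commute)
qed (use U in simp_all)

lemma frob_points: "x \<in> points Y \<Longrightarrow> frob Y x \<in> points Y"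
  by (meson chart_subset_points ex_chart frob_chart(1) subsetD)

lemma frob_power_fixed_iff:
  assumes "(U, n, \<phi>) \<in> charts Y" "x \<in> U"
  shows "(frob Y ^^ r) x = x \<longleftrightarrow> (\<forall>i<n. \<phi> x i ^ (CARD('k) ^ r) = \<phi> x i)"
proof
  assume "\<forall>i<n. \<phi> x i ^ (CARD('k) ^ r) = \<phi> x i"
  hence "\<phi> x i ^ (CARD('k) ^ r) = \<phi> x i" for i
    using chart_eq_0[OF assms, of i] card_field_ge_2[where 'k = 'k] by (cases "i < n") auto
  hence "\<phi> ((frob Y ^^ r) x) = \<phi> x"
    using frob_power_chart(2)[OF assms] by simp
  thus "(frob Y ^^ r) x = x"
    using chart_inj[OF assms(1)] frob_power_chart(1)[OF assms] assms(2) by (auto simp: inj_on_def)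
next
  assume "(frob Y ^^ r) x = x"
  thus "\<forall>i<n. \<phi> x i ^ (CARD('k) ^ r) = \<phi> x i"
    using frob_power_chart(2)[OF assms, of r] by (simp add: fun_eq_iff)
qed

lemma frob_periodic:
  assumes "x \<in> points Y"
  shows "\<exists>r\<ge>1. (frob Y ^^ r) x = x"
proof -
  obtain U n \<phi> where U: "(U, n, \<phi>) \<in> charts Y" "x \<in> U" using ex_chart[OF assms] .
  show ?thesis using alg_closure_tuple_periodic[of n "\<phi> x"] by (simp add: frob_power_fixed_iff[OF U])
qed

lemma rational_points_eq_fixed: "rational_points Y r = {x \<in> points Y. (frob Y ^^ r) x = x}"
proof (intro equalityI subsetI)
  fix x assume "x \<in> rational_points Y r"
  then obtain U n \<phi> where U: "(U, n, \<phi>) \<in> charts Y" "x \<in> U" "\<forall>i<n. \<phi> x i \<in> subfield_ext r"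
    unfolding rational_points_def by fast
  thus "x \<in> {x \<in> points Y. (frob Y ^^ r) x = x}"
    using chart_subset_points[OF U(1)] frob_power_fixed_iff[OF U(1,2)] by (auto simp: subfield_ext_def)
next
  fix x assume x: "x \<in> {x \<in> points Y. (frob Y ^^ r) x = x}"
  then obtain U n \<phi> where U: "(U, n, \<phi>) \<in> charts Y" "x \<in> U" using ex_chart[of x] by blast
  hence "\<forall>i<n. \<phi> x i \<in> subfield_ext r"
    using x frob_power_fixed_iff[OF U, of r] by (simp add: subfield_ext_def)
  thus "x \<in> rational_points Y r"
    unfolding rational_points_def mem_Collect_eq by (intro bexI[OF _ U(1)]) (simp add: U(2))
qed

lemma finite_rational_points:
  assumes "r \<ge> 1"
  shows "finite (rational_points Y r)"
proof -
  have fin: "finite {x \<in> U. \<forall>i<n. \<phi> x i \<in> subfield_ext r}" if U: "(U, n, \<phi>) \<in> charts Y" for U n \<phi>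
  proof (rule finite_imageD)
    have "\<phi> ` {x \<in> U. \<forall>i<n. \<phi> x i \<in> subfield_ext r} \<subseteq>
      {f. \<forall>i. (i \<in> {..<n} \<longrightarrow> f i \<in> subfield_ext r) \<and> (i \<notin> {..<n} \<longrightarrow> f i = 0)}"
      using chart_eq_0[OF U] by auto
    thus "finite (\<phi> ` {x \<in> U. \<forall>i<n. \<phi> x i \<in> subfield_ext r})"
      by (rule finite_subset) (intro finite_set_of_finite_funs finite_subfield_ext assms, simp)
    show "inj_on \<phi> {x \<in> U. \<forall>i<n. \<phi> x i \<in> subfield_ext r}"
      using chart_inj[OF U] by (rule inj_on_subset) auto
  qed
  have "rational_points Y r = (\<Union>(U, n, \<phi>)\<in>charts Y. {x \<in> U. \<forall>i<n. \<phi> x i \<in> subfield_ext r})"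
    by (auto simp: rational_points_def)
  moreover have "finite (charts Y)" using Y by (simp add: is_variety_def)
  ultimately show ?thesis using fin by auto
qed

end

section \<open>Orbits of a map with finitely many points of each period\<close>

text \<open>
  For Frobenius on a variety over a finite field, every point has a finite orbit, and only finitely
  many points are fixed by a given power.
\<close>

locale periodic_map =
  fixes g :: "'x \<Rightarrow> 'x" and P :: "'x set"
  assumes maps: "x \<in> P \<Longrightarrow> g x \<in> P"
    and periodic: "x \<in> P \<Longrightarrow> \<exists>n\<ge>1. (g ^^ n) x = x"
    and finite_fixed: "n \<ge> 1 \<Longrightarrow> finite {x \<in> P. (g ^^ n) x = x}"
begin

definition orbits_of_size :: "nat \<Rightarrow> 'x set set" where
  "orbits_of_size d = {B. \<exists>x\<in>P. B = orbit g x \<and> card B = d}"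

lemma self_in_orbit:
  assumes "x \<in> P"
  shows "x \<in> orbit g x"
proof -
  obtain n where "n \<ge> 1" "(g ^^ n) x = x" using periodic[OF assms] by blast
  hence "\<exists>n. x = (g ^^ n) x \<and> 0 < n" by (intro exI[of _ n]) simp
  thus ?thesis unfolding orbit_altdef by blast
qed

lemma orbit_subset_P: "x \<in> P \<Longrightarrow> orbit g x \<subseteq> P"
proof
  fix y assume "y \<in> orbit g x" and "x \<in> P"
  thus "y \<in> P" by (induction rule: orbit.induct) (auto intro: maps)
qed

lemma finite_orbit_P: "x \<in> P \<Longrightarrow> finite (orbit g x)"
  by (rule finite_orbit) (rule self_in_orbit)

lemma orbit_eq:
  assumes "x \<in> P" "y \<in> orbit g x"
  shows "orbit g y = orbit g x"
proof
  show "orbit g y \<subseteq> orbit g x" using assms(2) orbit_trans by fast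
  have "x \<in> orbit g y" using self_in_orbit[OF assms(1)] assms(2) by (rule orbit_swap)
  thus "orbit g x \<subseteq> orbit g y" using orbit_trans by fast
qed

lemma card_orbit_pos: "x \<in> P \<Longrightarrow> card (orbit g x) > 0"
  using finite_orbit_P self_in_orbit by (fastforce simp: card_gt_0_iff)

text \<open>
  The size of an orbit is the least period of its points.
\<close>

lemma funpow_fixed_iff:
  assumes x: "x \<in> P"
  shows "(g ^^ n) x = x \<longleftrightarrow> card (orbit g x) dvd n"
proof -
  define p where "p = funpow_dist1 g x x"
  have p: "(g ^^ p) x = x" "p > 0"
    unfolding p_def using funpow_dist1_prop[OF self_in_orbit[OF x]] by simp_all
  have least: "(g ^^ m) x \<noteq> x" if "0 < m" "m < p" for m
    using that unfolding p_def by (rule funpow_dist1_least)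
  have "orbit g x = (\<lambda>m. (g ^^ m) x) ` {0..<p}"
    using orbit_altdef_bounded[OF p] by auto
  moreover have "inj_on (\<lambda>m. (g ^^ m) x) {0..<p}"
    unfolding p_def by (rule inj_on_funpow_dist1) (rule self_in_orbit[OF x])
  ultimately have card: "card (orbit g x) = p" by (simp add: card_image)
  have "(g ^^ n) x = (g ^^ (n mod p)) x" by (rule funpow_mod_eq[OF p(1), symmetric])
  moreover have "(g ^^ (n mod p)) x = x \<longleftrightarrow> n mod p = 0"
    using least[of "n mod p"] p(2) by (cases "n mod p = 0") auto
  ultimately show ?thesis by (simp add: card dvd_eq_mod_eq_0)
qed

lemma orbits_of_sizeE:
  assumes "B \<in> orbits_of_size d"
  obtains x where "x \<in> P" "B = orbit g x" "card B = d"
  using assms unfolding orbits_of_size_def by blast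

lemma orbits_of_size_disjoint:
  assumes "B \<in> orbits_of_size d" "B' \<in> orbits_of_size d'" "B \<noteq> B'"
  shows "B \<inter> B' = {}"
  using assms by (elim orbits_of_sizeE) (metis disjoint_iff orbit_eq)

lemma orbits_of_size_subset: "B \<in> orbits_of_size d \<Longrightarrow> B \<subseteq> {x \<in> P. (g ^^ d) x = x}"
proof
  fix y assume B: "B \<in> orbits_of_size d" "y \<in> B"
  then obtain x where x: "x \<in> P" "B = orbit g x" "card B = d" by (elim orbits_of_sizeE)
  hence "y \<in> P" "orbit g y = B" using orbit_subset_P orbit_eq B(2) by blast+
  thus "y \<in> {x \<in> P. (g ^^ d) x = x}" using funpow_fixed_iff[of y d] x(3) by simp
qed

lemma finite_orbits_of_size:
  assumes "d \<ge> 1"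
  shows "finite (orbits_of_size d)"
proof (rule finite_subset)
  show "orbits_of_size d \<subseteq> Pow {x \<in> P. (g ^^ d) x = x}"
    by (rule subsetI) (rule PowI, rule orbits_of_size_subset)
  show "finite (Pow {x \<in> P. (g ^^ d) x = x})"
    using finite_fixed[OF assms] by (rule finite_Pow_iff[THEN iffD2])
qed

lemma card_fixed:
  assumes n: "n \<ge> 1"
  shows "card {x \<in> P. (g ^^ n) x = x} = (\<Sum>d | d dvd n. d * card (orbits_of_size d))"
proof -
  let ?D = "{d. d dvd n}"
  let ?A = "\<Union>d\<in>?D. orbits_of_size d"
  have pos: "d \<ge> 1" if "d \<in> ?D" for d
    using that n dvd_pos_nat[of n d] by simp
  have finD: "finite ?D" using n by simp
  have fin: "finite (orbits_of_size d)" if "d \<in> ?D" for d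
    using pos[OF that] by (rule finite_orbits_of_size)
  have "{x \<in> P. (g ^^ n) x = x} = \<Union>?A"
  proof (intro equalityI subsetI)
    fix x assume "x \<in> {x \<in> P. (g ^^ n) x = x}"
    hence x: "x \<in> P" "card (orbit g x) dvd n" by (auto simp: funpow_fixed_iff)
    hence "orbit g x \<in> orbits_of_size (card (orbit g x))" by (auto simp: orbits_of_size_def)
    thus "x \<in> \<Union>?A" using x self_in_orbit[OF x(1)] by blast
  next
    fix x assume "x \<in> \<Union>?A"
    then obtain d B where d: "d dvd n" "B \<in> orbits_of_size d" "x \<in> B" by blast
    then obtain y where y: "y \<in> P" "B = orbit g y" "card B = d" by (elim orbits_of_sizeE)
    hence "x \<in> P" "orbit g x = B" using orbit_subset_P orbit_eq d(3) by blast+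
    thus "x \<in> {x \<in> P. (g ^^ n) x = x}" using y d(1) by (simp add: funpow_fixed_iff)
  qed
  also have "card (\<Union>?A) = (\<Sum>B\<in>?A. card B)"
  proof (rule card_Union_disjoint)
    show "pairwise disjnt ?A"
      unfolding pairwise_def disjnt_def by (blast dest: orbits_of_size_disjoint)
    show "finite B" if "B \<in> ?A" for B
      using that finite_orbit_P by (auto elim: orbits_of_sizeE)
  qed
  also have "\<dots> = (\<Sum>d\<in>?D. \<Sum>B\<in>orbits_of_size d. card B)"
    using finD fin by (intro sum.UNION_disjoint) (auto simp: orbits_of_size_def)
  also have "\<dots> = (\<Sum>d\<in>?D. d * card (orbits_of_size d))"
    by (intro sum.cong refl) (auto elim!: orbits_of_sizeE simp: orbits_of_size_def)
  finally show ?thesis .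
qed

end

lemma periodic_map_funpow:
  assumes "periodic_map g P" "r \<ge> 1"
  shows "periodic_map (g ^^ r) P"
proof -
  interpret periodic_map g P by fact
  have iter: "(g ^^ n) x \<in> P" if "x \<in> P" for n x
    using that by (induction n) (auto intro: maps)
  show ?thesis
  proof
    fix x assume x: "x \<in> P"
    show "(g ^^ r) x \<in> P" using iter[OF x] .
    obtain n where n: "n \<ge> 1" "(g ^^ n) x = x" using periodic[OF x] by blast
    have "((g ^^ r) ^^ n) x = (g ^^ (n * r)) x" by (simp add: funpow_mult mult.commute)
    also have "\<dots> = x" using funpow_fixed_iff[OF x] n(2) by (simp add: dvd_mult2)
    finally show "\<exists>n\<ge>1. ((g ^^ r) ^^ n) x = x" using n(1) by blast
  next
    fix n :: nat assume "n \<ge> 1"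
    thus "finite {x \<in> P. ((g ^^ r) ^^ n) x = x}"
      using finite_fixed[of "r * n"] assms(2) by (simp add: funpow_mult mult.commute)
  qed
qed

section \<open>The polynomial counting orbits of a given size\<close>

text \<open>
  If \<open>A\<close> counts fixed points, in the sense that \<open>A(Q\<^sup>n)\<close> is the number of fixed points of the
  \<open>n\<close>-th power of a map, then the value at \<open>Q\<close> of this polynomial is the number of
  orbits of size \<open>n\<close>. It is the unique solution of \<open>\<Sum>\<^bsub>d | n\<^esub> d m\<^sub>d(q) = A(q\<^sup>n)\<close>.
\<close>

fun orbit_poly :: "rat poly \<Rightarrow> nat \<Rightarrow> rat poly" where
  "orbit_poly A n = smult (1 / of_nat n) (pcompose A (monom 1 n) -
     (\<Sum>d | d dvd n \<and> d < n. smult (of_nat d) (orbit_poly A d)))"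

declare orbit_poly.simps [simp del]

lemma sum_orbit_poly:
  assumes n: "n > 0"
  shows "(\<Sum>d | d dvd n. smult (of_nat d) (orbit_poly A d)) = pcompose A (monom 1 n)"
  unfolding sum_divisors_split[OF n] using n by (subst (1) orbit_poly.simps) simp

lemma poly_orbit_poly:
  assumes count: "\<And>n. n \<ge> 1 \<Longrightarrow> (\<Sum>d | d dvd n. of_nat d * M d) = poly A (Q ^ n)"
  assumes "n \<ge> 1"
  shows "poly (orbit_poly A n) Q = M n"
  using assms(2)
proof (induction n rule: less_induct)
  case (less n)
  hence n: "n > 0" by simp
  let ?r = "\<lambda>f. \<Sum>d | d dvd n \<and> d < n. of_nat d * f d :: rat"
  have "poly (\<Sum>d | d dvd n. smult (of_nat d) (orbit_poly A d)) Q = poly A (Q ^ n)"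
    unfolding sum_orbit_poly[OF n] by (simp add: poly_pcompose poly_monom)
  hence "of_nat n * poly (orbit_poly A n) Q + ?r (\<lambda>d. poly (orbit_poly A d) Q) = of_nat n * M n + ?r M"
    using count[of n] n unfolding sum_divisors_split[OF n] by (simp add: poly_sum)
  moreover have "?r (\<lambda>d. poly (orbit_poly A d) Q) = ?r M"
  proof (intro sum.cong refl)
    fix d assume "d \<in> {d. d dvd n \<and> d < n}"
    hence "d < n" "d \<ge> 1" using n dvd_pos_nat[of n d] by simp_all
    thus "of_nat d * poly (orbit_poly A d) Q = of_nat d * M d" using less.IH by simp
  qed
  ultimately show ?case using n by simp
qed

lemma poly_eqI_infinite:
  fixes p q :: "'a :: {comm_ring_1,ring_no_zero_divisors} poly"
  assumes "infinite S" "\<And>x. x \<in> S \<Longrightarrow> poly p x = poly q x"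
  shows "p = q"
proof (rule ccontr)
  assume "p \<noteq> q"
  hence "finite {x. poly (p - q) x = 0}" by (intro poly_roots_finite) simp
  moreover have "S \<subseteq> {x. poly (p - q) x = 0}" using assms(2) by auto
  ultimately show False using assms(1) finite_subset by blast
qed

section \<open>Types of colorings\<close>

lemma zero_color:
  assumes "is_coloring_data N C"
  shows "zero_color C \<in> colors C" "cdeg C (zero_color C) = 0"
    "c \<in> colors C \<Longrightarrow> cdeg C c = 0 \<Longrightarrow> c = zero_color C"
proof -
  have ex1: "\<exists>!c. c \<in> colors C \<and> cdeg C c = 0"
    using assms unfolding is_coloring_data_def by (elim conjE)
  have z: "zero_color C \<in> colors C \<and> cdeg C (zero_color C) = 0"
    unfolding zero_color_def by (rule theI'[OF ex1])
  thus "zero_color C \<in> colors C" "cdeg C (zero_color C) = 0" by simp_all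
  show "c = zero_color C" if "c \<in> colors C" "cdeg C c = 0"
    using ex1 z that by blast
qed

text \<open>
  The type with one more orbit of size \<open>d\<close> and color \<open>c\<close>.
\<close>

definition incr_type :: "nat \<Rightarrow> 'c \<Rightarrow> 'c ctype \<Rightarrow> 'c ctype" where
  "incr_type d c \<sigma> = \<sigma>(d := (\<sigma> d)(c := Suc (\<sigma> d c)))"

lemma incr_type_apply: "incr_type d c \<sigma> e b = (if e = d \<and> b = c then Suc (\<sigma> d c) else \<sigma> e b)"
  by (simp add: incr_type_def)

lemma incr_type_inject: "incr_type d c \<sigma> = incr_type d c \<tau> \<Longrightarrow> \<sigma> = \<tau>"
proof (intro ext)
  fix e b assume "incr_type d c \<sigma> = incr_type d c \<tau>"
  hence "incr_type d c \<sigma> e b = incr_type d c \<tau> e b" by simp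
  thus "\<sigma> e b = \<tau> e b" by (simp add: incr_type_apply split: if_splits)
qed

lemma ctype_supp_incr_type: "ctype_supp (incr_type d c \<sigma>) = insert (d, c) (ctype_supp \<sigma>)"
  by (auto simp: ctype_supp_def incr_type_apply split: if_splits)

lemma incr_type_in_ctypes:
  "\<sigma> \<in> ctypes C \<Longrightarrow> d \<ge> 1 \<Longrightarrow> c \<in> colors C - {zero_color C} \<Longrightarrow> incr_type d c \<sigma> \<in> ctypes C"
  by (simp add: ctypes_def ctype_supp_incr_type)

lemma ctypes_supp:
  assumes "\<tau> \<in> ctypes C" "\<tau> d c \<noteq> 0"
  shows "d \<ge> 1" "c \<in> colors C - {zero_color C}"
  using assms unfolding ctypes_def ctype_supp_def by fastforce+

lemma ctypes_finite_supp: "\<tau> \<in> ctypes C \<Longrightarrow> finite (ctype_supp \<tau>)"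
  by (simp add: ctypes_def)

lemma ctypes_decr:
  assumes "\<tau> \<in> ctypes C" "\<tau> d c \<noteq> 0"
  obtains \<sigma> where "\<sigma> \<in> ctypes C" "\<tau> = incr_type d c \<sigma>"
proof
  let ?\<sigma> = "\<tau>(d := (\<tau> d)(c := \<tau> d c - 1))"
  show "\<tau> = incr_type d c ?\<sigma>"
    using assms(2) by (intro ext) (simp add: incr_type_apply)
  have "ctype_supp ?\<sigma> \<subseteq> ctype_supp \<tau>"
    by (auto simp: ctype_supp_def split: if_splits)
  thus "?\<sigma> \<in> ctypes C"
    using assms(1) finite_subset by (auto simp: ctypes_def)
qed

lemma finite_colors_of_type:
  assumes "\<tau> \<in> ctypes C"
  shows "finite {c. \<tau> d c \<noteq> 0}"
proof (rule finite_subset)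
  show "{c. \<tau> d c \<noteq> 0} \<subseteq> snd ` ctype_supp \<tau>" by (force simp: ctype_supp_def)
qed (use ctypes_finite_supp[OF assms] in simp)

lemma ctype_degree_eq:
  assumes "finite K" "ctype_supp \<tau> \<subseteq> K"
  shows "ctype_degree C \<tau> = (\<Sum>(d, c)\<in>K. \<tau> d c * d * cdeg C c)"
  unfolding ctype_degree_def using assms
  by (intro sum.mono_neutral_left) (auto simp: ctype_supp_def)

lemma ctype_weight_eq:
  assumes "finite K" "ctype_supp \<tau> \<subseteq> K"
  shows "ctype_weight C \<tau> = (\<Prod>(d, c)\<in>K. mls_subst_power d (weight C c) ^ \<tau> d c)"
  unfolding ctype_weight_def using assms
  by (intro prod.mono_neutral_left) (auto simp: ctype_supp_def intro!: Nat.gr0I)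

lemma ctype_degree_incr_type:
  assumes "finite (ctype_supp \<sigma>)"
  shows "ctype_degree C (incr_type d c \<sigma>) = ctype_degree C \<sigma> + d * cdeg C c"
proof -
  let ?K = "insert (d, c) (ctype_supp \<sigma>)"
  have "ctype_degree C (incr_type d c \<sigma>) = (\<Sum>(e, b)\<in>?K. incr_type d c \<sigma> e b * e * cdeg C b)"
    using assms by (intro ctype_degree_eq) (auto simp: ctype_supp_incr_type)
  also have "\<dots> = (\<Sum>(e, b)\<in>?K. \<sigma> e b * e * cdeg C b) + (\<Sum>x\<in>?K. if x = (d, c) then d * cdeg C c else 0)"
    unfolding sum.distrib[symmetric]
    by (intro sum.cong refl) (auto simp: incr_type_apply algebra_simps split: if_splits)
  also have "(\<Sum>(e, b)\<in>?K. \<sigma> e b * e * cdeg C b) = ctype_degree C \<sigma>"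
    using assms by (intro ctype_degree_eq[symmetric]) auto
  also have "(\<Sum>x\<in>?K. if x = (d, c) then d * cdeg C c else 0) = d * cdeg C c"
    using assms by (subst sum.delta) auto
  finally show ?thesis .
qed

lemma ctype_weight_incr_type:
  assumes "finite (ctype_supp \<sigma>)"
  shows "ctype_weight C (incr_type d c \<sigma>) = mls_subst_power d (weight C c) * ctype_weight C \<sigma>"
proof -
  let ?K = "insert (d, c) (ctype_supp \<sigma>)"
  let ?w = "\<lambda>e b. mls_subst_power e (weight C b)"
  have "ctype_weight C (incr_type d c \<sigma>) = (\<Prod>(e, b)\<in>?K. ?w e b ^ incr_type d c \<sigma> e b)"
    using assms by (intro ctype_weight_eq) (auto simp: ctype_supp_incr_type)
  also have "\<dots> = (\<Prod>x\<in>?K. if x = (d, c) then ?w d c else 1) * (\<Prod>(e, b)\<in>?K. ?w e b ^ \<sigma> e b)"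
    unfolding prod.distrib[symmetric]
    by (intro prod.cong refl) (auto simp: incr_type_apply split: if_splits)
  also have "(\<Prod>(e, b)\<in>?K. ?w e b ^ \<sigma> e b) = ctype_weight C \<sigma>"
    using assms by (intro ctype_weight_eq[symmetric]) auto
  also have "(\<Prod>x\<in>?K. if x = (d, c) then ?w d c else 1) = ?w d c"
    using assms by (subst prod.delta) auto
  finally show ?thesis .
qed

lemma cdeg_pos:
  assumes "is_coloring_data N C" "c \<in> colors C - {zero_color C}"
  shows "cdeg C c > 0"
  using zero_color(3)[OF assms(1), of c] assms(2) by auto

lemma ctypes_induct [consumes 2, case_names zero incr]:
  assumes "is_coloring_data N C" "\<tau> \<in> ctypes C"
  assumes zero: "Q (\<lambda>_ _. 0)"
  assumes incr: "\<And>\<sigma> d c. \<sigma> \<in> ctypes C \<Longrightarrow> d \<ge> 1 \<Longrightarrow> c \<in> colors C - {zero_color C} \<Longrightarrow>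
    Q \<sigma> \<Longrightarrow> Q (incr_type d c \<sigma>)"
  shows "Q \<tau>"
  using assms(2)
proof (induction "ctype_degree C \<tau>" arbitrary: \<tau> rule: less_induct)
  case less
  show ?case
  proof (cases "\<exists>d c. \<tau> d c \<noteq> 0")
    case False
    hence "\<tau> = (\<lambda>_ _. 0)" by (intro ext) simp
    thus ?thesis using zero by simp
  next
    case True
    then obtain d c where dc: "\<tau> d c \<noteq> 0" by blast
    note dc' = ctypes_supp[OF less.prems dc]
    obtain \<sigma> where \<sigma>: "\<sigma> \<in> ctypes C" "\<tau> = incr_type d c \<sigma>"
      by (rule ctypes_decr[OF less.prems dc])
    have "ctype_degree C \<sigma> < ctype_degree C \<tau>"
      using cdeg_pos[OF assms(1) dc'(2)] dc'(1)
      by (simp add: \<sigma>(2) ctype_degree_incr_type ctypes_finite_supp[OF \<sigma>(1)])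
    hence "Q \<sigma>" using \<sigma>(1) by (rule less.hyps)
    thus ?thesis unfolding \<sigma>(2) by (rule incr[OF \<sigma>(1) dc'])
  qed
qed

section \<open>Counting colorings of a given type\<close>

text \<open>
  Colorings of \<open>Y\<close> over the extension of degree \<open>r\<close> of the ground field. The orbits are those of
  the \<open>r\<close>-th power of Frobenius.
\<close>

locale coloring_count = periodic_map "frob Y ^^ r" "points Y"
  for Y :: "('k :: {field,finite}, 'x) variety" and r :: nat +
  fixes N :: nat and C :: "'c coloring_data"
  assumes C: "is_coloring_data N C"
begin

abbreviation "g \<equiv> frob Y ^^ r"
abbreviation "z \<equiv> zero_color C"

text \<open>
  The orbits of size \<open>d\<close> with color \<open>c\<close>. The orbits of color \<open>z\<close> are the uncolored ones.
\<close>

definition colored_orbits :: "('x \<Rightarrow> 'c) \<Rightarrow> nat \<Rightarrow> 'c \<Rightarrow> 'x set set" where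
  "colored_orbits \<Lambda> d c = {B \<in> orbits_of_size d. \<forall>x\<in>B. \<Lambda> x = c}"

definition colorings_of_type :: "'c ctype \<Rightarrow> ('x \<Rightarrow> 'c) set" where
  "colorings_of_type \<sigma> = {\<Lambda> \<in> colorings C Y r. coloring_type C Y r \<Lambda> = \<sigma>}"

definition recolor :: "'x set \<Rightarrow> 'c \<Rightarrow> ('x \<Rightarrow> 'c) \<Rightarrow> 'x \<Rightarrow> 'c" where
  "recolor B c \<Lambda> x = (if x \<in> B then c else \<Lambda> x)"

lemma coloringsD:
  assumes "\<Lambda> \<in> colorings C Y r"
  shows "x \<in> points Y \<Longrightarrow> \<Lambda> x \<in> colors C" "x \<notin> points Y \<Longrightarrow> \<Lambda> x = z"
    "finite {x \<in> points Y. \<Lambda> x \<noteq> z}" "x \<in> points Y \<Longrightarrow> \<Lambda> (g x) = \<Lambda> x"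
  using assms by (simp_all add: colorings_def)

lemma coloring_orbit:
  assumes \<Lambda>: "\<Lambda> \<in> colorings C Y r"
  assumes "y \<in> orbit g x" "x \<in> points Y"
  shows "\<Lambda> y = \<Lambda> x"
  using assms(2,3)
proof (induction rule: orbit.induct)
  case base
  thus ?case by (rule coloringsD(4)[OF \<Lambda>])
next
  case (step y)
  have "y \<in> points Y" using step orbit_subset_P by blast
  thus ?case using step coloringsD(4)[OF \<Lambda>] by simp
qed

lemma coloring_orbit_const:
  assumes \<Lambda>: "\<Lambda> \<in> colorings C Y r" and B: "B \<in> orbits_of_size d" "x \<in> B"
  shows "B \<in> colored_orbits \<Lambda> d (\<Lambda> x)"
proof -
  obtain y where y: "y \<in> points Y" "B = orbit g y" using B(1) by (rule orbits_of_sizeE)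
  have "\<Lambda> x' = \<Lambda> y" if "x' \<in> B" for x' using coloring_orbit[OF \<Lambda>] y that by blast
  thus ?thesis using B by (simp add: colored_orbits_def)
qed

lemma orbits_of_size_nonempty: "B \<in> orbits_of_size d \<Longrightarrow> \<exists>x. x \<in> B"
  by (elim orbits_of_sizeE) (use self_in_orbit in blast)

lemma orbits_of_size_points: "B \<in> orbits_of_size d \<Longrightarrow> B \<subseteq> points Y"
  by (elim orbits_of_sizeE) (use orbit_subset_P in blast)

lemma coloring_type_eq:
  assumes \<Lambda>: "\<Lambda> \<in> colorings C Y r"
  shows "coloring_type C Y r \<Lambda> d c =
    (if d \<ge> 1 \<and> c \<in> colors C - {z} then card (colored_orbits \<Lambda> d c) else 0)"
proof -
  have "{B. \<exists>x\<in>points Y. B = orbit g x \<and> card B = d \<and> \<Lambda> x = c} = colored_orbits \<Lambda> d c"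
  proof (intro equalityI subsetI)
    fix B assume "B \<in> {B. \<exists>x\<in>points Y. B = orbit g x \<and> card B = d \<and> \<Lambda> x = c}"
    then obtain x where x: "x \<in> points Y" "B = orbit g x" "card B = d" "\<Lambda> x = c" by blast
    hence "B \<in> orbits_of_size d" "x \<in> B"
      using self_in_orbit unfolding orbits_of_size_def by blast+
    thus "B \<in> colored_orbits \<Lambda> d c" using coloring_orbit_const[OF \<Lambda>, of B d x] x(4) by simp
  next
    fix B assume B: "B \<in> colored_orbits \<Lambda> d c"
    then obtain x where x: "x \<in> points Y" "B = orbit g x" "card B = d"
      unfolding colored_orbits_def by (blast elim: orbits_of_sizeE)
    moreover have "\<Lambda> x = c" using B x(2) self_in_orbit[OF x(1)] by (simp add: colored_orbits_def)
    ultimately show "B \<in> {B. \<exists>x\<in>points Y. B = orbit g x \<and> card B = d \<and> \<Lambda> x = c}" by blast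
  qed
  thus ?thesis by (simp add: coloring_type_def)
qed

lemma finite_colored_orbits: "d \<ge> 1 \<Longrightarrow> finite (colored_orbits \<Lambda> d c)"
  unfolding colored_orbits_def using finite_orbits_of_size[of d] by simp

lemma recolor_coloring:
  assumes \<Lambda>: "\<Lambda> \<in> colorings C Y r" and B: "B \<in> orbits_of_size d" "d \<ge> 1" and c: "c \<in> colors C"
  shows "recolor B c \<Lambda> \<in> colorings C Y r"
  unfolding colorings_def mem_Collect_eq
proof (intro conjI ballI allI impI)
  obtain y where y: "y \<in> points Y" "B = orbit g y" "card B = d" using B(1) by (rule orbits_of_sizeE)
  have "finite B" using y finite_orbit_P by simp
  fix x
  show "recolor B c \<Lambda> x \<in> colors C" if "x \<in> points Y"
    using that c coloringsD(1)[OF \<Lambda>] by (simp add: recolor_def)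
  show "recolor B c \<Lambda> x = z" if "x \<notin> points Y"
    using that orbits_of_size_points[OF B(1)] coloringsD(2)[OF \<Lambda>] by (auto simp: recolor_def)
  have "{x \<in> points Y. recolor B c \<Lambda> x \<noteq> z} \<subseteq> {x \<in> points Y. \<Lambda> x \<noteq> z} \<union> B"
    by (auto simp: recolor_def split: if_splits)
  thus "finite {x \<in> points Y. recolor B c \<Lambda> x \<noteq> z}"
    by (rule finite_subset) (use coloringsD(3)[OF \<Lambda>] \<open>finite B\<close> in simp)
  show "recolor B c \<Lambda> (g x) = recolor B c \<Lambda> x" if x: "x \<in> points Y"
  proof -
    have "g x \<in> B \<longleftrightarrow> x \<in> B"
    proof
      assume "x \<in> B"
      thus "g x \<in> B" unfolding y(2) by (rule orbit.step)
    next
      assume "g x \<in> B"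
      hence "orbit g (g x) = B" unfolding y(2) using y(1) by (intro orbit_eq)
      moreover have "orbit g (g x) = orbit g x" using self_in_orbit[OF x] by (rule self_in_orbit_step)
      ultimately show "x \<in> B" using self_in_orbit[OF x] by simp
    qed
    thus ?thesis using coloringsD(4)[OF \<Lambda> x] by (simp add: recolor_def)
  qed
qed

lemma recolor_type:
  assumes \<Lambda>: "\<Lambda> \<in> colorings C Y r" and d: "d \<ge> 1" and B: "B \<in> colored_orbits \<Lambda> d z"
    and c: "c \<in> colors C - {z}"
  shows "coloring_type C Y r (recolor B c \<Lambda>) = incr_type d c (coloring_type C Y r \<Lambda>)"
proof (intro ext)
  fix e b
  have Bo: "B \<in> orbits_of_size d" and Bz: "\<And>x. x \<in> B \<Longrightarrow> \<Lambda> x = z"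
    using B by (auto simp: colored_orbits_def)
  obtain y where y: "y \<in> B" using orbits_of_size_nonempty[OF Bo] by blast
  have R: "recolor B c \<Lambda> \<in> colorings C Y r"
    using c by (intro recolor_coloring[OF \<Lambda> Bo d]) simp
  show "coloring_type C Y r (recolor B c \<Lambda>) e b = incr_type d c (coloring_type C Y r \<Lambda>) e b"
  proof (cases "e \<ge> 1 \<and> b \<in> colors C - {z}")
    case False
    thus ?thesis using d c unfolding incr_type_apply coloring_type_eq[OF R] coloring_type_eq[OF \<Lambda>]
      by (simp only: if_False) auto
  next
    case True
    have mem: "B' \<in> colored_orbits (recolor B c \<Lambda>) e b \<longleftrightarrow>
      B' \<in> colored_orbits \<Lambda> e b \<or> (B' = B \<and> e = d \<and> b = c)" for B'
    proof (cases "B' \<in> orbits_of_size e")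
      case False
      thus ?thesis using Bo by (auto simp: colored_orbits_def)
    next
      case B': True
      show ?thesis
      proof (cases "B' = B")
        case True
        hence "e = d" using B' Bo by (elim orbits_of_sizeE) simp
        thus ?thesis
          using True Bo y Bz \<open>e \<ge> 1 \<and> b \<in> colors C - {z}\<close>
          by (auto simp: colored_orbits_def recolor_def)
      next
        case False
        hence "B' \<inter> B = {}" by (rule orbits_of_size_disjoint[OF B' Bo])
        hence "recolor B c \<Lambda> x = \<Lambda> x" if "x \<in> B'" for x using that by (auto simp: recolor_def)
        thus ?thesis using False by (simp add: colored_orbits_def)
      qed
    qed
    show ?thesis
    proof (cases "e = d \<and> b = c")
      case eq: True
      have "colored_orbits (recolor B c \<Lambda>) e b = insert B (colored_orbits \<Lambda> e b)"
        using mem eq by blast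
      moreover have "B \<notin> colored_orbits \<Lambda> e b"
        using Bz y True by (auto simp: colored_orbits_def)
      ultimately show ?thesis
        using True eq finite_colored_orbits[of e]
        by (simp add: incr_type_apply coloring_type_eq[OF R] coloring_type_eq[OF \<Lambda>])
    next
      case False
      hence "colored_orbits (recolor B c \<Lambda>) e b = colored_orbits \<Lambda> e b"
        using mem by blast
      thus ?thesis
        by (simp only: incr_type_apply if_not_P[OF False] coloring_type_eq[OF R] coloring_type_eq[OF \<Lambda>])
    qed
  qed
qed

lemma card_uncolored_orbits:
  assumes \<Lambda>: "\<Lambda> \<in> colorings_of_type \<sigma>" and \<sigma>: "\<sigma> \<in> ctypes C" and d: "d \<ge> 1"
  shows "card (colored_orbits \<Lambda> d z) + (\<Sum>c | \<sigma> d c \<noteq> 0. \<sigma> d c) = card (orbits_of_size d)"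
proof -
  define S where "S = {c. \<sigma> d c \<noteq> 0}"
  have \<Lambda>': "\<Lambda> \<in> colorings C Y r" "coloring_type C Y r \<Lambda> = \<sigma>"
    using \<Lambda> by (auto simp: colorings_of_type_def)
  have S: "c \<in> colors C - {z}" if "c \<in> S" for c
    using ctypes_supp[OF \<sigma>] that by (auto simp: S_def)
  have finS: "finite S" unfolding S_def by (rule finite_colors_of_type[OF \<sigma>])
  have \<sigma>_eq: "\<sigma> d c = card (colored_orbits \<Lambda> d c)" if "c \<in> colors C - {z}" for c
    using coloring_type_eq[OF \<Lambda>'(1), of d c] that d \<Lambda>'(2) by simp
  have zS: "z \<notin> S" using S by blast
  have "orbits_of_size d = (\<Union>c\<in>insert z S. colored_orbits \<Lambda> d c)"
  proof (intro equalityI subsetI)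
    fix B assume B: "B \<in> orbits_of_size d"
    obtain x where x: "x \<in> B" using orbits_of_size_nonempty[OF B] by blast
    have Bx: "B \<in> colored_orbits \<Lambda> d (\<Lambda> x)" by (rule coloring_orbit_const[OF \<Lambda>'(1) B x])
    have "\<Lambda> x \<in> insert z S"
    proof (cases "\<Lambda> x = z")
      case False
      hence "\<Lambda> x \<in> colors C - {z}"
        using coloringsD(1)[OF \<Lambda>'(1)] orbits_of_size_points[OF B] x by blast
      from \<sigma>_eq[OF this] have "\<sigma> d (\<Lambda> x) \<noteq> 0"
        using Bx finite_colored_orbits[OF d] by (auto simp: card_eq_0_iff)
      thus ?thesis by (simp add: S_def)
    qed simp
    thus "B \<in> (\<Union>c\<in>insert z S. colored_orbits \<Lambda> d c)" using Bx by blast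
  qed (auto simp: colored_orbits_def)
  also have "card \<dots> = (\<Sum>c\<in>insert z S. card (colored_orbits \<Lambda> d c))"
  proof (rule card_UN_disjoint)
    show "\<forall>c\<in>insert z S. \<forall>c'\<in>insert z S. c \<noteq> c' \<longrightarrow> colored_orbits \<Lambda> d c \<inter> colored_orbits \<Lambda> d c' = {}"
      using orbits_of_size_nonempty by (fastforce simp: colored_orbits_def)
  qed (use finS finite_colored_orbits[OF d] in auto)
  also have "\<dots> = card (colored_orbits \<Lambda> d z) + (\<Sum>c\<in>S. \<sigma> d c)"
    using finS zS S \<sigma>_eq by simp
  finally show ?thesis by (simp add: S_def)
qed

text \<open>
  Both sides of the equation become numbers of pairs of a coloring and an orbit of size \<open>d\<close> after
  subtracting the second summand: on the left the coloring has type \<open>incr_type d c \<sigma>\<close> and the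
  orbit has color \<open>c\<close>, on the right the coloring has type \<open>\<sigma>\<close> and the orbit is uncolored.
  Recoloring the orbit is a bijection between these pairs.
\<close>

lemma colorings_of_type_recursion:
  assumes \<sigma>: "\<sigma> \<in> ctypes C" and d: "d \<ge> 1" and c: "c \<in> colors C - {z}"
    and fin: "finite (colorings_of_type \<sigma>)"
  shows "finite (colorings_of_type (incr_type d c \<sigma>))"
    and "Suc (\<sigma> d c) * card (colorings_of_type (incr_type d c \<sigma>)) +
      (\<Sum>c | \<sigma> d c \<noteq> 0. \<sigma> d c) * card (colorings_of_type \<sigma>) =
      card (orbits_of_size d) * card (colorings_of_type \<sigma>)"
proof -
  let ?\<tau> = "incr_type d c \<sigma>"
  define A where "A = Sigma (colorings_of_type \<sigma>) (\<lambda>\<Lambda>. colored_orbits \<Lambda> d z)"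
  define A' where "A' = Sigma (colorings_of_type ?\<tau>) (\<lambda>\<Lambda>. colored_orbits \<Lambda> d c)"
  have bij: "bij_betw (\<lambda>(\<Lambda>, B). (recolor B c \<Lambda>, B)) A A'"
  proof (rule bij_betw_byWitness[where f' = "\<lambda>(\<Lambda>, B). (recolor B z \<Lambda>, B)"])
    have *: "recolor B z (recolor B c \<Lambda>) = \<Lambda>" if "B \<in> colored_orbits \<Lambda> d z" for \<Lambda> B c
      using that by (auto simp: recolor_def colored_orbits_def)
    have **: "recolor B c (recolor B z \<Lambda>) = \<Lambda>" if "B \<in> colored_orbits \<Lambda> d c" for \<Lambda> B
      using that by (auto simp: recolor_def colored_orbits_def)
    show "\<forall>a\<in>A. (case case a of (\<Lambda>, B) \<Rightarrow> (recolor B c \<Lambda>, B) of (\<Lambda>, B) \<Rightarrow> (recolor B z \<Lambda>, B)) = a"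
      by (auto simp: A_def *)
    show "\<forall>a\<in>A'. (case case a of (\<Lambda>, B) \<Rightarrow> (recolor B z \<Lambda>, B) of (\<Lambda>, B) \<Rightarrow> (recolor B c \<Lambda>, B)) = a"
      by (auto simp: A'_def **)
    show "(\<lambda>(\<Lambda>, B). (recolor B c \<Lambda>, B)) ` A \<subseteq> A'"
    proof clarsimp
      fix \<Lambda> B assume "(\<Lambda>, B) \<in> A"
      hence \<Lambda>: "\<Lambda> \<in> colorings C Y r" "coloring_type C Y r \<Lambda> = \<sigma>" and B: "B \<in> colored_orbits \<Lambda> d z"
        by (auto simp: A_def colorings_of_type_def)
      have Bo: "B \<in> orbits_of_size d" using B by (simp add: colored_orbits_def)
      have "recolor B c \<Lambda> \<in> colorings C Y r"
        using c by (intro recolor_coloring[OF \<Lambda>(1) Bo d]) simp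
      moreover have "coloring_type C Y r (recolor B c \<Lambda>) = ?\<tau>"
        using recolor_type[OF \<Lambda>(1) d B c] \<Lambda>(2) by simp
      moreover have "B \<in> colored_orbits (recolor B c \<Lambda>) d c"
        using Bo by (simp add: colored_orbits_def recolor_def)
      ultimately show "(recolor B c \<Lambda>, B) \<in> A'" by (simp add: A'_def colorings_of_type_def)
    qed
    show "(\<lambda>(\<Lambda>, B). (recolor B z \<Lambda>, B)) ` A' \<subseteq> A"
    proof clarsimp
      fix \<Lambda> B assume "(\<Lambda>, B) \<in> A'"
      hence \<Lambda>: "\<Lambda> \<in> colorings C Y r" "coloring_type C Y r \<Lambda> = ?\<tau>" and B: "B \<in> colored_orbits \<Lambda> d c"
        by (auto simp: A'_def colorings_of_type_def)
      have Bo: "B \<in> orbits_of_size d" using B by (simp add: colored_orbits_def)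
      have R: "recolor B z \<Lambda> \<in> colorings C Y r"
        using zero_color(1)[OF C] by (intro recolor_coloring[OF \<Lambda>(1) Bo d])
      moreover have Bz: "B \<in> colored_orbits (recolor B z \<Lambda>) d z"
        using Bo by (simp add: colored_orbits_def recolor_def)
      moreover have "incr_type d c (coloring_type C Y r (recolor B z \<Lambda>)) = incr_type d c \<sigma>"
        using recolor_type[OF R d Bz c] \<Lambda>(2) **[OF B] by simp
      hence "coloring_type C Y r (recolor B z \<Lambda>) = \<sigma>" by (rule incr_type_inject)
      ultimately show "(recolor B z \<Lambda>, B) \<in> A" by (simp add: A_def colorings_of_type_def)
    qed
  qed
  have card': "card (colored_orbits \<Lambda> d c) = Suc (\<sigma> d c)" if "\<Lambda> \<in> colorings_of_type ?\<tau>" for \<Lambda>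
  proof -
    have "\<Lambda> \<in> colorings C Y r" "coloring_type C Y r \<Lambda> d c = ?\<tau> d c"
      using that by (auto simp: colorings_of_type_def)
    thus ?thesis using coloring_type_eq[of \<Lambda> d c] d c by (simp add: incr_type_apply)
  qed
  have "finite A"
    unfolding A_def using fin finite_colored_orbits[OF d] by (intro finite_SigmaI)
  hence "finite A'" using bij_betw_finite[OF bij] by simp
  (* Every coloring of the larger type has at least one orbit of size d and color c. *)
  moreover have "colorings_of_type ?\<tau> \<subseteq> fst ` A'"
  proof
    fix \<Lambda> assume \<Lambda>: "\<Lambda> \<in> colorings_of_type ?\<tau>"
    then obtain B where "B \<in> colored_orbits \<Lambda> d c" using card'[OF \<Lambda>] by fastforce
    thus "\<Lambda> \<in> fst ` A'" using \<Lambda> unfolding A'_def by force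
  qed
  ultimately show fin': "finite (colorings_of_type ?\<tau>)"
    using finite_surj by blast
  have "card A' = (\<Sum>\<Lambda>\<in>colorings_of_type ?\<tau>. card (colored_orbits \<Lambda> d c))"
    unfolding A'_def using fin' finite_colored_orbits[OF d] by (intro card_SigmaI) auto
  also have "\<dots> = Suc (\<sigma> d c) * card (colorings_of_type ?\<tau>)"
    by (simp add: card')
  finally have cX': "card A' = Suc (\<sigma> d c) * card (colorings_of_type ?\<tau>)" .
  have "card A = (\<Sum>\<Lambda>\<in>colorings_of_type \<sigma>. card (colored_orbits \<Lambda> d z))"
    unfolding A_def using fin finite_colored_orbits[OF d] by (intro card_SigmaI) auto
  hence "card A + (\<Sum>c | \<sigma> d c \<noteq> 0. \<sigma> d c) * card (colorings_of_type \<sigma>) =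
    (\<Sum>\<Lambda>\<in>colorings_of_type \<sigma>. card (colored_orbits \<Lambda> d z) + (\<Sum>c | \<sigma> d c \<noteq> 0. \<sigma> d c))"
    by (simp only: sum.distrib sum_constant mult.commute of_nat_id)
  also have "\<dots> = card (orbits_of_size d) * card (colorings_of_type \<sigma>)"
    using card_uncolored_orbits[OF _ \<sigma> d] by simp
  finally show "Suc (\<sigma> d c) * card (colorings_of_type ?\<tau>) +
      (\<Sum>c | \<sigma> d c \<noteq> 0. \<sigma> d c) * card (colorings_of_type \<sigma>) =
      card (orbits_of_size d) * card (colorings_of_type \<sigma>)"
    using cX' bij_betw_same_card[OF bij] by simp
qed

lemma colorings_of_type_zero: "colorings_of_type (\<lambda>_ _. 0) = {\<lambda>_. z}"
proof (intro equalityI subsetI)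
  fix \<Lambda> assume "\<Lambda> \<in> colorings_of_type (\<lambda>_ _. 0)"
  hence \<Lambda>: "\<Lambda> \<in> colorings C Y r" "\<And>d c. coloring_type C Y r \<Lambda> d c = 0"
    by (auto simp: colorings_of_type_def)
  have "\<Lambda> x = z" for x
  proof (rule ccontr)
    assume nz: "\<Lambda> x \<noteq> z"
    hence x: "x \<in> points Y" using coloringsD(2)[OF \<Lambda>(1)] by blast
    define d where "d = card (orbit g x)"
    have d: "d \<ge> 1" using card_orbit_pos[OF x] by (simp add: d_def)
    have "orbit g x \<in> orbits_of_size d" using x unfolding orbits_of_size_def d_def by blast
    hence "orbit g x \<in> colored_orbits \<Lambda> d (\<Lambda> x)"
      using self_in_orbit[OF x] by (rule coloring_orbit_const[OF \<Lambda>(1)])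
    hence "card (colored_orbits \<Lambda> d (\<Lambda> x)) \<noteq> 0"
      using finite_colored_orbits[OF d] by (auto simp: card_eq_0_iff)
    thus False
      using \<Lambda>(2)[of d "\<Lambda> x"] coloring_type_eq[OF \<Lambda>(1), of d "\<Lambda> x"] d nz coloringsD(1)[OF \<Lambda>(1) x] by simp
  qed
  thus "\<Lambda> \<in> {\<lambda>_. z}" by (simp add: fun_eq_iff)
next
  fix \<Lambda> :: "'x \<Rightarrow> 'c" assume "\<Lambda> \<in> {\<lambda>_. z}"
  hence \<Lambda>: "\<Lambda> = (\<lambda>_. z)" by simp
  have col: "\<Lambda> \<in> colorings C Y r" using zero_color(1)[OF C] by (simp add: \<Lambda> colorings_def)
  moreover have "coloring_type C Y r \<Lambda> = (\<lambda>_ _. 0)"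
  proof (intro ext)
    fix d c
    have "colored_orbits \<Lambda> d c = {}" if "c \<noteq> z"
      using that orbits_of_size_nonempty by (fastforce simp: colored_orbits_def \<Lambda>)
    thus "coloring_type C Y r \<Lambda> d c = 0" by (simp add: coloring_type_eq[OF col])
  qed
  ultimately show "\<Lambda> \<in> colorings_of_type (\<lambda>_ _. 0)" by (simp add: colorings_of_type_def)
qed

end

section \<open>Adams operations on power series\<close>

text \<open>
  The substitution of all variables, including \<open>T\<close>, by their \<open>d\<close>-th powers.
\<close>

definition fps_adams :: "nat \<Rightarrow> rat mls fps \<Rightarrow> rat mls fps" where
  "fps_adams d F = Abs_fps (\<lambda>n. if d dvd n then mls_subst_power d (fps_nth F (n div d)) else 0)"

lemma fps_adams_nth:
  "fps_nth (fps_adams d F) n = (if d dvd n then mls_subst_power d (fps_nth F (n div d)) else 0)"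
  by (simp add: fps_adams_def)

lemma fps_adams_mult:
  assumes d: "d > 0"
  shows "fps_adams d (F * G) = fps_adams d F * fps_adams d G"
proof (rule fps_ext)
  fix n
  have RHS: "fps_nth (fps_adams d F * fps_adams d G) n =
    (\<Sum>i\<le>n. fps_nth (fps_adams d F) i * fps_nth (fps_adams d G) (n - i))"
    by (simp add: fps_mult_nth atLeast0AtMost)
  show "fps_nth (fps_adams d (F * G)) n = fps_nth (fps_adams d F * fps_adams d G) n"
  proof (cases "d dvd n")
    case False
    have "fps_nth (fps_adams d F) i * fps_nth (fps_adams d G) (n - i) = 0" if "i \<le> n" for i
    proof (cases "d dvd i \<and> d dvd (n - i)")
      case True
      hence "d dvd i + (n - i)" by (intro dvd_add) auto
      thus ?thesis using that False by simp
    qed (auto simp: fps_adams_nth)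
    thus ?thesis unfolding RHS using False by (simp add: fps_adams_nth)
  next
    case True
    then obtain k where k: "n = d * k" by (elim dvdE)
    have "fps_nth (fps_adams d (F * G)) n =
      (\<Sum>i\<le>k. mls_subst_power d (fps_nth F i) * mls_subst_power d (fps_nth G (k - i)))"
      using d by (simp add: fps_adams_nth k fps_mult_nth atLeast0AtMost mls_subst_power_sum
          mls_subst_power_mult)
    also have "\<dots> = (\<Sum>i\<in>(*) d ` {..k}. fps_nth (fps_adams d F) i * fps_nth (fps_adams d G) (n - i))"
      using d by (subst sum.reindex) (auto simp: inj_on_def fps_adams_nth k simp flip: diff_mult_distrib2)
    also have "\<dots> = (\<Sum>i\<le>n. fps_nth (fps_adams d F) i * fps_nth (fps_adams d G) (n - i))"
    proof (rule sum.mono_neutral_left)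
      show "\<forall>i\<in>{..n} - (*) d ` {..k}. fps_nth (fps_adams d F) i * fps_nth (fps_adams d G) (n - i) = 0"
      proof
        fix i assume i: "i \<in> {..n} - (*) d ` {..k}"
        have "\<not> d dvd i"
        proof
          assume "d dvd i"
          then obtain l where l: "i = d * l" by (elim dvdE)
          hence "l \<le> k" using i d k by simp
          thus False using i l by blast
        qed
        thus "fps_nth (fps_adams d F) i * fps_nth (fps_adams d G) (n - i) = 0"
          by (simp add: fps_adams_nth)
      qed
    qed (auto simp: k)
    finally show ?thesis unfolding RHS .
  qed
qed

lemma theta_fps_adams:
  assumes d: "d > 0"
  shows "theta (fps_adams d F) = of_nat d * fps_adams d (theta F)"
proof (rule fps_ext)
  fix n
  have *: "of_nat d * G = fps_const (of_nat d) * G" for G :: "rat mls fps" by (simp add: fps_of_nat)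
  show "fps_nth (theta (fps_adams d F)) n = fps_nth (of_nat d * fps_adams d (theta F)) n"
    unfolding * using d
    by (auto simp: theta_nth fps_adams_nth mls_subst_power_mult mult.assoc elim!: dvdE)
qed

lemma has_dlog_fps_adams:
  assumes "d > 0" "has_dlog F A"
  shows "has_dlog (fps_adams d F) (of_nat d * fps_adams d A)"
  using assms by (simp add: has_dlog_def theta_fps_adams fps_adams_mult fps_adams_nth mult.left_commute)

text \<open>
  This is the identity \<open>\<Sum>\<^sub>d d m\<^sub>d \<psi>\<^sub>d (\<Sum>\<^sub>k \<psi>\<^sub>k (\<theta> V)) = \<Sum>\<^sub>n (\<Sum>\<^bsub>d | n\<^esub> d m\<^sub>d) \<psi>\<^sub>n (\<theta> V) = \<Sum>\<^sub>n \<psi>\<^sub>n (a \<theta> V)\<close>,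
  written for the coefficient of \<open>T\<^sup>j\<close>.
\<close>

lemma plog_deriv_scale:
  assumes m: "\<And>n. n > 0 \<Longrightarrow> (\<Sum>d | d dvd n. of_nat d * m d) = mls_subst_power n a"
  assumes j: "j > 0"
  shows "(\<Sum>d | d dvd j. of_nat d * m d * fps_nth (fps_adams d (plog_deriv V)) j) =
    fps_nth (plog_deriv (fps_const a * V)) j"
proof -
  let ?D = "\<lambda>n. {d. d dvd n}"
  have pos: "d > 0" if "d dvd j" for d using that j by (rule dvd_pos_nat[rotated])
  have fin: "finite (?D (j div d))" if "d dvd j" for d
    using dvd_div_pos[OF that j] by simp
  have iff: "(d dvd j \<and> e dvd j div d) = (e dvd j \<and> d dvd j div e)" for d e
  proof -
    have *: "d dvd j \<and> e dvd j div d \<longleftrightarrow> d * e dvd j" for d e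
    proof (cases "d dvd j")
      case True
      hence "d \<noteq> 0" using j by auto
      thus ?thesis using True dvd_div_iff_mult[OF _ True, of e] by (simp add: mult.commute)
    next
      case False
      thus ?thesis using dvd_mult_left by blast
    qed
    show ?thesis unfolding * by (simp only: mult.commute)
  qed
  have "(\<Sum>d\<in>?D j. of_nat d * m d * fps_nth (fps_adams d (plog_deriv V)) j) =
    (\<Sum>d\<in>?D j. \<Sum>e\<in>?D (j div d). (of_nat d * m d) * (of_nat e * mls_subst_power (j div e) (fps_nth V e)))"
  proof (intro sum.cong refl)
    fix d assume "d \<in> ?D j"
    hence d: "d dvd j" by simp
    have "fps_nth (fps_adams d (plog_deriv V)) j =
      (\<Sum>e\<in>?D (j div d). of_nat e * mls_subst_power d (mls_subst_power (j div d div e) (fps_nth V e)))"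
      using d pos[OF d] dvd_div_pos[OF d j]
      by (simp add: fps_adams_nth plog_deriv_nth mls_subst_power_sum mls_subst_power_mult)
    also have "\<dots> = (\<Sum>e\<in>?D (j div d). of_nat e * mls_subst_power (j div e) (fps_nth V e))"
    proof (intro sum.cong refl)
      fix e assume "e \<in> ?D (j div d)"
      hence e: "e dvd j div d" by simp
      have "j div d div e > 0" by (rule dvd_div_pos[OF e dvd_div_pos[OF d j]])
      moreover have "d * (j div d div e) = j div e"
      proof -
        obtain k where "j div d = e * k" using e by (rule dvdE)
        hence "j = d * (e * k)" using d by (metis dvd_mult_div_cancel)
        thus ?thesis using j by simp
      qed
      ultimately show "of_nat e * mls_subst_power d (mls_subst_power (j div d div e) (fps_nth V e)) =
          of_nat e * mls_subst_power (j div e) (fps_nth V e)"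
        using mls_subst_power_subst_power[OF pos[OF d], of "j div d div e" "fps_nth V e"] by simp
    qed
    finally show "of_nat d * m d * fps_nth (fps_adams d (plog_deriv V)) j =
      (\<Sum>e\<in>?D (j div d). (of_nat d * m d) * (of_nat e * mls_subst_power (j div e) (fps_nth V e)))"
      by (simp add: sum_distrib_left)
  qed
  also have "\<dots> = (\<Sum>(d, e)\<in>Sigma (?D j) (\<lambda>d. ?D (j div d)).
      (of_nat d * m d) * (of_nat e * mls_subst_power (j div e) (fps_nth V e)))"
    using j fin by (subst sum.Sigma) auto
  also have "\<dots> = (\<Sum>(e, d)\<in>Sigma (?D j) (\<lambda>e. ?D (j div e)).
      (of_nat d * m d) * (of_nat e * mls_subst_power (j div e) (fps_nth V e)))"
    by (rule sum.reindex_bij_witness[of _ prod.swap prod.swap]) (use iff in auto)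
  also have "\<dots> = (\<Sum>e\<in>?D j. \<Sum>d\<in>?D (j div e).
      (of_nat d * m d) * (of_nat e * mls_subst_power (j div e) (fps_nth V e)))"
    using j fin by (subst sum.Sigma) auto
  also have "\<dots> = (\<Sum>e\<in>?D j. of_nat e * mls_subst_power (j div e) (a * fps_nth V e))"
  proof (intro sum.cong refl)
    fix e assume "e \<in> ?D j"
    hence e: "e dvd j" by simp
    have "(\<Sum>d\<in>?D (j div e). (of_nat d * m d) * (of_nat e * mls_subst_power (j div e) (fps_nth V e))) =
      mls_subst_power (j div e) a * (of_nat e * mls_subst_power (j div e) (fps_nth V e))"
      unfolding sum_distrib_right[symmetric] m[OF dvd_div_pos[OF e j]] ..
    thus "(\<Sum>d\<in>?D (j div e). (of_nat d * m d) * (of_nat e * mls_subst_power (j div e) (fps_nth V e))) =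
      of_nat e * mls_subst_power (j div e) (a * fps_nth V e)"
      using dvd_div_pos[OF e j] by (simp add: mls_subst_power_mult mult.left_commute)
  qed
  also have "\<dots> = fps_nth (plog_deriv (fps_const a * V)) j"
    using j by (simp add: plog_deriv_nth)
  finally show ?thesis .
qed

section \<open>Types of a given degree\<close>

definition types_of_degree :: "'c coloring_data \<Rightarrow> nat \<Rightarrow> 'c ctype set" where
  "types_of_degree C n = {\<tau> \<in> ctypes C. ctype_degree C \<tau> = n}"

lemma ctype_degree_ge:
  assumes "\<tau> \<in> ctypes C"
  shows "\<tau> d c * d * cdeg C c \<le> ctype_degree C \<tau>"
proof (cases "\<tau> d c = 0")
  case False
  hence "(d, c) \<in> ctype_supp \<tau>" by (simp add: ctype_supp_def)
  from member_le_sum[OF this, of "\<lambda>(d, c). \<tau> d c * d * cdeg C c"] ctypes_finite_supp[OF assms]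
  show ?thesis by (simp add: ctype_degree_def)
qed simp

context
  fixes C :: "'c coloring_data" and N :: nat
  assumes C: "is_coloring_data N C"
begin

lemma types_of_degree_bounds:
  assumes "\<tau> \<in> types_of_degree C n" "\<tau> d c \<noteq> 0"
  shows "\<tau> d c \<le> n" "d \<in> {1..n}" "c \<in> colors C - {zero_color C}" "cdeg C c \<le> n"
proof -
  have \<tau>: "\<tau> \<in> ctypes C" "ctype_degree C \<tau> = n" using assms(1) by (auto simp: types_of_degree_def)
  have dc: "d \<ge> 1" "c \<in> colors C - {zero_color C}" using ctypes_supp[OF \<tau>(1) assms(2)] by auto
  have pos: "cdeg C c \<ge> 1" using cdeg_pos[OF C dc(2)] by simp
  have le: "\<tau> d c * d * cdeg C c \<le> n" using ctype_degree_ge[OF \<tau>(1)] \<tau>(2) by simp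
  have "\<tau> d c * 1 * 1 \<le> \<tau> d c * d * cdeg C c" using dc(1) pos by (intro mult_mono) auto
  from order_trans[OF this le] show "\<tau> d c \<le> n" by simp
  have "1 * d * 1 \<le> \<tau> d c * d * cdeg C c" using assms(2) pos by (intro mult_mono) auto
  from order_trans[OF this le] show "d \<in> {1..n}" using dc(1) by simp
  have "1 * 1 * cdeg C c \<le> \<tau> d c * d * cdeg C c" using assms(2) dc(1) by (intro mult_mono) auto
  from order_trans[OF this le] show "cdeg C c \<le> n" by simp
  show "c \<in> colors C - {zero_color C}" by (rule dc)
qed

lemma finite_colors_le: "finite {c \<in> colors C. cdeg C c \<le> n}"
proof -
  have "{c \<in> colors C. cdeg C c \<le> n} = (\<Union>k\<le>n. {c \<in> colors C. cdeg C c = k})" by auto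
  thus ?thesis using C by (simp add: is_coloring_data_def)
qed

lemma finite_types_of_degree: "finite (types_of_degree C n)"
proof (rule finite_imageD)
  define K where "K = {1..n} \<times> {c \<in> colors C. cdeg C c \<le> n}"
  have "case_prod ` types_of_degree C n \<subseteq>
    {f. \<forall>x. (x \<in> K \<longrightarrow> f x \<in> {0..n}) \<and> (x \<notin> K \<longrightarrow> f x = 0)}"
  proof
    fix f assume "f \<in> case_prod ` types_of_degree C n"
    then obtain \<tau> where \<tau>: "\<tau> \<in> types_of_degree C n" and f: "f = case_prod \<tau>" by blast
    have "(x \<in> K \<longrightarrow> f x \<in> {0..n}) \<and> (x \<notin> K \<longrightarrow> f x = 0)" for x
    proof (cases x)
      case (Pair d c)
      show ?thesis
        using types_of_degree_bounds[OF \<tau>, of d c]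
        by (cases "\<tau> d c = 0") (auto simp: K_def f Pair)
    qed
    thus "f \<in> {f. \<forall>x. (x \<in> K \<longrightarrow> f x \<in> {0..n}) \<and> (x \<notin> K \<longrightarrow> f x = 0)}" by blast
  qed
  moreover have "finite K" unfolding K_def using finite_colors_le by simp
  hence "finite {f. \<forall>x. (x \<in> K \<longrightarrow> f x \<in> {0..n}) \<and> (x \<notin> K \<longrightarrow> f x = 0)}"
    by (rule finite_set_of_finite_funs) simp
  ultimately show "finite (case_prod ` types_of_degree C n)" by (rule finite_subset)
  show "inj_on case_prod (types_of_degree C n)"
    by (auto simp: inj_on_def fun_eq_iff)
qed

lemma types_of_degree_0: "types_of_degree C 0 = {\<lambda>_ _. 0}"
proof (intro equalityI subsetI)
  fix \<tau> assume "\<tau> \<in> types_of_degree C 0"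
  hence "\<tau> d c = 0" for d c using types_of_degree_bounds(2)[of \<tau> 0 d c] by auto
  thus "\<tau> \<in> {\<lambda>_ _. 0}" by (simp add: fun_eq_iff)
next
  fix \<tau> :: "'c ctype" assume "\<tau> \<in> {\<lambda>_ _. 0}"
  thus "\<tau> \<in> types_of_degree C 0"
    by (simp add: types_of_degree_def ctypes_def ctype_supp_def ctype_degree_def)
qed

lemma degree_as_sum:
  assumes \<tau>: "\<tau> \<in> types_of_degree C n"
  shows "(\<Sum>d\<in>{1..n}. \<Sum>c | \<tau> d c \<noteq> 0. d * cdeg C c * \<tau> d c) = n"
proof -
  have ct: "\<tau> \<in> ctypes C" "ctype_degree C \<tau> = n" using \<tau> by (auto simp: types_of_degree_def)
  have "ctype_supp \<tau> = Sigma {1..n} (\<lambda>d. {c. \<tau> d c \<noteq> 0})"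
    using types_of_degree_bounds(2)[OF \<tau>] by (auto simp: ctype_supp_def)
  hence "n = (\<Sum>(d, c)\<in>Sigma {1..n} (\<lambda>d. {c. \<tau> d c \<noteq> 0}). d * cdeg C c * \<tau> d c)"
    unfolding ct(2)[symmetric] ctype_degree_def by (simp add: ac_simps)
  thus ?thesis using finite_colors_of_type[OF ct(1)] by (subst sum.Sigma) auto
qed

section \<open>The generating function of the types\<close>

text \<open>
  The series \<open>\<Sum>\<^sub>c W(c) T\<^bsup>|c|\<^esup>\<close>, which turns out to be the coloring zeta function of the point.
\<close>

definition color_series :: "rat mls fps" where
  "color_series = Abs_fps (\<lambda>n. \<Sum>c | c \<in> colors C \<and> cdeg C c = n. weight C c)"

lemma color_series_0: "fps_nth color_series 0 = 1"
proof -
  have "{c. c \<in> colors C \<and> cdeg C c = 0} = {zero_color C}"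
    using zero_color[OF C] by blast
  thus ?thesis using C by (simp add: color_series_def is_coloring_data_def)
qed

lemma R_fps_color_series: "color_series \<in> R_fps N"
  using C by (auto simp: R_fps_def color_series_def is_coloring_data_def intro!: R_ring_sum)

lemma fps_adams_color_series:
  assumes d: "d \<ge> 1"
  shows "fps_nth (fps_adams d color_series) i =
    (\<Sum>c | c \<in> colors C \<and> d * cdeg C c = i. mls_subst_power d (weight C c))"
proof (cases "d dvd i")
  case True
  hence "cdeg C c = i div d \<longleftrightarrow> d * cdeg C c = i" for c using d by auto
  thus ?thesis using True d by (simp add: fps_adams_nth color_series_def mls_subst_power_sum)
next
  case False
  hence empty: "{c. c \<in> colors C \<and> d * cdeg C c = i} = {}" by auto
  show ?thesis unfolding empty using False by (simp add: fps_adams_nth)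
qed

text \<open>
  In the following \<open>p \<tau>\<close> plays the role of the number of colorings of type \<open>\<tau>\<close>, and \<open>m d\<close> the
  role of the number of orbits of size \<open>d\<close>; only the recursion between them is used. The sum in
  the recursion is the number of orbits of size \<open>d\<close> with nonzero color in a coloring of type
  \<open>\<sigma>\<close>.
\<close>

context
  fixes p :: "'c ctype \<Rightarrow> rat mls" and m :: "nat \<Rightarrow> rat mls"
  assumes p_zero: "p (\<lambda>_ _. 0) = 1"
  assumes p_incr: "\<And>\<sigma> d c. \<sigma> \<in> ctypes C \<Longrightarrow> d \<ge> 1 \<Longrightarrow> c \<in> colors C - {zero_color C} \<Longrightarrow>
    of_nat (Suc (\<sigma> d c)) * p (incr_type d c \<sigma>) = (m d - of_nat (\<Sum>c | \<sigma> d c \<noteq> 0. \<sigma> d c)) * p \<sigma>"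
begin

text \<open>
  The generating function of the colorings, and the one of the pairs of a coloring and an
  uncolored orbit of size \<open>d\<close>.
\<close>

definition type_series :: "rat mls fps" where
  "type_series = Abs_fps (\<lambda>n. \<Sum>\<tau>\<in>types_of_degree C n. p \<tau> * ctype_weight C \<tau>)"

definition free_orbit_series :: "nat \<Rightarrow> rat mls fps" where
  "free_orbit_series d = Abs_fps (\<lambda>n. \<Sum>\<tau>\<in>types_of_degree C n.
     (m d - of_nat (\<Sum>c | \<tau> d c \<noteq> 0. \<tau> d c)) * p \<tau> * ctype_weight C \<tau>)"

text \<open>
  The left-hand side counts colorings with a marked orbit of size \<open>d\<close> and nonzero color, where an
  orbit with color \<open>c\<close> has the additional weight \<open>h |c|\<close>. Such a pair is the same as a coloring
  with an uncolored orbit of size \<open>d\<close> and a nonzero color for this orbit.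
\<close>

lemma mark_orbit:
  fixes h :: "nat \<Rightarrow> rat mls"
  assumes d: "d \<ge> 1"
  shows "(\<Sum>\<tau>\<in>types_of_degree C n. (\<Sum>c | \<tau> d c \<noteq> 0. h (cdeg C c) * of_nat (\<tau> d c)) * p \<tau> * ctype_weight C \<tau>) =
    fps_nth (Abs_fps (\<lambda>i. \<Sum>c | c \<in> colors C - {zero_color C} \<and> d * cdeg C c = i.
      h (cdeg C c) * mls_subst_power d (weight C c)) * free_orbit_series d) n"
proof -
  define K where "K = {c \<in> colors C - {zero_color C}. d * cdeg C c \<le> n}"
  let ?w = "\<lambda>c. mls_subst_power d (weight C c)"
  let ?inc = "\<lambda>(c, \<sigma>). (incr_type d c \<sigma>, c)"
  let ?dec = "\<lambda>(\<tau>, c). (c, \<tau>(d := (\<tau> d)(c := \<tau> d c - 1)))"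
  have finK: "finite K"
  proof (rule finite_subset)
    show "K \<subseteq> {c \<in> colors C. cdeg C c \<le> n}"
      using d unfolding K_def by (auto intro: order_trans[rotated])
  qed (rule finite_colors_le)
  have "(\<Sum>\<tau>\<in>types_of_degree C n. (\<Sum>c | \<tau> d c \<noteq> 0. h (cdeg C c) * of_nat (\<tau> d c)) * p \<tau> * ctype_weight C \<tau>) =
    (\<Sum>\<tau>\<in>types_of_degree C n. \<Sum>c | \<tau> d c \<noteq> 0. h (cdeg C c) * (of_nat (\<tau> d c) * p \<tau>) * ctype_weight C \<tau>)"
    by (simp add: sum_distrib_right mult.assoc)
  also have "\<dots> = (\<Sum>(\<tau>, c)\<in>Sigma (types_of_degree C n) (\<lambda>\<tau>. {c. \<tau> d c \<noteq> 0}).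
      h (cdeg C c) * (of_nat (\<tau> d c) * p \<tau>) * ctype_weight C \<tau>)"
    using finite_types_of_degree finite_colors_of_type
    by (subst sum.Sigma) (auto simp: types_of_degree_def)
  also have "\<dots> = (\<Sum>(c, \<sigma>)\<in>Sigma K (\<lambda>c. types_of_degree C (n - d * cdeg C c)).
      h (cdeg C c) * ?w c * ((m d - of_nat (\<Sum>c | \<sigma> d c \<noteq> 0. \<sigma> d c)) * p \<sigma> * ctype_weight C \<sigma>))"
    (is "sum ?f ?S = sum ?f' ?S'")
  proof (rule sum.reindex_bij_witness[of _ ?inc ?dec])
    fix a assume "a \<in> ?S"
    then obtain \<tau> c where a: "a = (\<tau>, c)" and \<tau>: "\<tau> \<in> types_of_degree C n" and nz: "\<tau> d c \<noteq> 0"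
      by blast
    let ?\<sigma> = "\<tau>(d := (\<tau> d)(c := \<tau> d c - 1))"
    have ct: "\<tau> \<in> ctypes C" "ctype_degree C \<tau> = n" using \<tau> by (auto simp: types_of_degree_def)
    have c: "c \<in> colors C - {zero_color C}" using ctypes_supp[OF ct(1)] nz by blast
    have eq: "incr_type d c ?\<sigma> = \<tau>"
      using nz by (intro ext) (simp add: incr_type_apply)
    obtain \<sigma>' where "\<sigma>' \<in> ctypes C" "\<tau> = incr_type d c \<sigma>'"
      using ctypes_decr[OF ct(1)] nz by blast
    hence \<sigma>: "?\<sigma> \<in> ctypes C" using eq incr_type_inject by metis
    have deg: "n = ctype_degree C ?\<sigma> + d * cdeg C c"
      using ctype_degree_incr_type[OF ctypes_finite_supp[OF \<sigma>], of C d c] unfolding eq ct(2) .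
    have "c \<in> K" using c deg by (simp add: K_def)
    moreover have "?\<sigma> \<in> types_of_degree C (n - d * cdeg C c)"
      using \<sigma> deg by (simp add: types_of_degree_def)
    ultimately show "?dec a \<in> ?S'" unfolding a by simp
    show "?inc (?dec a) = a" by (simp only: a prod.case eq)
    have "of_nat (\<tau> d c) * p \<tau> = (m d - of_nat (\<Sum>b | ?\<sigma> d b \<noteq> 0. ?\<sigma> d b)) * p ?\<sigma>"
      using p_incr[OF \<sigma> d c] nz unfolding eq by simp
    moreover have "ctype_weight C \<tau> = ?w c * ctype_weight C ?\<sigma>"
      using ctype_weight_incr_type[OF ctypes_finite_supp[OF \<sigma>], of C d c] unfolding eq .
    ultimately have "h (cdeg C c) * ?w c *
       ((m d - of_nat (\<Sum>b | ?\<sigma> d b \<noteq> 0. ?\<sigma> d b)) * p ?\<sigma> * ctype_weight C ?\<sigma>) =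
       h (cdeg C c) * (of_nat (\<tau> d c) * p \<tau>) * ctype_weight C \<tau>"
      by (simp only: ac_simps)
    thus "?f' (?dec a) = ?f a" unfolding a prod.case .
  next
    fix b assume "b \<in> ?S'"
    then obtain c \<sigma> where b: "b = (c, \<sigma>)" and c: "c \<in> K"
      and \<sigma>: "\<sigma> \<in> types_of_degree C (n - d * cdeg C c)"
      by blast
    have "(incr_type d c \<sigma>)(d := (incr_type d c \<sigma> d)(c := incr_type d c \<sigma> d c - 1)) = \<sigma>"
      by (intro ext) (simp add: incr_type_apply)
    thus "?dec (?inc b) = b" unfolding b prod.case by (rule arg_cong)
    have ct: "\<sigma> \<in> ctypes C" "ctype_degree C \<sigma> = n - d * cdeg C c"
      using \<sigma> by (auto simp: types_of_degree_def)
    have "incr_type d c \<sigma> \<in> types_of_degree C n"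
      using c ct d by (auto simp: types_of_degree_def K_def ctype_degree_incr_type ctypes_finite_supp
          intro: incr_type_in_ctypes)
    moreover have "incr_type d c \<sigma> d c \<noteq> 0" by (simp add: incr_type_apply)
    ultimately show "?inc b \<in> ?S" unfolding b by simp
  qed
  also have "\<dots> = (\<Sum>c\<in>K. h (cdeg C c) * ?w c * fps_nth (free_orbit_series d) (n - d * cdeg C c))"
    using finK finite_types_of_degree
    by (subst sum.Sigma[symmetric]) (auto simp: free_orbit_series_def sum_distrib_left)
  also have "\<dots> = (\<Sum>i\<le>n. \<Sum>c | c \<in> K \<and> d * cdeg C c = i.
      h (cdeg C c) * ?w c * fps_nth (free_orbit_series d) (n - d * cdeg C c))"
    by (rule sum.group[symmetric]) (use finK in \<open>auto simp: K_def\<close>)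
  also have "\<dots> = (\<Sum>i\<le>n. (\<Sum>c | c \<in> colors C - {zero_color C} \<and> d * cdeg C c = i.
      h (cdeg C c) * ?w c) * fps_nth (free_orbit_series d) (n - i))"
    unfolding sum_distrib_right by (intro sum.cong refl) (auto simp: K_def)
  finally show ?thesis by (simp add: fps_mult_nth atLeast0AtMost)
qed

lemma nonzero_colors_eq:
  assumes "d \<ge> 1"
  shows "{c. c \<in> colors C - {zero_color C} \<and> d * cdeg C c = i} =
    (if i = 0 then {} else {c. c \<in> colors C \<and> d * cdeg C c = i})"
proof (cases "i = 0")
  case True
  have "d * cdeg C c > 0" if "c \<in> colors C - {zero_color C}" for c
    using cdeg_pos[OF C that] assms by simp
  hence "d * cdeg C c \<noteq> 0" if "c \<in> colors C - {zero_color C}" for c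
    using that by (metis less_numeral_extra(3))
  thus ?thesis using True by auto
next
  case False
  hence "c \<noteq> zero_color C" if "d * cdeg C c = i" for c
    using that zero_color(2)[OF C] by auto
  thus ?thesis using False by auto
qed

text \<open>
  An orbit of size \<open>d\<close> is uncolored or has a nonzero color; the latter case is \<open>mark_orbit\<close>
  with \<open>h = 1\<close>.
\<close>

lemma type_series_mult:
  assumes d: "d \<ge> 1"
  shows "fps_const (m d) * type_series = fps_adams d color_series * free_orbit_series d"
proof -
  have G: "Abs_fps (\<lambda>i. \<Sum>c | c \<in> colors C - {zero_color C} \<and> d * cdeg C c = i.
      1 * mls_subst_power d (weight C c)) = fps_adams d color_series - 1"
  proof (rule fps_ext)
    fix i
    have "fps_nth (fps_adams d color_series) 0 = 1"
      using d by (simp add: fps_adams_nth color_series_0)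
    thus "fps_nth (Abs_fps (\<lambda>i. \<Sum>c | c \<in> colors C - {zero_color C} \<and> d * cdeg C c = i.
      1 * mls_subst_power d (weight C c))) i = fps_nth (fps_adams d color_series - 1) i"
      unfolding nonzero_colors_eq[OF d] by (simp add: fps_adams_color_series[OF d])
  qed
  have "fps_const (m d) * type_series - free_orbit_series d = (fps_adams d color_series - 1) * free_orbit_series d"
  proof (rule fps_ext)
    fix n
    have "fps_nth (fps_const (m d) * type_series - free_orbit_series d) n =
      (\<Sum>\<tau>\<in>types_of_degree C n. (\<Sum>c | \<tau> d c \<noteq> 0. 1 * of_nat (\<tau> d c)) * p \<tau> * ctype_weight C \<tau>)"
      by (simp add: type_series_def free_orbit_series_def sum_distrib_left algebra_simps
          flip: sum_subtractf)
    also have "\<dots> = fps_nth ((fps_adams d color_series - 1) * free_orbit_series d) n"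
      using mark_orbit[OF d, where n = n and h = "\<lambda>_. 1"] unfolding G .
    finally show "fps_nth (fps_const (m d) * type_series - free_orbit_series d) n =
      fps_nth ((fps_adams d color_series - 1) * free_orbit_series d) n" .
  qed
  thus ?thesis by (simp add: algebra_simps)
qed

text \<open>
  The degree of a coloring is the sum of \<open>d |c|\<close> over its orbits, where \<open>d\<close> is the size and
  \<open>c\<close> the color of the orbit. So \<open>\<theta>\<close> amounts to marking an orbit with this weight.
\<close>

lemma theta_type_series:
  "fps_nth (theta type_series) n =
    (\<Sum>d\<in>{1..n}. fps_nth (theta (fps_adams d color_series) * free_orbit_series d) n)"
proof -
  have G: "Abs_fps (\<lambda>i. \<Sum>c | c \<in> colors C - {zero_color C} \<and> d * cdeg C c = i.
      of_nat (d * cdeg C c) * mls_subst_power d (weight C c)) = theta (fps_adams d color_series)"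
    if d: "d \<ge> 1" for d
  proof (rule fps_ext)
    fix i
    have "(\<Sum>c | c \<in> colors C \<and> d * cdeg C c = i. of_nat (d * cdeg C c) * mls_subst_power d (weight C c)) =
      (\<Sum>c | c \<in> colors C \<and> d * cdeg C c = i. of_nat i * mls_subst_power d (weight C c))"
      by (intro sum.cong refl) auto
    thus "fps_nth (Abs_fps (\<lambda>i. \<Sum>c | c \<in> colors C - {zero_color C} \<and> d * cdeg C c = i.
      of_nat (d * cdeg C c) * mls_subst_power d (weight C c))) i = fps_nth (theta (fps_adams d color_series)) i"
      unfolding nonzero_colors_eq[OF d]
      by (cases "i = 0") (simp_all add: theta_nth fps_adams_color_series[OF d] sum_distrib_left del: of_nat_mult)
  qed
  have "fps_nth (theta type_series) n = (\<Sum>\<tau>\<in>types_of_degree C n. of_nat n * p \<tau> * ctype_weight C \<tau>)"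
    by (simp add: theta_nth type_series_def sum_distrib_left mult.assoc)
  also have "\<dots> = (\<Sum>\<tau>\<in>types_of_degree C n. \<Sum>d\<in>{1..n}.
      (\<Sum>c | \<tau> d c \<noteq> 0. of_nat (d * cdeg C c) * of_nat (\<tau> d c)) * p \<tau> * ctype_weight C \<tau>)"
  proof (rule sum.cong[OF refl])
    fix \<tau> assume \<tau>: "\<tau> \<in> types_of_degree C n"
    have "of_nat n = (of_nat (\<Sum>d\<in>{1..n}. \<Sum>c | \<tau> d c \<noteq> 0. d * cdeg C c * \<tau> d c) :: rat mls)"
      by (simp only: degree_as_sum[OF \<tau>])
    also have "\<dots> = (\<Sum>d\<in>{1..n}. \<Sum>c | \<tau> d c \<noteq> 0. of_nat (d * cdeg C c) * of_nat (\<tau> d c))"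
      by (simp only: of_nat_sum of_nat_mult)
    finally show "of_nat n * p \<tau> * ctype_weight C \<tau> = (\<Sum>d\<in>{1..n}.
      (\<Sum>c | \<tau> d c \<noteq> 0. of_nat (d * cdeg C c) * of_nat (\<tau> d c)) * p \<tau> * ctype_weight C \<tau>)"
      by (simp only: sum_distrib_right)
  qed
  also have "\<dots> = (\<Sum>d\<in>{1..n}. \<Sum>\<tau>\<in>types_of_degree C n.
      (\<Sum>c | \<tau> d c \<noteq> 0. of_nat (d * cdeg C c) * of_nat (\<tau> d c)) * p \<tau> * ctype_weight C \<tau>)"
    by (rule sum.swap)
  also have "\<dots> = (\<Sum>d\<in>{1..n}. fps_nth (theta (fps_adams d color_series) * free_orbit_series d) n)"
  proof (rule sum.cong[OF refl])
    fix d assume "d \<in> {1..n}"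
    hence d: "d \<ge> 1" by simp
    show "(\<Sum>\<tau>\<in>types_of_degree C n.
      (\<Sum>c | \<tau> d c \<noteq> 0. of_nat (d * cdeg C c) * of_nat (\<tau> d c)) * p \<tau> * ctype_weight C \<tau>) =
      fps_nth (theta (fps_adams d color_series) * free_orbit_series d) n"
      using mark_orbit[OF d, where n = n and h = "\<lambda>k. of_nat (d * k)"] unfolding G[OF d] .
  qed
  finally show ?thesis .
qed

lemma has_dlog_type_series:
  assumes V: "has_dlog color_series (plog_deriv V)"
  assumes m: "\<And>n. n > 0 \<Longrightarrow> (\<Sum>d | d dvd n. of_nat d * m d) = mls_subst_power n a"
  shows "has_dlog type_series (plog_deriv (fps_const a * V))"
  unfolding has_dlog_def
proof
  have "fps_nth type_series 0 = p (\<lambda>_ _. 0) * ctype_weight C (\<lambda>_ _. 0)"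
    by (simp add: type_series_def types_of_degree_0)
  thus "fps_nth type_series 0 = 1" by (simp add: p_zero ctype_weight_def ctype_supp_def)
next
  let ?A = "plog_deriv V" and ?B = "plog_deriv (fps_const a * V)"
  let ?f = "\<lambda>d j. of_nat d * m d * fps_nth (fps_adams d ?A) j"
  \<comment> \<open>Only divisors of \<open>j\<close> contribute, so the range of \<open>d\<close> can be the same for all \<open>j \<le> n\<close>.\<close>
  have B: "fps_nth ?B j = (\<Sum>d\<in>{1..n}. ?f d j)" if "j \<le> n" for j n
  proof (cases "j = 0")
    case True
    have "?f d 0 = 0" if "d \<in> {1..n}" for d
      using that by (simp add: fps_adams_nth)
    hence "(\<Sum>d\<in>{1..n}. ?f d j) = 0" using True by (intro sum.neutral) blast
    thus ?thesis using True by simp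
  next
    case False
    hence j: "j > 0" by simp
    have "(\<Sum>d | d dvd j. ?f d j) = (\<Sum>d\<in>{1..n}. ?f d j)"
    proof (rule sum.mono_neutral_left)
      show "{d. d dvd j} \<subseteq> {1..n}"
      proof
        fix d assume "d \<in> {d. d dvd j}"
        thus "d \<in> {1..n}"
          using dvd_pos_nat[OF j, of d] dvd_imp_le[of d j] j that by simp
      qed
    qed (auto simp: fps_adams_nth)
    thus ?thesis using plog_deriv_scale[OF m j, of V] by simp
  qed
  show "theta type_series = type_series * ?B"
  proof (rule fps_ext)
    fix n
    have "fps_nth (theta type_series) n =
      (\<Sum>d\<in>{1..n}. fps_nth (theta (fps_adams d color_series) * free_orbit_series d) n)"
      by (rule theta_type_series)
    also have "\<dots> = (\<Sum>d\<in>{1..n}. fps_nth (type_series * (fps_const (of_nat d * m d) * fps_adams d ?A)) n)"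
    proof (rule sum.cong[OF refl])
      fix d assume "d \<in> {1..n}"
      hence d: "d \<ge> 1" by simp
      have "theta (fps_adams d color_series) * free_orbit_series d =
        of_nat d * fps_adams d ?A * (fps_adams d color_series * free_orbit_series d)"
        using has_dlog_fps_adams[OF _ V, of d] d by (simp add: has_dlog_def ac_simps)
      also have "\<dots> = type_series * (fps_const (of_nat d * m d) * fps_adams d ?A)"
        unfolding type_series_mult[OF d, symmetric]
        by (simp add: ac_simps fps_of_nat[symmetric] flip: fps_const_mult)
      finally show "fps_nth (theta (fps_adams d color_series) * free_orbit_series d) n =
        fps_nth (type_series * (fps_const (of_nat d * m d) * fps_adams d ?A)) n" by simp
    qed
    also have "\<dots> = (\<Sum>d\<in>{1..n}. \<Sum>i\<le>n. fps_nth type_series i * ?f d (n - i))"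
      by (simp add: fps_mult_nth[of type_series] atLeast0AtMost)
    also have "\<dots> = (\<Sum>i\<le>n. fps_nth type_series i * (\<Sum>d\<in>{1..n}. ?f d (n - i)))"
      unfolding sum_distrib_left by (rule sum.swap)
    also have "\<dots> = (\<Sum>i\<le>n. fps_nth type_series i * fps_nth ?B (n - i))"
      by (simp add: B[where n = n])
    also have "\<dots> = fps_nth (type_series * ?B) n"
      by (simp add: fps_mult_nth atLeast0AtMost)
    finally show "fps_nth (theta type_series) n = fps_nth (type_series * ?B) n" .
  qed
qed

end

end

section \<open>Varieties with polynomial count\<close>

text \<open>
  The properties of a variety with polynomial count that determine its coloring zeta function. The
  assumptions do not involve the charts.
\<close>

locale polynomial_orbits =
  fixes Y :: "('k :: {field,finite}, 'x) variety" and A :: "rat poly"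
    and N :: nat and C :: "'c coloring_data"
  assumes C: "is_coloring_data N C"
    and frob: "periodic_map (frob Y) (points Y)"
    and count_fixed: "n \<ge> 1 \<Longrightarrow>
      of_nat (card {x \<in> points Y. (frob Y ^^ n) x = x}) = poly A (of_nat (CARD('k) ^ n))"
begin

lemma coloring_count: "r \<ge> 1 \<Longrightarrow> coloring_count Y r N C"
  by (intro coloring_count.intro coloring_count_axioms.intro periodic_map_funpow frob C)

abbreviation "orbits r \<equiv> periodic_map.orbits_of_size (frob Y ^^ r) (points Y)"
abbreviation "colorings_of r \<equiv> coloring_count.colorings_of_type Y r C"
text \<open>
  The number of orbits of size \<open>d\<close> with nonzero color in a coloring of type \<open>\<sigma>\<close>.
\<close>

abbreviation "used \<sigma> d \<equiv> (\<Sum>c | \<sigma> d c \<noteq> 0. \<sigma> d c)"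

lemma poly_orbit_poly_card:
  assumes r: "r \<ge> 1" and d: "d \<ge> 1"
  shows "poly (orbit_poly A d) (of_nat (CARD('k) ^ r)) = of_nat (card (orbits r d))"
proof (rule poly_orbit_poly[OF _ d])
  fix n :: nat assume n: "n \<ge> 1"
  interpret coloring_count Y r N C by (rule coloring_count[OF r])
  have "(\<Sum>d | d dvd n. of_nat d * of_nat (card (orbits r d))) =
    (of_nat (\<Sum>d | d dvd n. d * card (orbits r d)) :: rat)"
    by simp
  also have "\<dots> = of_nat (card {x \<in> points Y. (frob Y ^^ (r * n)) x = x})"
    using card_fixed[OF n] by (simp add: funpow_mult mult.commute)
  also have "\<dots> = poly A (of_nat (CARD('k) ^ (r * n)))"
    using r n by (intro count_fixed) simp
  finally show "(\<Sum>d | d dvd n. of_nat d * of_nat (card (orbits r d))) =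
    poly A (of_nat (CARD('k) ^ r) ^ n)"
    by (simp add: power_mult)
qed

lemma card_colorings_of_recursion:
  assumes \<sigma>: "\<sigma> \<in> ctypes C" and d: "d \<ge> 1" and c: "c \<in> colors C - {zero_color C}"
    and r: "r \<ge> 1" and fin: "finite (colorings_of r \<sigma>)"
  shows "of_nat (Suc (\<sigma> d c)) * of_nat (card (colorings_of r (incr_type d c \<sigma>))) =
    (poly (orbit_poly A d) (of_nat (CARD('k) ^ r)) - of_nat (used \<sigma> d)) *
      of_nat (card (colorings_of r \<sigma>))"
proof -
  interpret coloring_count Y r N C by (rule coloring_count[OF r])
  have "of_nat (Suc (\<sigma> d c)) * of_nat (card (colorings_of r (incr_type d c \<sigma>))) +
    of_nat (used \<sigma> d) * of_nat (card (colorings_of r \<sigma>)) =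
    (of_nat (card (orbits r d)) * of_nat (card (colorings_of r \<sigma>)) :: rat)"
    unfolding of_nat_mult[symmetric] of_nat_add[symmetric]
      colorings_of_type_recursion(2)[OF \<sigma> d c fin] ..
  thus ?thesis
    unfolding poly_orbit_poly_card[OF r d] by (simp only: left_diff_distrib eq_diff_eq)
qed

text \<open>
  Finiteness is carried along in the induction, since \<open>card\<close> is 0 on infinite sets.
\<close>

lemma ex_count_poly:
  assumes "\<tau> \<in> ctypes C"
  shows "(\<forall>r\<ge>1. finite (colorings_of r \<tau>)) \<and>
    (\<exists>P :: rat poly. \<forall>r\<ge>1. poly P (of_nat (CARD('k) ^ r)) = of_nat (card (colorings_of r \<tau>)))"
  using C assms
proof (induction rule: ctypes_induct)
  case zero
  have "colorings_of r (\<lambda>_ _. 0) = {\<lambda>_. zero_color C}" if "r \<ge> 1" for r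
    by (rule coloring_count.colorings_of_type_zero[OF coloring_count[OF that]])
  hence "\<forall>r\<ge>1. finite (colorings_of r (\<lambda>_ _. 0))"
    "\<forall>r\<ge>1. poly (1 :: rat poly) (of_nat (CARD('k) ^ r)) = of_nat (card (colorings_of r (\<lambda>_ _. 0)))"
    by simp_all
  thus ?case by (intro conjI exI[of _ "1 :: rat poly"])
next
  case (incr \<sigma> d c)
  note fin = incr.IH[THEN conjunct1]
  obtain P :: "rat poly" where P: "\<forall>r\<ge>1. poly P (of_nat (CARD('k) ^ r)) = of_nat (card (colorings_of r \<sigma>))"
    using incr.IH[THEN conjunct2] by (rule exE)
  define P' where "P' = smult (1 / of_nat (Suc (\<sigma> d c))) ((orbit_poly A d - of_nat (used \<sigma> d)) * P)"
  have "finite (colorings_of r (incr_type d c \<sigma>)) \<and>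
    poly P' (of_nat (CARD('k) ^ r)) = of_nat (card (colorings_of r (incr_type d c \<sigma>)))" if r: "r \<ge> 1" for r
  proof
    interpret coloring_count Y r N C by (rule coloring_count[OF r])
    have fr: "finite (colorings_of r \<sigma>)" using fin r by blast
    show "finite (colorings_of r (incr_type d c \<sigma>))"
      by (rule colorings_of_type_recursion(1)[OF incr.hyps fr])
    have "poly P' (of_nat (CARD('k) ^ r)) = 1 / of_nat (Suc (\<sigma> d c)) *
      ((poly (orbit_poly A d) (of_nat (CARD('k) ^ r)) - of_nat (used \<sigma> d)) *
        of_nat (card (colorings_of r \<sigma>)))"
      unfolding P'_def poly_smult poly_mult poly_diff poly_of_nat P[rule_format, OF r] ..
    also have "\<dots> = 1 / of_nat (Suc (\<sigma> d c)) *
      (of_nat (Suc (\<sigma> d c)) * of_nat (card (colorings_of r (incr_type d c \<sigma>))))"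
      unfolding card_colorings_of_recursion[OF incr.hyps r fr] ..
    also have "\<dots> = of_nat (card (colorings_of r (incr_type d c \<sigma>)))"
      by (simp del: of_nat_Suc)
    finally show "poly P' (of_nat (CARD('k) ^ r)) = of_nat (card (colorings_of r (incr_type d c \<sigma>)))" .
  qed
  thus ?case by (intro conjI exI[of _ P'] allI impI) simp_all
qed

lemma poly_eqI_count:
  fixes P Q :: "rat poly"
  assumes "\<And>r. r \<ge> 1 \<Longrightarrow> poly P (of_nat (CARD('k) ^ r)) = poly Q (of_nat (CARD('k) ^ r))"
  shows "P = Q"
proof (rule poly_eqI_infinite)
  have "inj (\<lambda>r. of_nat (CARD('k) ^ r) :: rat)"
    using card_field_ge_2[where 'k = 'k] by (auto simp: inj_def)
  hence "inj_on (\<lambda>r. of_nat (CARD('k) ^ r) :: rat) {1..}"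
    by (rule inj_on_subset) simp
  thus "infinite ((\<lambda>r. of_nat (CARD('k) ^ r) :: rat) ` {1..})"
    using infinite_Ici by (simp only: finite_image_iff not_False_eq_True)
qed (use assms in auto)

lemma poly_ctype_count_poly:
  assumes "\<tau> \<in> ctypes C" "r \<ge> 1"
  shows "poly (ctype_count_poly C Y \<tau>) (of_nat (CARD('k) ^ r)) = of_nat (card (colorings_of r \<tau>))"
proof -
  let ?Q = "\<lambda>P. \<forall>r\<ge>1. poly P (of_nat (CARD('k) ^ r)) =
    (of_nat (card {\<Lambda> \<in> colorings C Y r. coloring_type C Y r \<Lambda> = \<tau>}) :: rat)"
  have eq: "colorings_of r \<tau> = {\<Lambda> \<in> colorings C Y r. coloring_type C Y r \<Lambda> = \<tau>}" if "r \<ge> 1" for r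
    by (rule coloring_count.colorings_of_type_def[OF coloring_count[OF that]])
  obtain P where "?Q P" using ex_count_poly[OF assms(1)] eq by auto
  moreover from this have "P' = P" if "?Q P'" for P'
    using that by (intro poly_eqI_count) simp
  ultimately have "?Q (ctype_count_poly C Y \<tau>)"
    unfolding ctype_count_poly_def by (rule theI)
  thus ?thesis using assms(2) eq by simp
qed

lemma ctype_count_poly_zero: "ctype_count_poly C Y (\<lambda>_ _. 0) = 1"
proof (rule poly_eqI_count)
  fix r :: nat assume r: "r \<ge> 1"
  have "(\<lambda>_ _. 0) \<in> ctypes C" by (simp add: ctypes_def ctype_supp_def)
  from poly_ctype_count_poly[OF this r]
  show "poly (ctype_count_poly C Y (\<lambda>_ _. 0)) (of_nat (CARD('k) ^ r)) = poly 1 (of_nat (CARD('k) ^ r))"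
    by (simp add: coloring_count.colorings_of_type_zero[OF coloring_count[OF r]])
qed

lemma ctype_count_poly_incr:
  assumes \<sigma>: "\<sigma> \<in> ctypes C" and d: "d \<ge> 1" and c: "c \<in> colors C - {zero_color C}"
  shows "of_nat (Suc (\<sigma> d c)) * ctype_count_poly C Y (incr_type d c \<sigma>) =
    (orbit_poly A d - of_nat (used \<sigma> d)) * ctype_count_poly C Y \<sigma>"
proof (rule poly_eqI_count)
  fix r :: nat assume r: "r \<ge> 1"
  have fr: "finite (colorings_of r \<sigma>)" using ex_count_poly[OF \<sigma>] r by blast
  show "poly (of_nat (Suc (\<sigma> d c)) * ctype_count_poly C Y (incr_type d c \<sigma>)) (of_nat (CARD('k) ^ r)) =
    poly ((orbit_poly A d - of_nat (used \<sigma> d)) * ctype_count_poly C Y \<sigma>) (of_nat (CARD('k) ^ r))"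
    unfolding poly_mult poly_diff poly_of_nat poly_ctype_count_poly[OF \<sigma> r]
      poly_ctype_count_poly[OF incr_type_in_ctypes[OF \<sigma> d c] r]
    by (rule card_colorings_of_recursion[OF \<sigma> d c r fr])
qed

lemma has_dlog_coloring_zeta:
  assumes V: "has_dlog (color_series C) (plog_deriv V)"
  shows "has_dlog (coloring_zeta C Y) (plog_deriv (fps_const (at_q A) * V))"
proof -
  let ?p = "\<lambda>\<tau>. at_q (ctype_count_poly C Y \<tau>)" and ?m = "\<lambda>d. at_q (orbit_poly A d)"
  have p0: "?p (\<lambda>_ _. 0) = 1" by (simp add: ctype_count_poly_zero)
  have p1: "of_nat (Suc (\<sigma> d c)) * ?p (incr_type d c \<sigma>) = (?m d - of_nat (used \<sigma> d)) * ?p \<sigma>"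
    if "\<sigma> \<in> ctypes C" "d \<ge> 1" "c \<in> colors C - {zero_color C}" for \<sigma> d c
    using arg_cong[OF ctype_count_poly_incr[OF that], of at_q]
    by (simp only: at_q_mult at_q_diff at_q_of_nat)
  have m: "(\<Sum>d | d dvd n. of_nat d * ?m d) = mls_subst_power n (at_q A)" if n: "n > 0" for n
  proof -
    have "at_q (\<Sum>d | d dvd n. smult (of_nat d) (orbit_poly A d)) = mls_subst_power n (at_q A)"
      by (simp only: sum_orbit_poly[OF n] mls_subst_power_at_q[OF n])
    thus ?thesis by (simp add: at_q_sum at_q_smult mls_const_of_nat)
  qed
  have "coloring_zeta C Y = type_series C ?p"
    unfolding coloring_zeta_def types_of_degree_def[symmetric]
    by (rule type_series_def[where p = ?p and m = ?m, OF C p0 p1, symmetric])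
  thus ?thesis using has_dlog_type_series[where p = ?p and m = ?m, OF C p0 p1 V m] by simp
qed

end

lemma of_int_poly_eq_poly_map: "of_int (poly P x) = poly (map_poly of_int P) (of_int x :: rat)"
  by (induction P) (simp_all add: map_poly_pCons)

theorem theorem4:
  fixes Y :: "('k::{field,finite}, 'x) variety"
    and NY :: "int poly"
    and N :: nat
    and C :: "'c coloring_data"
  assumes "is_variety Y"
    and "polynomial_count Y NY"
    and "is_coloring_data N C"
  shows "coloring_zeta C Y \<in> R_fps N \<and> fps_nth (coloring_zeta C Y) 0 = 1 \<and>
    Log N (coloring_zeta C Y) =
      fps_const (at_q (map_poly of_int NY)) *
        Log N (coloring_zeta C (point_variety :: ('k, unit) variety))"
proof -
  note C = assms(3)
  let ?A = "map_poly of_int NY :: rat poly" and ?pt = "point_variety :: ('k, unit) variety"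
  have per: "periodic_map (frob Y) (points Y)"
    using frob_points[OF assms(1)] frob_periodic[OF assms(1)] finite_rational_points[OF assms(1)]
    by unfold_locales (auto simp: rational_points_eq_fixed[OF assms(1)])
  have count: "of_nat (card {x \<in> points Y. (frob Y ^^ n) x = x}) = poly ?A (of_nat (CARD('k) ^ n))"
    if "n \<ge> 1" for n
  proof -
    have "int (card {x \<in> points Y. (frob Y ^^ n) x = x}) = poly NY (int (CARD('k) ^ n))"
      using assms(2) that by (simp add: polynomial_count_def rational_points_eq_fixed[OF assms(1)])
    hence "(of_int (int (card {x \<in> points Y. (frob Y ^^ n) x = x})) :: rat) =
      of_int (poly NY (int (CARD('k) ^ n)))" by (rule arg_cong)
    also have "\<dots> = poly ?A (of_int (int (CARD('k) ^ n)))" by (rule of_int_poly_eq_poly_map)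
    finally show ?thesis by simp
  qed
  interpret Y: polynomial_orbits Y ?A N C
    by (rule polynomial_orbits.intro[OF C per count])
  \<comment> \<open>The point has only one geometric point, so no property of its chart is needed.\<close>
  have frob_pt: "frob ?pt = id" by (rule ext) simp
  interpret pt: polynomial_orbits ?pt 1 N C
    by (intro polynomial_orbits.intro periodic_map.intro C) (auto simp: frob_pt point_variety_def)
  obtain V where V: "is_Log N (color_series C) V"
    using ex_is_Log[OF R_fps_color_series[OF C] color_series_0[OF C]] by blast
  hence dlog: "has_dlog (color_series C) (plog_deriv V)" by (simp add: is_Log_iff)
  have "coloring_zeta C ?pt = color_series C"
    using pt.has_dlog_coloring_zeta[OF dlog] dlog by (intro has_dlog_unique) simp_all
  hence Log_pt: "Log N (coloring_zeta C ?pt) = V" using Log_eqI[OF V] by simp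
  let ?W = "fps_const (at_q ?A) * V"
  have W: "has_dlog (coloring_zeta C Y) (plog_deriv ?W)" by (rule Y.has_dlog_coloring_zeta[OF dlog])
  have W': "?W \<in> R_fps N"
    using V by (auto simp: is_Log_iff R_fps_def intro!: R_ring_mult R_ring_at_q)
  have "is_Log N (coloring_zeta C Y) ?W"
    using V W W' by (simp add: is_Log_iff)
  thus ?thesis
    using R_fps_plethystic_exp[OF W' W] has_dlog_0[OF W] Log_pt Log_eqI by metis
qed

end
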